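(* Let $\Omega \subset \mathbb{R}^n$ be compact, $\alpha>0$, and let $\mathcal{D} \in \mathbb{L}(\mathcal{M}(\Omega); C_0(\Omega))$ be defined by $\mathcal{D}\mu = \rho*\mu$, where $0 \not\equiv \rho \in C_0(\mathbb{R}^n)\cap L^2(\mathbb{R}^n)$ satisfies $\rho(-y)=\rho(y)$ for all $y$ and $\mathcal{F}[\rho]\ge 0$. Let $F: \mathcal{M}(\Omega)\to\mathbb{R}$ be convex, pre-differentiable, and $L$-smooth with respect to $\|\cdot\|_{\mathcal{D}}$ for some $L \ge 0$: $$F(\nu)-F(\mu)-\langle F'(\mu)|\nu-\mu\rangle \le \frac{L}{2}\|\nu-\mu\|_{\mathcal{D}}^2 \quad\text{for all } \nu,\mu\in\mathcal{M}(\Omega).$$ Let the step length $\tau>0$ satisfy $\tau L<1$, and let $G(\mu) = \alpha\|\mu\|_{\mathcal{M}(\Omega)} + \delta_{\ge 0}(\mu)$. Let $\kappa \in (0,1)$ and let $\{\mu^k\}_{k\ge1}$ be generated by the forward-backward method $\mu$FB (defined in the context) from some $\mu^0\in\mathcal{Z}(\Omega)$. Also suppose that (i) $F$ is bounded from below; (ii) $F'$ is continuous with respect to $\|\cdot\|_{\mathcal{D}}$ (as a map from $\mathcal{M}(\Omega)$ with the semi-norm $\|\cdot\|_{\mathcal{D}}$ to $C_0(\Omega)$ with the supremum norm); and (iii) the tolerance sequence $\{\epsilon_{k+1}\}_{k\in\mathbb{N}}\subset(0,\infty)$ satisfies $\sum_{k=0}^\infty\epsilon_{k+1}<\infty$.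 Then there exists a weak-$*$ limit point $\bar\mu$ of $\{\mu^k\}_{k\in\mathbb{N}}$ satisfying $0\in\partial[F+G](\bar\mu)$, and any two such points $\bar\mu,\hat\mu$ satisfy $\|\bar\mu-\hat\mu\|_{\mathcal{D}}=0$. If a point $\bar\mu$ satisfying both properties (being a weak-$*$ limit point of $\{\mu^k\}_{k\in\mathbb{N}}$ and $0\in\partial[F+G](\bar\mu)$) is unique, then $\mu^k\rightharpoonup\bar\mu$ weakly-$*$ in $\mathcal{M}(\Omega)$. In particular, this holds when there exists $\rho^{1/2}\in L^2(\mathbb{R}^n)\cap C_0(\mathbb{R}^n)$ with $\rho=\rho^{1/2}*\rho^{1/2}$ such that $V_{\rho^{1/2}}(\Omega)$ is fundamental for $C_0(\Omega)$.
   Context: All functions and measures are real-valued; $\mathbb{N}=\{0,1,2,\dots\}$. $\mathcal{M}(\Omega)$ is the space of finite Radon measures with the Radon (total variation) norm. $C_0(\Omega)$ (equal to $C(\Omega)$ for compact $\Omega$) is its designated predual, with dual product $\langle\phi|\mu\rangle=\int_\Omega\phi\,d\mu$; weak-$*$ convergence is with respect to it, and a weak-$*$ limit point of a sequence is the weak-$*$ limit of some subsequence. $\mathcal{Z}(\Omega)$ is the set of discrete measures (finite real combinations of Dirac measures at points of $\Omega$). $[\rho*\mu](x)=\int_\Omega\rho(x-y)\,d\mu(y)$; $\mathcal{F}$ is the Fourier transform; $\|\mu\|_{\mathcal{D}}=\sqrt{\langle\mathcal{D}\mu|\mu\rangle}$. $\delta_{\ge0}(\mu)$ equals $0$ if $\mu\ge0$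 and $\infty$ otherwise. $F$ is pre-differentiable if it is Fréchet differentiable with $F'(\mu)\in C_0(\Omega)$ (identified with its canonical image in $\mathcal{M}(\Omega)^*$) for all $\mu$. For convex $H:\mathcal{M}(\Omega)\to[-\infty,\infty]$, the pre-subdifferential is $\partial H(\mu)=\{\phi\in C_0(\Omega)\mid H(\nu)-H(\mu)\ge\langle\phi|\nu-\mu\rangle\ \forall\nu\in\mathcal{M}(\Omega)\}$. For a function $\phi$ on $\mathbb{R}^n$, $V_\phi(\Omega)=\{x\mapsto\phi(x-y)\mid y\in\Omega\}$ (as functions on $\Omega$). A subset $V$ of a normed space $X$ is fundamental if its linear span is dense in $X$. Method $\mu$FB: given $\mu^0\in\mathcal{Z}(\Omega)$, $\tau>0$, $\kappa\in(0,1)$ and tolerances $\epsilon_{k+1}>0$, for each $k\in\mathbb{N}$ let $v^k:=F'(\mu^k)$ and let $\mu^{k+1}\in\mathcal{Z}(\Omega)$, $\mu^{k+1}\ge0$, be computed so as to satisfy $$\tau[v^k+\alpha]+\mathcal{D}(\mu^{k+1}-\mu^k)\ge-\epsilon_{k+1}\ \text{ on }\Omega,$$ $$\tau[v^k+\alpha]+\mathcal{D}(\mu^{k+1}-\mu^k)\le\epsilon_{k+1}\ \text{ on }\operatorname{supp}\mu^{k+1},$$ $$\langle\tau[v^k+\alpha]+\mathcal{D}(\mu^{k+1}-\mu^k)|\mu^{k+1}\rangle\le\kappa\epsilon_{k+1}.$$ *)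

theory Defs
  imports "HOL-Probability.Probability"
begin

section \<open>Finite signed Radon measures\<close>

text \<open>
  A finite signed Borel measure is a real-valued, countably additive set function of bounded
  variation, extended by \<open>0\<close> to the sets that are not Borel. On a Euclidean space
  every such measure is Radon, so regularity is not a separate requirement.
\<close>

definition partition_sums :: "('a::topological_space set \<Rightarrow> real) \<Rightarrow> 'a set \<Rightarrow> real set" where
  "partition_sums m A =
     {(\<Sum>B\<in>P. \<bar>m B\<bar>) | P. finite P \<and> P \<subseteq> sets borel \<and> partition_on A P}"

definition signed_radon :: "('a::euclidean_space set \<Rightarrow> real) \<Rightarrow> bool" where
  "signed_radon m \<longleftrightarrow>
     (\<forall>A. A \<notin> sets borel \<longrightarrow> m A = 0) \<and>
     (\<forall>A :: nat \<Rightarrow> 'a set. range A \<subseteq> sets borel \<longrightarrow> disjoint_family A \<longrightarrow>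
        (\<lambda>i. m (A i)) sums m (\<Union>i. A i)) \<and>
     bdd_above (partition_sums m UNIV)"

lemma signed_radon_measure:
  fixes M :: "'a::euclidean_space measure"
  assumes "finite_measure M" "sets M = sets borel"
  shows "signed_radon (measure M)"
proof -
  interpret finite_measure M by fact
  have sp: "space M = UNIV" using sets_eq_imp_space_eq[OF assms(2)] by simp
  have "(\<Sum>B\<in>P. \<bar>measure M B\<bar>) \<le> measure M UNIV"
    if P: "finite P" "P \<subseteq> sets borel" "partition_on UNIV P" for P
  proof -
    have "disjoint_family_on (\<lambda>B. B) P"
      using P(3) by (auto simp: partition_on_def disjoint_def disjoint_family_on_def)
    then have "measure M (\<Union>B\<in>P. B) = (\<Sum>B\<in>P. measure M B)"
      using P assms(2) by (intro finite_measure_finite_Union) auto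
    then show ?thesis using P(3) by (simp add: partition_on_def)
  qed
  then have "bdd_above (partition_sums (measure M) UNIV)"
    unfolding partition_sums_def by (intro bdd_aboveI[of _ "measure M UNIV"]) auto
  then show ?thesis
    unfolding signed_radon_def using finite_measure_UNION assms(2)
    by (auto simp: measure_notin_sets)
qed

lemma partition_sums_nonempty:
  assumes "A \<in> sets borel" shows "partition_sums m A \<noteq> {}"
proof (cases "A = {}")
  case True
  then show ?thesis unfolding partition_sums_def
    using partition_on_empty by (auto intro!: exI[of _ "{}"])
next
  case False
  then have "partition_on A {A}" by (auto simp: partition_on_def disjoint_def)
  then show ?thesis unfolding partition_sums_def using assms by (auto intro!: exI[of _ "{A}"])
qed

lemma partition_sums_scale:
  "x \<in> partition_sums (\<lambda>A. c * m A) A \<Longrightarrow> \<exists>y\<in>partition_sums m A. x = \<bar>c\<bar> * y"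
proof -
  assume "x \<in> partition_sums (\<lambda>A. c * m A) A"
  then obtain P where P: "finite P" "P \<subseteq> sets borel" "partition_on A P"
    and x: "x = (\<Sum>B\<in>P. \<bar>c * m B\<bar>)"
    unfolding partition_sums_def by auto
  have "x = \<bar>c\<bar> * (\<Sum>B\<in>P. \<bar>m B\<bar>)" unfolding x by (simp add: abs_mult sum_distrib_left)
  then show ?thesis unfolding partition_sums_def using P by blast
qed

lemma partition_sums_add:
  "x \<in> partition_sums (\<lambda>A. m A + m' A) A \<Longrightarrow>
     \<exists>y\<in>partition_sums m A. \<exists>z\<in>partition_sums m' A. x \<le> y + z"
proof -
  assume "x \<in> partition_sums (\<lambda>A. m A + m' A) A"
  then obtain P where P: "finite P" "P \<subseteq> sets borel" "partition_on A P"
    and x: "x = (\<Sum>B\<in>P. \<bar>m B + m' B\<bar>)"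
    unfolding partition_sums_def by auto
  have "x \<le> (\<Sum>B\<in>P. \<bar>m B\<bar>) + (\<Sum>B\<in>P. \<bar>m' B\<bar>)"
    unfolding x sum.distrib[symmetric] by (intro sum_mono abs_triangle_ineq)
  then show ?thesis unfolding partition_sums_def using P by blast
qed

lemma signed_radon_add:
  assumes "signed_radon m" "signed_radon m'"
  shows "signed_radon (\<lambda>A. m A + m' A)"
proof -
  obtain b where b: "\<And>x. x \<in> partition_sums m UNIV \<Longrightarrow> x \<le> b"
    using assms(1) unfolding signed_radon_def bdd_above_def by blast
  obtain c where c: "\<And>x. x \<in> partition_sums m' UNIV \<Longrightarrow> x \<le> c"
    using assms(2) unfolding signed_radon_def bdd_above_def by blast
  have "x \<le> b + c" if "x \<in> partition_sums (\<lambda>A. m A + m' A) UNIV" for x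
    using partition_sums_add[OF that] b c by (meson add_mono order_trans)
  then have "bdd_above (partition_sums (\<lambda>A. m A + m' A) UNIV)" by (rule bdd_aboveI)
  then show ?thesis using assms unfolding signed_radon_def by (simp add: sums_add)
qed

lemma signed_radon_scale:
  assumes "signed_radon m"
  shows "signed_radon (\<lambda>A. c * m A)"
proof -
  obtain b where "\<And>x. x \<in> partition_sums m UNIV \<Longrightarrow> x \<le> b"
    using assms unfolding signed_radon_def bdd_above_def by blast
  then have "x \<le> \<bar>c\<bar> * b" if "x \<in> partition_sums (\<lambda>A. c * m A) UNIV" for x
    using partition_sums_scale[OF that] by (auto intro!: mult_left_mono)
  then have "bdd_above (partition_sums (\<lambda>A. c * m A) UNIV)" by (rule bdd_aboveI)
  then show ?thesis using assms unfolding signed_radon_def by (simp add: sums_mult)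
qed

lemma signed_radon_zero: "signed_radon (\<lambda>A. 0)"
proof -
  have "bdd_above (partition_sums (\<lambda>A. 0) UNIV)"
    by (rule bdd_aboveI[of _ 0]) (auto simp: partition_sums_def)
  then show ?thesis unfolding signed_radon_def by simp
qed

typedef (overloaded) ('a::euclidean_space) radon = "{m :: 'a set \<Rightarrow> real. signed_radon m}"
  morphisms mass Radon
  using signed_radon_zero by auto

setup_lifting type_definition_radon

definition total_variation :: "'a::euclidean_space radon \<Rightarrow> 'a set \<Rightarrow> real" where
  "total_variation \<mu> A = Sup (partition_sums (mass \<mu>) A)"

instantiation radon :: (euclidean_space) real_normed_vector
begin

lift_definition zero_radon :: "'a radon" is "\<lambda>A. 0"
  by (rule signed_radon_zero)

lift_definition plus_radon :: "'a radon \<Rightarrow> 'a radon \<Rightarrow> 'a radon" is "\<lambda>m m' A. m A + m' A"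
  by (rule signed_radon_add)

lift_definition scaleR_radon :: "real \<Rightarrow> 'a radon \<Rightarrow> 'a radon" is "\<lambda>c m A. c * m A"
  by (rule signed_radon_scale)

definition uminus_radon :: "'a radon \<Rightarrow> 'a radon" where "- \<mu> = (- 1) *\<^sub>R (\<mu> :: 'a radon)"
definition minus_radon :: "'a radon \<Rightarrow> 'a radon \<Rightarrow> 'a radon" where "\<mu> - \<nu> = \<mu> + - (\<nu> :: 'a radon)"
definition norm_radon :: "'a radon \<Rightarrow> real" where "norm \<mu> = total_variation (\<mu> :: 'a radon) UNIV"
definition dist_radon :: "'a radon \<Rightarrow> 'a radon \<Rightarrow> real" where "dist \<mu> \<nu> = norm (\<mu> - \<nu> :: 'a radon)"
definition sgn_radon :: "'a radon \<Rightarrow> 'a radon" where "sgn \<mu> = inverse (norm \<mu>) *\<^sub>R (\<mu> :: 'a radon)"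
definition uniformity_radon :: "('a radon \<times> 'a radon) filter" where
  "uniformity = (INF e\<in>{0<..}. principal {(\<mu>, \<nu> :: 'a radon). dist \<mu> \<nu> < e})"
definition open_radon :: "'a radon set \<Rightarrow> bool" where
  "open U = (\<forall>\<mu>\<in>U. eventually (\<lambda>(\<mu>', \<nu> :: 'a radon). \<mu>' = \<mu> \<longrightarrow> \<nu> \<in> U) uniformity)"

instance
proof
  fix \<mu> \<nu> \<xi> :: "'a radon" and a b :: real
  show "\<mu> + \<nu> + \<xi> = \<mu> + (\<nu> + \<xi>)" "\<mu> + \<nu> = \<nu> + \<mu>" "0 + \<mu> = \<mu>"
    by (transfer; simp add: add_ac)+
  show "- \<mu> + \<mu> = 0" unfolding uminus_radon_def by transfer simp
  show "\<mu> - \<nu> = \<mu> + - \<nu>" by (rule minus_radon_def)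
  show "a *\<^sub>R (\<mu> + \<nu>) = a *\<^sub>R \<mu> + a *\<^sub>R \<nu>" "(a + b) *\<^sub>R \<mu> = a *\<^sub>R \<mu> + b *\<^sub>R \<mu>"
    by (transfer; simp add: algebra_simps)+
  show "a *\<^sub>R b *\<^sub>R \<mu> = (a * b) *\<^sub>R \<mu>" "1 *\<^sub>R \<mu> = \<mu>"
    by (transfer; simp add: algebra_simps)+
  show "dist \<mu> \<nu> = norm (\<mu> - \<nu>)" by (rule dist_radon_def)
  show "sgn \<mu> = inverse (norm \<mu>) *\<^sub>R \<mu>" by (rule sgn_radon_def)
  show "uniformity = (INF e\<in>{0<..}. principal {(\<mu>, \<nu> :: 'a radon). dist \<mu> \<nu> < e})"
    by (rule uniformity_radon_def)
  show "open U = (\<forall>\<mu>\<in>U. eventually (\<lambda>(\<mu>', \<nu>). \<mu>' = \<mu> \<longrightarrow> \<nu> \<in> U) uniformity)" for U :: "'a radon set"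
    by (rule open_radon_def)
  have ne: "partition_sums (mass \<mu>) UNIV \<noteq> {}" for \<mu> :: "'a radon"
    by (rule partition_sums_nonempty) auto
  have bdd: "bdd_above (partition_sums (mass \<mu>) UNIV)" for \<mu> :: "'a radon"
    by transfer (simp add: signed_radon_def)
  have upper: "x \<le> norm \<mu>" if "x \<in> partition_sums (mass \<mu>) UNIV" for x and \<mu> :: "'a radon"
    unfolding norm_radon_def total_variation_def by (rule cSup_upper[OF that bdd])
  have least: "norm \<mu> \<le> b" if "\<And>x. x \<in> partition_sums (mass \<mu>) UNIV \<Longrightarrow> x \<le> b"
    for b and \<mu> :: "'a radon"
    unfolding norm_radon_def total_variation_def by (rule cSup_least[OF ne that])
  have nonneg: "0 \<le> norm \<mu>" for \<mu> :: "'a radon"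
  proof -
    obtain x where x: "x \<in> partition_sums (mass \<mu>) UNIV" using ne by blast
    then have "0 \<le> x" unfolding partition_sums_def by (auto intro: sum_nonneg)
    then show ?thesis using upper[OF x] by simp
  qed
  show "norm (\<mu> + \<nu>) \<le> norm \<mu> + norm \<nu>"
  proof (rule least)
    fix x assume "x \<in> partition_sums (mass (\<mu> + \<nu>)) UNIV"
    then have "x \<in> partition_sums (\<lambda>A. mass \<mu> A + mass \<nu> A) UNIV"
      by (simp add: plus_radon.rep_eq)
    then obtain y z where "y \<in> partition_sums (mass \<mu>) UNIV"
      "z \<in> partition_sums (mass \<nu>) UNIV" "x \<le> y + z"
      using partition_sums_add by blast
    then show "x \<le> norm \<mu> + norm \<nu>" using upper[of y \<mu>] upper[of z \<nu>] by linarith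
  qed
  have scale_le: "norm (c *\<^sub>R \<mu>) \<le> \<bar>c\<bar> * norm \<mu>" for c and \<mu> :: "'a radon"
  proof (rule least)
    fix x assume "x \<in> partition_sums (mass (c *\<^sub>R \<mu>)) UNIV"
    then have "x \<in> partition_sums (\<lambda>A. c * mass \<mu> A) UNIV"
      by (simp add: scaleR_radon.rep_eq)
    from partition_sums_scale[OF this] show "x \<le> \<bar>c\<bar> * norm \<mu>"
      using upper by (auto intro!: mult_left_mono)
  qed
  show zero: "(norm \<mu> = 0) = (\<mu> = 0)"
  proof
    assume "\<mu> = 0"
    moreover have "(0::real) *\<^sub>R (0 :: 'a radon) = 0" by transfer simp
    ultimately show "norm \<mu> = 0"
      using nonneg[of "0 :: 'a radon"] scale_le[of 0 "0 :: 'a radon"] by simp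
  next
    assume n0: "norm \<mu> = 0"
    have "mass \<mu> A = 0" for A
    proof (cases "A \<in> sets borel")
      case False
      then show ?thesis by transfer (simp add: signed_radon_def)
    next
      case True
      show ?thesis
      proof (cases "A = {}")
        case True
        have "(\<lambda>i::nat. mass \<mu> {}) sums mass \<mu> (\<Union>i::nat. {})"
          using mass[of \<mu>] unfolding signed_radon_def mem_Collect_eq
          by (auto simp: disjoint_family_on_def dest: spec[where x="\<lambda>i::nat. {}"])
        then have "summable (\<lambda>i::nat. mass \<mu> {})" by (rule sums_summable)
        then show ?thesis using True by (simp add: summable_const_iff)
      next
        case False
        let ?P = "{A, - A} - {{}}"
        have "partition_on UNIV ?P" by (auto simp: partition_on_def disjoint_def)
        then have "(\<Sum>B\<in>?P. \<bar>mass \<mu> B\<bar>) \<in> partition_sums (mass \<mu>) UNIV"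
          unfolding partition_sums_def using \<open>A \<in> sets borel\<close>
          by (intro CollectI exI[of _ ?P]) auto
        then have "(\<Sum>B\<in>?P. \<bar>mass \<mu> B\<bar>) \<le> 0" using upper[of _ \<mu>] n0 by simp
        moreover have "\<bar>mass \<mu> A\<bar> \<le> (\<Sum>B\<in>?P. \<bar>mass \<mu> B\<bar>)"
          using False by (intro member_le_sum) auto
        ultimately show ?thesis by simp
      qed
    qed
    then show "\<mu> = 0" by transfer auto
  qed
  show "norm (a *\<^sub>R \<mu>) = \<bar>a\<bar> * norm \<mu>"
  proof (cases "a = 0")
    case True
    have "(0::real) *\<^sub>R \<mu> = 0" by transfer simp
    then show ?thesis using True scale_le[of 0 \<mu>] nonneg[of "0 :: 'a radon"] by simp
  next
    case False
    have "inverse a *\<^sub>R a *\<^sub>R \<mu> = \<mu>" using False by transfer (simp add: field_simps)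
    then have "norm \<mu> \<le> \<bar>inverse a\<bar> * norm (a *\<^sub>R \<mu>)" using scale_le[of "inverse a" "a *\<^sub>R \<mu>"] by simp
    then have "\<bar>a\<bar> * norm \<mu> \<le> norm (a *\<^sub>R \<mu>)" using False by (simp add: field_simps)
    then show ?thesis using scale_le[of a \<mu>] by simp
  qed
qed

end

lemma mass_uminus: "mass (- \<mu>) A = - mass \<mu> A"
  unfolding uminus_radon_def scaleR_radon.rep_eq by simp

lemma mass_sums:
  fixes \<mu> :: "'a::euclidean_space radon" and A :: "nat \<Rightarrow> 'a set"
  assumes "range A \<subseteq> sets borel" "disjoint_family A"
  shows "(\<lambda>i. mass \<mu> (A i)) sums mass \<mu> (\<Union>i. A i)"
proof -
  have "signed_radon (mass \<mu>)" using mass[of \<mu>] by simp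
  then show ?thesis using assms unfolding signed_radon_def by simp
qed

lemma mass_empty: "mass \<mu> {} = 0"
proof -
  have "(\<lambda>i::nat. mass \<mu> {}) sums mass \<mu> (\<Union>i::nat. {})"
    by (rule mass_sums) (auto simp: disjoint_family_on_def)
  then have "summable (\<lambda>i::nat. mass \<mu> {})" by (rule sums_summable)
  then show ?thesis by (simp add: summable_const_iff)
qed

lemma mass_Un:
  assumes "A \<in> sets borel" "B \<in> sets borel" "A \<inter> B = {}"
  shows "mass \<mu> (A \<union> B) = mass \<mu> A + mass \<mu> B"
proof -
  have "(\<lambda>i. mass \<mu> (binaryset A B i)) sums mass \<mu> (\<Union>i. binaryset A B i)"
  proof (rule mass_sums)
    show "range (binaryset A B) \<subseteq> sets borel" using assms by (simp add: range_binaryset_eq)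
    show "disjoint_family (binaryset A B)"
      unfolding disjoint_family_on_def binaryset_def using assms(3) by (simp add: Int_commute)
  qed
  then have "(\<lambda>i. mass \<mu> (binaryset A B i)) sums mass \<mu> (A \<union> B)"
    by (simp only: UN_binaryset_eq)
  moreover have "(\<lambda>i. mass \<mu> (binaryset A B i)) sums (mass \<mu> A + mass \<mu> B)"
    by (rule binaryset_sums) (rule mass_empty)
  ultimately show ?thesis by (rule sums_unique2)
qed


section \<open>Integration against signed measures\<close>

text \<open>
  The positive part of the Jordan decomposition; the negative part of \<open>\<mu>\<close> is the
  positive part of \<open>- \<mu>\<close>. The lemmas \<open>emeasure_pos_part\<close> and
  \<open>jordan_decomposition\<close> show that the set function is a measure and that the
  decomposition recovers \<open>\<mu>\<close>.
\<close>

definition pos_part :: "'a::euclidean_space radon \<Rightarrow> 'a measure" where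
  "pos_part \<mu> = measure_of UNIV (sets borel)
     (\<lambda>A. SUP B\<in>{B \<in> sets borel. B \<subseteq> A}. ennreal (mass \<mu> B))"

lemma space_pos_part [simp]: "space (pos_part \<mu>) = UNIV"
  and sets_pos_part [simp, measurable_cong]: "sets (pos_part \<mu>) = sets borel"
  unfolding pos_part_def using sets.sigma_sets_eq[of borel] by (simp_all add: sets_measure_of)

lemma SUP_add_SUP_le:
  fixes c :: ennreal
  assumes "I \<noteq> {}" "J \<noteq> {}" and le: "\<And>i j. i \<in> I \<Longrightarrow> j \<in> J \<Longrightarrow> f i + g j \<le> c"
  shows "(SUP i\<in>I. f i) + (SUP j\<in>J. g j) \<le> c"
proof -
  have "f i + (SUP j\<in>J. g j) \<le> c" if "i \<in> I" for i
    unfolding ennreal_SUP_add_right[OF assms(2)]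
    by (rule SUP_least) (rule le[OF that])
  then show ?thesis
    unfolding ennreal_SUP_add_left[OF assms(1), symmetric] by (rule SUP_least)
qed

lemma emeasure_pos_part:
  fixes \<mu> :: "'a::euclidean_space radon"
  assumes "A \<in> sets borel"
  shows "emeasure (pos_part \<mu>) A = (SUP B\<in>{B \<in> sets borel. B \<subseteq> A}. ennreal (mass \<mu> B))"
    (is "_ = ?p A")
proof (rule emeasure_measure_of[OF pos_part_def])
  show "sets borel \<subseteq> Pow (UNIV :: 'a set)" by simp
  show "A \<in> sets (pos_part \<mu>)" unfolding sets_pos_part by (rule assms)
  show "positive (sets (pos_part \<mu>)) ?p"
    by (auto simp: positive_def mass_empty cong: conj_cong)
  show "countably_additive (sets (pos_part \<mu>)) ?p"
    unfolding countably_additive_def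
  proof (intro allI impI)
    fix A :: "nat \<Rightarrow> 'a set"
    assume A: "range A \<subseteq> sets (pos_part \<mu>)" "disjoint_family A"
    then have Ab: "A i \<in> sets borel" for i by auto
    show "(\<Sum>i. ?p (A i)) = ?p (\<Union>i. A i)"
    proof (rule antisym)
      have fin: "(\<Sum>i<n. ?p (A i)) \<le> ?p (\<Union>i<n. A i)" for n
      proof (induction n)
        case (Suc n)
        have "?p (\<Union>i<n. A i) + ?p (A n) \<le> ?p (\<Union>i<Suc n. A i)"
        proof -
          let ?S = "\<lambda>A. {B \<in> sets borel. B \<subseteq> A}"
          have ne: "?S X \<noteq> {}" for X :: "'a set" by auto
          have "ennreal (mass \<mu> B) + ennreal (mass \<mu> C) \<le> ?p (\<Union>i<Suc n. A i)"
            if B: "B \<in> ?S (\<Union>i<n. A i)" and C: "C \<in> ?S (A n)" for B C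
          proof -
            have "A i \<inter> A n = {}" if "i < n" for i
              using disjoint_family_onD[OF A(2), of i n] that by simp
            then have disj: "B \<inter> C = {}" using B C by blast
            have up: "ennreal (mass \<mu> D) \<le> ?p (\<Union>i<Suc n. A i)"
              if "D \<in> sets borel" "D \<subseteq> (\<Union>i<Suc n. A i)" for D
              by (rule SUP_upper) (use that in auto)
            have subs: "B \<subseteq> (\<Union>i<Suc n. A i)" "C \<subseteq> (\<Union>i<Suc n. A i)"
              using B C by (auto simp: lessThan_Suc)
            consider "mass \<mu> B < 0" | "mass \<mu> C < 0" | "0 \<le> mass \<mu> B" "0 \<le> mass \<mu> C" by linarith
            then show ?thesis
            proof cases
              case 1 then show ?thesis
                using up[of C] C subs by (simp add: ennreal_neg)
            next
              case 2 then show ?thesis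
                using up[of B] B subs by (simp add: ennreal_neg)
            next
              case 3
              then have "ennreal (mass \<mu> B) + ennreal (mass \<mu> C) = ennreal (mass \<mu> (B \<union> C))"
                using mass_Un[of B C \<mu>] B C disj by (simp add: ennreal_plus)
              also have "\<dots> \<le> ?p (\<Union>i<Suc n. A i)"
                using B C subs by (intro up) auto
              finally show ?thesis .
            qed
          qed
          then show ?thesis by (rule SUP_add_SUP_le[OF ne ne])
        qed
        moreover have "(\<Sum>i<Suc n. ?p (A i)) \<le> ?p (\<Union>i<n. A i) + ?p (A n)"
          unfolding sum.lessThan_Suc using Suc by (rule add_right_mono)
        ultimately show ?case by (rule order_trans[rotated])
      qed simp
      show "(\<Sum>i. ?p (A i)) \<le> ?p (\<Union>i. A i)"
      proof (rule suminf_le_const)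
        show "sum (\<lambda>i. ?p (A i)) {..<n} \<le> ?p (\<Union>i. A i)" for n
          by (rule order_trans[OF fin]) (rule SUP_subset_mono, auto)
      qed simp
    next
      show "?p (\<Union>i. A i) \<le> (\<Sum>i. ?p (A i))"
      proof (rule SUP_least)
        fix B assume B: "B \<in> {B \<in> sets borel. B \<subseteq> (\<Union>i. A i)}"
        have "(\<lambda>i. mass \<mu> (B \<inter> A i)) sums mass \<mu> (\<Union>i. B \<inter> A i)"
          by (rule mass_sums) (use A B Ab in \<open>auto simp: disjoint_family_on_def\<close>)
        moreover have "(\<Union>i. B \<inter> A i) = B" using B by auto
        ultimately have s: "(\<lambda>n. \<Sum>i<n. mass \<mu> (B \<inter> A i)) \<longlonglongrightarrow> mass \<mu> B"
          by (simp add: sums_def)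
        have "ennreal (\<Sum>i<n. mass \<mu> (B \<inter> A i)) \<le> (\<Sum>i. ?p (A i))" for n
        proof -
          have "ennreal (\<Sum>i<n. mass \<mu> (B \<inter> A i)) \<le> ennreal (\<Sum>i<n. max 0 (mass \<mu> (B \<inter> A i)))"
            by (intro ennreal_leI sum_mono) auto
          also have "\<dots> = (\<Sum>i<n. ennreal (max 0 (mass \<mu> (B \<inter> A i))))"
            by (rule sum_ennreal[symmetric]) auto
          also have "\<dots> \<le> (\<Sum>i<n. ?p (A i))"
          proof (rule sum_mono)
            fix i
            have "ennreal (max 0 (mass \<mu> (B \<inter> A i))) = ennreal (mass \<mu> (B \<inter> A i))"
              by (auto simp: max_def ennreal_neg)
            also have "\<dots> \<le> ?p (A i)" by (rule SUP_upper) (use B Ab in auto)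
            finally show "ennreal (max 0 (mass \<mu> (B \<inter> A i))) \<le> ?p (A i)" .
          qed
          also have "\<dots> \<le> (\<Sum>i. ?p (A i))" by (rule sum_le_suminf) auto
          finally show ?thesis .
        qed
        then show "ennreal (mass \<mu> B) \<le> (\<Sum>i. ?p (A i))"
          by (intro LIMSEQ_le_const2[OF tendsto_ennrealI[OF s]]) auto
      qed
    qed
  qed
qed

lemma mass_le_norm: "mass \<mu> A \<le> norm \<mu>"
proof (cases "A \<in> sets borel \<and> A \<noteq> {}")
  case True
  let ?P = "{A, - A} - {{}}"
  have "partition_on UNIV ?P" by (auto simp: partition_on_def disjoint_def)
  then have "(\<Sum>B\<in>?P. \<bar>mass \<mu> B\<bar>) \<in> partition_sums (mass \<mu>) UNIV"
    unfolding partition_sums_def using True by (intro CollectI exI[of _ ?P]) auto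
  moreover have "bdd_above (partition_sums (mass \<mu>) UNIV)"
    using mass[of \<mu>] by (simp add: signed_radon_def)
  ultimately have "(\<Sum>B\<in>?P. \<bar>mass \<mu> B\<bar>) \<le> norm \<mu>"
    unfolding norm_radon_def total_variation_def by (rule cSup_upper)
  moreover have "\<bar>mass \<mu> A\<bar> \<le> (\<Sum>B\<in>?P. \<bar>mass \<mu> B\<bar>)"
    using True by (intro member_le_sum) auto
  ultimately show ?thesis by simp
next
  case False
  then have "mass \<mu> A = 0" using mass[of \<mu>] mass_empty by (auto simp: signed_radon_def)
  then show ?thesis by simp
qed

lemma finite_measure_pos_part: "finite_measure (pos_part \<mu>)"
proof
  have "emeasure (pos_part \<mu>) UNIV \<le> ennreal (norm \<mu>)"
    by (subst emeasure_pos_part) (auto intro!: SUP_least ennreal_leI mass_le_norm)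
  then show "emeasure (pos_part \<mu>) (space (pos_part \<mu>)) \<noteq> \<infinity>"
    using neq_top_trans[OF ennreal_neq_top] by simp
qed

lemma jordan_decomposition:
  fixes \<mu> :: "'a::euclidean_space radon"
  assumes A: "A \<in> sets borel"
  shows "mass \<mu> A = measure (pos_part \<mu>) A - measure (pos_part (- \<mu>)) A"
proof -
  have le: "mass \<mu> A + measure (pos_part (- \<mu>)) A \<le> measure (pos_part \<mu>) A"
    for \<mu> :: "'a radon"
  proof -
    interpret p: finite_measure "pos_part \<mu>" by (rule finite_measure_pos_part)
    have up: "mass \<mu> B \<le> measure (pos_part \<mu>) A" if "B \<in> sets borel" "B \<subseteq> A" for B
    proof -
      have "ennreal (mass \<mu> B) \<le> emeasure (pos_part \<mu>) A"
        by (subst emeasure_pos_part[OF A]) (rule SUP_upper, use that in auto)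
      then show ?thesis by (simp add: p.emeasure_eq_measure)
    qed
    interpret n: finite_measure "pos_part (- \<mu>)" by (rule finite_measure_pos_part)
    have "ennreal (mass (- \<mu>) B) \<le> ennreal (measure (pos_part \<mu>) A - mass \<mu> A)"
      if "B \<in> sets borel" "B \<subseteq> A" for B
    proof -
      have "A = B \<union> (A - B)" using that by auto
      then have "mass \<mu> A = mass \<mu> B + mass \<mu> (A - B)"
        using mass_Un[of B "A - B" \<mu>] that A by auto
      moreover have "mass \<mu> (A - B) \<le> measure (pos_part \<mu>) A" using that A by (intro up) auto
      ultimately show ?thesis by (intro ennreal_leI) (simp add: mass_uminus)
    qed
    then have "emeasure (pos_part (- \<mu>)) A \<le> ennreal (measure (pos_part \<mu>) A - mass \<mu> A)"
      by (subst emeasure_pos_part[OF A]) (auto intro!: SUP_least)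
    moreover have "0 \<le> measure (pos_part \<mu>) A - mass \<mu> A" using up[OF A order_refl] by simp
    ultimately show ?thesis by (simp add: n.emeasure_eq_measure)
  qed
  from le[of \<mu>] le[of "- \<mu>"] show ?thesis by (simp add: mass_uminus)
qed

text \<open>
  The dual product \<open>\<langle>\<phi>|\<mu>\<rangle>\<close> integrates over \<open>\<Omega>\<close> only,
  so the values of \<open>\<phi>\<close> outside \<open>\<Omega>\<close> are irrelevant.
\<close>

definition pairing :: "'a::euclidean_space set \<Rightarrow> ('a \<Rightarrow> real) \<Rightarrow> 'a radon \<Rightarrow> real" where
  "pairing \<Omega> \<phi> \<mu> = (LINT x:\<Omega>|pos_part \<mu>. \<phi> x) - (LINT x:\<Omega>|pos_part (- \<mu>). \<phi> x)"


section \<open>Spaces of measures and of continuous functions on a set\<close>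

text \<open>
  Measures on \<open>\<Omega>\<close> are identified with the measures on the whole space that are
  concentrated on \<open>\<Omega>\<close>; functions on \<open>\<Omega>\<close> are represented by functions
  on the whole space of which only the values on \<open>\<Omega>\<close> matter.
\<close>

definition measures_on :: "'a::euclidean_space set \<Rightarrow> 'a radon set" where
  "measures_on \<Omega> = {\<mu>. \<forall>A\<in>sets borel. A \<inter> \<Omega> = {} \<longrightarrow> mass \<mu> A = 0}"

definition C0 :: "'a::euclidean_space set \<Rightarrow> ('a \<Rightarrow> real) set" where
  "C0 \<Omega> = {\<phi>. continuous_on \<Omega> \<phi> \<and>
     (\<forall>\<epsilon>>0. \<exists>K. compact K \<and> K \<subseteq> \<Omega> \<and> (\<forall>x\<in>\<Omega> - K. \<bar>\<phi> x\<bar> < \<epsilon>))}"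

lift_definition dirac :: "'a::euclidean_space \<Rightarrow> 'a radon" is "\<lambda>x. measure (return borel x)"
  by (rule signed_radon_measure) (simp_all add: prob_space.finite_measure prob_space_return)

definition discrete_measures :: "'a::euclidean_space set \<Rightarrow> 'a radon set" where
  "discrete_measures \<Omega> = span (dirac ` \<Omega>)"

definition nonneg_measure :: "'a::euclidean_space radon \<Rightarrow> bool" where
  "nonneg_measure \<mu> \<longleftrightarrow> (\<forall>A\<in>sets borel. 0 \<le> mass \<mu> A)"

definition supp :: "'a::euclidean_space radon \<Rightarrow> 'a set" where
  "supp \<mu> = {x. \<forall>U. open U \<longrightarrow> x \<in> U \<longrightarrow> 0 < total_variation \<mu> U}"

definition weak_star_tendsto ::
  "'a::euclidean_space set \<Rightarrow> (nat \<Rightarrow> 'a radon) \<Rightarrow> 'a radon \<Rightarrow> bool" where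
  "weak_star_tendsto \<Omega> \<mu>s \<mu> \<longleftrightarrow> \<mu> \<in> measures_on \<Omega> \<and>
     (\<forall>\<phi>\<in>C0 \<Omega>. (\<lambda>k. pairing \<Omega> \<phi> (\<mu>s k)) \<longlonglongrightarrow> pairing \<Omega> \<phi> \<mu>)"

definition weak_star_limit_point ::
  "'a::euclidean_space set \<Rightarrow> (nat \<Rightarrow> 'a radon) \<Rightarrow> 'a radon \<Rightarrow> bool" where
  "weak_star_limit_point \<Omega> \<mu>s \<mu> \<longleftrightarrow>
     (\<exists>r. strict_mono r \<and> weak_star_tendsto \<Omega> (\<mu>s \<circ> r) \<mu>)"

text \<open>Density of the linear span in \<open>C0 \<Omega>\<close> with respect to the supremum norm over \<open>\<Omega>\<close>.\<close>

definition fundamental_C0 :: "'a::euclidean_space set \<Rightarrow> ('a \<Rightarrow> real) set \<Rightarrow> bool" where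
  "fundamental_C0 \<Omega> V \<longleftrightarrow> V \<subseteq> C0 \<Omega> \<and>
     (\<forall>\<phi>\<in>C0 \<Omega>. \<forall>\<epsilon>>0. \<exists>S c. finite S \<and> S \<subseteq> V \<and>
        (\<forall>x\<in>\<Omega>. \<bar>\<phi> x - (\<Sum>f\<in>S. c f * f x)\<bar> < \<epsilon>))"

definition translates :: "('a::euclidean_space \<Rightarrow> real) \<Rightarrow> 'a set \<Rightarrow> ('a \<Rightarrow> real) set" where
  "translates \<phi> \<Omega> = {\<lambda>x. \<phi> (x - y) | y. y \<in> \<Omega>}"


section \<open>Square-integrable functions and the Fourier transform\<close>

definition L2 :: "('a::euclidean_space \<Rightarrow> 'b::{banach, second_countable_topology}) set" where
  "L2 = {f \<in> borel_measurable lborel. integrable lborel (\<lambda>x. (norm (f x))\<^sup>2)}"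

definition fourier_L1 :: "('a::euclidean_space \<Rightarrow> real) \<Rightarrow> 'a \<Rightarrow> complex" where
  "fourier_L1 f \<xi> = (LINT x|lborel. cis (- 2 * pi * (x \<bullet> \<xi>)) * of_real (f x))"

text \<open>
  A function in \<open>L2\<close> need not be integrable. By Plancherel's theorem its Fourier transform
  is the \<open>L2\<close>-limit of the Fourier transforms of its restrictions to balls. The
  nonnegative Lebesgue integral is used since the Bochner integral of a non-integrable
  function is \<open>0\<close>.
\<close>

definition has_fourier_L2 :: "('a::euclidean_space \<Rightarrow> real) \<Rightarrow> ('a \<Rightarrow> complex) \<Rightarrow> bool" where
  "has_fourier_L2 f g \<longleftrightarrow> f \<in> L2 \<and> g \<in> L2 \<and>
     ((\<lambda>R. \<integral>\<^sup>+ \<xi>. ennreal ((cmod (fourier_L1 (\<lambda>x. indicator (cball 0 R) x * f x) \<xi> - g \<xi>))\<^sup>2)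
        \<partial>lborel) \<longlongrightarrow> 0) at_top"

definition fun_convolution :: "('a::euclidean_space \<Rightarrow> real) \<Rightarrow> ('a \<Rightarrow> real) \<Rightarrow> 'a \<Rightarrow> real" where
  "fun_convolution f g x = (LINT y|lborel. f (x - y) * g y)"


section \<open>The operator, the functionals and the method\<close>

definition conv_op :: "('a::euclidean_space \<Rightarrow> real) \<Rightarrow> 'a set \<Rightarrow> 'a radon \<Rightarrow> 'a \<Rightarrow> real" where
  "conv_op \<rho> \<Omega> \<mu> x = pairing \<Omega> (\<lambda>y. \<rho> (x - y)) \<mu>"

definition conv_norm :: "('a::euclidean_space \<Rightarrow> real) \<Rightarrow> 'a set \<Rightarrow> 'a radon \<Rightarrow> real" where
  "conv_norm \<rho> \<Omega> \<mu> = sqrt (pairing \<Omega> (conv_op \<rho> \<Omega> \<mu>) \<mu>)"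

text \<open>
  \<open>F\<close> is pre-differentiable on the measures on \<open>\<Omega>\<close> with derivative \<open>F'\<close>.
  The values \<open>F' \<mu>\<close> are unique as functions on \<open>\<Omega>\<close>.
\<close>

definition has_pre_derivative ::
  "'a::euclidean_space set \<Rightarrow> ('a radon \<Rightarrow> real) \<Rightarrow> ('a radon \<Rightarrow> 'a \<Rightarrow> real) \<Rightarrow> bool" where
  "has_pre_derivative \<Omega> F F' \<longleftrightarrow> (\<forall>\<mu>\<in>measures_on \<Omega>. F' \<mu> \<in> C0 \<Omega> \<and>
     (F has_derivative pairing \<Omega> (F' \<mu>)) (at \<mu> within measures_on \<Omega>))"

text \<open>
  In \<open>ereal\<close>, \<open>\<infinity> - \<infinity> = \<infinity>\<close>. This is harmless for functionals that are never
  \<open>- \<infinity>\<close> and finite somewhere: where such an \<open>H\<close> is infinite, its pre-subdifferential is empty.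
\<close>

definition pre_subdiff ::
  "'a::euclidean_space set \<Rightarrow> ('a radon \<Rightarrow> ereal) \<Rightarrow> 'a radon \<Rightarrow> ('a \<Rightarrow> real) set" where
  "pre_subdiff \<Omega> H \<mu> = {\<phi> \<in> C0 \<Omega>.
     \<forall>\<nu>\<in>measures_on \<Omega>. H \<nu> - H \<mu> \<ge> ereal (pairing \<Omega> \<phi> (\<nu> - \<mu>))}"

definition reg_G :: "real \<Rightarrow> 'a::euclidean_space radon \<Rightarrow> ereal" where
  "reg_G \<alpha> \<mu> = ereal (\<alpha> * norm \<mu>) + (if nonneg_measure \<mu> then 0 else \<infinity>)"

text \<open>The tolerance of step \<open>k\<close> is \<open>\<epsilon> (Suc k)\<close>; \<open>\<epsilon> 0\<close> is not used.\<close>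

definition muFB ::
  "'a::euclidean_space set \<Rightarrow> ('a \<Rightarrow> real) \<Rightarrow> real \<Rightarrow> ('a radon \<Rightarrow> 'a \<Rightarrow> real) \<Rightarrow>
   real \<Rightarrow> real \<Rightarrow> (nat \<Rightarrow> real) \<Rightarrow> (nat \<Rightarrow> 'a radon) \<Rightarrow> bool" where
  "muFB \<Omega> \<rho> \<alpha> F' \<tau> \<kappa> \<epsilon> \<mu> \<longleftrightarrow>
     \<mu> 0 \<in> discrete_measures \<Omega> \<and>
     (\<forall>k. let r = (\<lambda>x. \<tau> * (F' (\<mu> k) x + \<alpha>) + conv_op \<rho> \<Omega> (\<mu> (Suc k) - \<mu> k) x) in
        \<mu> (Suc k) \<in> discrete_measures \<Omega> \<and> nonneg_measure (\<mu> (Suc k)) \<and>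
        (\<forall>x\<in>\<Omega>. r x \<ge> - \<epsilon> (Suc k)) \<and>
        (\<forall>x\<in>supp (\<mu> (Suc k)). r x \<le> \<epsilon> (Suc k)) \<and>
        pairing \<Omega> r (\<mu> (Suc k)) \<le> \<kappa> * \<epsilon> (Suc k))"

end

theory Submission
  imports Defs
begin

text \<open>
  The residual inequalities of a step, \<open>L\<close>-smoothness and convexity give a three-point
  inequality whose error terms are summable. Comparing with the previous iterate bounds the
  masses and makes the steps tend to zero in the seminorm of the convolution operator; this
  operator turns weak-* convergence of bounded nonnegative measures into uniform convergence,
  so every weak-* limit point is a minimiser. Comparing with a minimiser gives
  quasi-Fejer monotonicity, and Opial's argument shows that two limit points are at seminorm
  distance zero. The seminorm is only needed on discrete measures, where its positivity is the
  positive definiteness of \<open>\<rho>\<close>. If \<open>\<rho> = \<rho>\<^sub>h * \<rho>\<^sub>h\<close>, a measure of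
  seminorm zero has a correlation with \<open>\<rho>\<^sub>h\<close> whose self-convolution vanishes; such
  a square-integrable function is zero, and the translates of \<open>\<rho>\<^sub>h\<close> separate measures.
\<close>

section \<open>Integration against signed measures\<close>

text \<open>\<open>Q\<close> is shown to be nonnegative on discrete measures only, and this shapes
  the estimates. Symmetry of the convolution form is used with one discrete argument, where it is a
  finite sum. Lower bounds at other differences come from the boundedness of \<rho> and of the
  masses. The Cauchy-Schwarz bound of \<open>D\<close> by \<open>Q\<close> reaches the limit points
  only through approximation by iterates.

  Compactness is obtained by moving probability measures on \<Omega> to the unit interval, where
  Helly selection applies. A continuous map carries the limit back, so the limit is a measure by
  construction.

  For a square-integrable function with vanishing self-convolution, the Fourier transform would have
  square zero. The argument here stays in the Hilbert space instead: the closed span of the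
  translates of the function is translation invariant, and its elements have zero convolution with
  the function. This makes the projection of a bump onto that span the natural object; almost
  minimisers stand in for it.\<close>

lemma sum_list_integral_zero:
  fixes cs :: "(real \<times> 'a::euclidean_space measure) list" and u :: "'a \<Rightarrow> real"
  assumes fin: "\<And>c M. (c, M) \<in> set cs \<Longrightarrow> finite_measure M \<and> sets M = sets borel"
    and zero: "\<And>A. A \<in> sets borel \<Longrightarrow> (\<Sum>(c, M)\<leftarrow>cs. c * measure M A) = 0"
    and u: "u \<in> borel_measurable borel" "\<And>x. 0 \<le> u x" "\<And>x. u x \<le> B"
  shows "(\<Sum>(c, M)\<leftarrow>cs. c * (LINT x|M. u x)) = 0"
proof -
  have intg: "integrable M f"
    if "(c, M) \<in> set cs" "f \<in> borel_measurable borel" "\<And>x. 0 \<le> f x" "\<And>x. f x \<le> C"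
    for c M C and f :: "'a \<Rightarrow> real"
  proof -
    interpret finite_measure M using fin that(1) by blast
    have "sets M = sets borel" using fin that(1) by blast
    then have "f \<in> borel_measurable M" using that(2) by (simp cong: measurable_cong_sets)
    then show ?thesis
      by (intro integrable_const_bound[of _ C]) (use that in auto)
  qed
  \<comment> \<open>The bound is quantified inside the induction because scaled functions, summands
    and approximants come with bounds of their own.\<close>
  have "\<forall>B. (\<forall>x. u x \<le> B) \<longrightarrow> (\<Sum>(c, M)\<leftarrow>cs. c * (LINT x|M. u x)) = 0"
    using u(1,2)
  proof (induct u rule: borel_measurable_induct_real)
    case (set A)
    have "(\<Sum>(c, M)\<leftarrow>cs. c * (LINT x|M. indicator A x)) = (\<Sum>(c, M)\<leftarrow>cs. c * measure M A)"
    proof (rule arg_cong[where f = sum_list], rule map_cong[OF refl], clarify)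
      fix c M assume "(c, M) \<in> set cs"
      then have "sets M = sets borel" using fin by blast
      then show "c * (LINT x|M. indicator A x) = c * measure M A"
        using sets_eq_imp_space_eq[of M borel] by simp
    qed
    then show ?case using zero[OF set] by simp
  next
    case (mult u c)
    show ?case
    proof (intro allI impI)
      fix B assume B: "\<forall>x. c * u x \<le> B"
      show "(\<Sum>(d, M)\<leftarrow>cs. d * (LINT x|M. c * u x)) = 0"
      proof (cases "c = 0")
        case False
        then have "u x \<le> B / c" for x
          using B mult(1) by (simp add: pos_le_divide_eq mult.commute)
        then have "(\<Sum>(d, M)\<leftarrow>cs. d * (LINT x|M. u x)) = 0" using mult(4) by blast
        moreover have "(\<Sum>(d, M)\<leftarrow>cs. d * (LINT x|M. c * u x)) = c * (\<Sum>(d, M)\<leftarrow>cs. d * (LINT x|M. u x))"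
          by (simp add: sum_list_const_mult[symmetric] split_beta' mult.left_commute)
        ultimately show ?thesis by simp
      qed (simp add: split_beta')
    qed
  next
    case (add u v)
    show ?case
    proof (intro allI impI)
      fix B assume B: "\<forall>x. v x + u x \<le> B"
      have bu: "u x \<le> B" for x using B[rule_format, of x] add(5)[of x] by linarith
      have bv: "v x \<le> B" for x using B[rule_format, of x] add(2)[of x] by linarith
      have "(\<Sum>(d, M)\<leftarrow>cs. d * (LINT x|M. v x + u x)) =
            (\<Sum>(d, M)\<leftarrow>cs. d * (LINT x|M. v x) + d * (LINT x|M. u x))"
      proof (rule arg_cong[where f = sum_list], rule map_cong[OF refl], clarify)
        fix c M assume cM: "(c, M) \<in> set cs"
        have "integrable M u" by (rule intg[OF cM add(1,2) bu])
        moreover have "integrable M v" by (rule intg[OF cM add(4,5) bv])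
        ultimately show "c * (LINT x|M. v x + u x) = c * (LINT x|M. v x) + c * (LINT x|M. u x)"
          by (simp add: distrib_left)
      qed
      also have "\<dots> = (\<Sum>(d, M)\<leftarrow>cs. d * (LINT x|M. v x)) + (\<Sum>(d, M)\<leftarrow>cs. d * (LINT x|M. u x))"
        by (simp add: sum_list_addf split_beta')
      also have "\<dots> = 0" using add(3)[rule_format, OF bu] add(7)[rule_format, OF bv] by simp
      finally show "(\<Sum>(d, M)\<leftarrow>cs. d * (LINT x|M. v x + u x)) = 0" .
    qed
  next
    case (seq U)
    show ?case
    proof (intro allI impI)
      fix B assume B: "\<forall>x. u x \<le> B"
      have le: "U i x \<le> B" for i x
      proof -
        have "U i x \<le> u x" using seq(4,5) by (intro incseq_le) (auto simp: incseq_def le_fun_def)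
        then show ?thesis using B order_trans by blast
      qed
      have lim: "(\<lambda>i. c * (LINT x|M. U i x)) \<longlonglongrightarrow> c * (LINT x|M. u x)" if cM: "(c, M) \<in> set cs" for c M
      proof (rule tendsto_mult_left, rule integral_dominated_convergence[where w = "\<lambda>_. B"])
        interpret finite_measure M using fin cM by blast
        have s: "sets M = sets borel" using fin cM by blast
        show "u \<in> borel_measurable M" "U i \<in> borel_measurable M" for i
          using u(1) seq(1) s by (simp_all cong: measurable_cong_sets)
        show "integrable M (\<lambda>x. B)" by simp
        show "AE x in M. (\<lambda>i. U i x) \<longlonglongrightarrow> u x" using seq(5) by simp
        show "AE x in M. norm (U i x) \<le> B" for i using le seq(2) by simp
      qed
      have lims: "(\<lambda>i. \<Sum>(c, M)\<leftarrow>ds. c * (LINT x|M. U i x)) \<longlonglongrightarrow> (\<Sum>(c, M)\<leftarrow>ds. c * (LINT x|M. u x))"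
        if "set ds \<subseteq> set cs" for ds
        using that
      proof (induction ds)
        case (Cons d ds)
        then show ?case using lim[of "fst d" "snd d"] by (cases d) (auto intro!: tendsto_add)
      qed simp
      have zz: "(\<Sum>(c, M)\<leftarrow>cs. c * (LINT x|M. U i x)) = 0" for i
        using seq(3)[of i] le by blast
      from lims[of cs] have "(\<lambda>i. 0) \<longlonglongrightarrow> (\<Sum>(c, M)\<leftarrow>cs. c * (LINT x|M. u x))"
        using zz by simp
      then show "(\<Sum>(c, M)\<leftarrow>cs. c * (LINT x|M. u x)) = 0"
        by (simp add: LIMSEQ_const_iff)
    qed
  qed
  then show ?thesis using u(3) by blast
qed

lemma set_integrable_continuous_compact:
  fixes \<phi> :: "'a::euclidean_space \<Rightarrow> real"
  assumes "finite_measure M" "sets M = sets borel" "compact \<Omega>" "continuous_on \<Omega> \<phi>"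
  shows "set_integrable M \<Omega> \<phi>"
proof -
  interpret finite_measure M by fact
  have "bounded (\<phi> ` \<Omega>)" using assms by (simp add: compact_continuous_image compact_imp_bounded)
  then obtain B where B: "\<And>x. x \<in> \<Omega> \<Longrightarrow> \<bar>\<phi> x\<bar> \<le> B" "0 < B"
    unfolding bounded_pos by auto
  have "(\<lambda>x. indicator \<Omega> x *\<^sub>R \<phi> x) \<in> borel_measurable borel"
    using assms by (intro borel_measurable_continuous_on_indicator borel_compact)
  then have "(\<lambda>x. indicator \<Omega> x *\<^sub>R \<phi> x) \<in> borel_measurable M"
    using assms(2) by (simp cong: measurable_cong_sets)
  then show ?thesis unfolding set_integrable_def
    by (intro integrable_const_bound[of _ B]) (use B in \<open>auto simp: indicator_def\<close>)
qed

text \<open>The Jordan parts of a sum are not the sums of the Jordan parts, so linearity of the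
  pairing in the measure is not immediate. It is a linear relation with real coefficients between
  positive measures, and such relations pass from sets to integrals. A list allows the same measure
  to occur twice.\<close>

lemma sum_list_set_integral_zero:
  fixes cs :: "(real \<times> 'a::euclidean_space measure) list" and \<phi> :: "'a \<Rightarrow> real"
  assumes fin: "\<And>c M. (c, M) \<in> set cs \<Longrightarrow> finite_measure M \<and> sets M = sets borel"
    and zero: "\<And>A. A \<in> sets borel \<Longrightarrow> (\<Sum>(c, M)\<leftarrow>cs. c * measure M A) = 0"
    and \<Omega>: "compact \<Omega>" "continuous_on \<Omega> \<phi>"
  shows "(\<Sum>(c, M)\<leftarrow>cs. c * (LINT x:\<Omega>|M. \<phi> x)) = 0"
proof -
  have "bounded (\<phi> ` \<Omega>)" using \<Omega> by (simp add: compact_continuous_image compact_imp_bounded)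
  then obtain B where B: "\<And>x. x \<in> \<Omega> \<Longrightarrow> \<bar>\<phi> x\<bar> \<le> B" "0 < B"
    unfolding bounded_pos by auto
  let ?f = "\<lambda>x. indicator \<Omega> x * \<phi> x"
  have m: "?f \<in> borel_measurable borel"
    using borel_measurable_continuous_on_indicator[OF borel_compact[OF \<Omega>(1)] \<Omega>(2)] by simp
  have p: "(\<Sum>(c, M)\<leftarrow>cs. c * (LINT x|M. max 0 (?f x))) = 0"
    by (rule sum_list_integral_zero[OF fin zero, where B = B]) (use m B in \<open>auto simp: indicator_def abs_le_iff\<close>)
  have n: "(\<Sum>(c, M)\<leftarrow>cs. c * (LINT x|M. max 0 (- ?f x))) = 0"
    by (rule sum_list_integral_zero[OF fin zero, where B = B]) (use m B in \<open>auto simp: indicator_def abs_le_iff\<close>)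
  have "(\<Sum>(c, M)\<leftarrow>cs. c * (LINT x:\<Omega>|M. \<phi> x)) =
    (\<Sum>(c, M)\<leftarrow>cs. c * (LINT x|M. max 0 (?f x)) - c * (LINT x|M. max 0 (- ?f x)))"
  proof (rule arg_cong[where f = sum_list], rule map_cong[OF refl], clarify)
    fix c M assume cM: "(c, M) \<in> set cs"
    then have i: "integrable M ?f"
      using set_integrable_continuous_compact[of M \<Omega> \<phi>] fin \<Omega> by (simp add: set_integrable_def)
    have "(LINT x:\<Omega>|M. \<phi> x) = (LINT x|M. max 0 (?f x) - max 0 (- ?f x))"
      unfolding set_lebesgue_integral_def by (rule Bochner_Integration.integral_cong) auto
    also have "\<dots> = (LINT x|M. max 0 (?f x)) - (LINT x|M. max 0 (- ?f x))"
      using i by (intro Bochner_Integration.integral_diff integrable_max) auto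
    finally show "c * (LINT x:\<Omega>|M. \<phi> x) = c * (LINT x|M. max 0 (?f x)) - c * (LINT x|M. max 0 (- ?f x))"
      by (simp add: right_diff_distrib)
  qed
  also have "\<dots> = 0" using p n by (simp add: sum_list_subtractf split_beta')
  finally show ?thesis .
qed

text \<open>Any decomposition into two finite measures computes the pairing, not only the Jordan
  decomposition.\<close>

lemma pairing_eq_diff:
  assumes M: "finite_measure M" "sets M = sets borel" and N: "finite_measure N" "sets N = sets borel"
    and eq: "\<And>A. A \<in> sets borel \<Longrightarrow> mass \<mu> A = measure M A - measure N A"
    and \<Omega>: "compact \<Omega>" "continuous_on \<Omega> \<phi>"
  shows "pairing \<Omega> \<phi> \<mu> = (LINT x:\<Omega>|M. \<phi> x) - (LINT x:\<Omega>|N. \<phi> x)"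
proof -
  have "(\<Sum>(c, M)\<leftarrow>[(1, pos_part \<mu>), (-1, pos_part (- \<mu>)), (-1, M), (1, N)]. c * (LINT x:\<Omega>|M. \<phi> x)) = 0"
  proof (rule sum_list_set_integral_zero[OF _ _ \<Omega>], goal_cases)
    case (2 A)
    then show ?case using eq[OF 2] jordan_decomposition[OF 2, of \<mu>] by (simp only: list.map sum_list.Cons sum_list.Nil prod.case, simp?, linarith?)
  qed (use M N finite_measure_pos_part in auto)
  then show ?thesis by (simp add: pairing_def)
qed

section \<open>Bilinearity of the dual product\<close>

context
  fixes \<Omega> :: "'a::euclidean_space set"
  assumes cpt: "compact \<Omega>"
begin

lemma pairing_add_measure:
  assumes "continuous_on \<Omega> \<phi>"
  shows "pairing \<Omega> \<phi> (\<mu> + \<nu>) = pairing \<Omega> \<phi> \<mu> + pairing \<Omega> \<phi> \<nu>"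
proof -
  have "(\<Sum>(c, M)\<leftarrow>[(1, pos_part (\<mu> + \<nu>)), (-1, pos_part (- (\<mu> + \<nu>))), (-1, pos_part \<mu>), (1, pos_part (- \<mu>)),
     (-1, pos_part \<nu>), (1, pos_part (- \<nu>))]. c * (LINT x:\<Omega>|M. \<phi> x)) = 0"
  proof (rule sum_list_set_integral_zero[OF _ _ cpt assms], goal_cases)
    case (2 A)
    then show ?case
      using jordan_decomposition[OF 2, of "\<mu> + \<nu>"] jordan_decomposition[OF 2, of "\<mu>"]
        jordan_decomposition[OF 2, of \<nu>] fun_cong[OF plus_radon.rep_eq[of \<mu> \<nu>], of A]
      by (simp only: list.map sum_list.Cons sum_list.Nil prod.case, simp?, linarith?)
  qed (use finite_measure_pos_part in auto)
  then show ?thesis by (simp add: pairing_def)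
qed

lemma pairing_scale_measure:
  assumes "continuous_on \<Omega> \<phi>"
  shows "pairing \<Omega> \<phi> (a *\<^sub>R \<mu>) = a * pairing \<Omega> \<phi> \<mu>"
proof -
  have eq: "a * measure (pos_part \<mu>) A - a * measure (pos_part (- \<mu>)) A =
     measure (pos_part (a *\<^sub>R \<mu>)) A - measure (pos_part (- (a *\<^sub>R \<mu>))) A" if "A \<in> sets borel" for A
    unfolding right_diff_distrib[symmetric] using that
    by (simp add: jordan_decomposition[symmetric] scaleR_radon.rep_eq)
  have "(\<Sum>(c, M)\<leftarrow>[(1, pos_part (a *\<^sub>R \<mu>)), (-1, pos_part (- (a *\<^sub>R \<mu>))), (-a, pos_part \<mu>), (a, pos_part (- \<mu>))]. c * (LINT x:\<Omega>|M. \<phi> x)) = 0"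
    by (rule sum_list_set_integral_zero[OF _ _ cpt assms])
      (use eq finite_measure_pos_part in \<open>auto simp: algebra_simps\<close>)
  then show ?thesis by (simp add: pairing_def right_diff_distrib)
qed

lemma linear_pairing: "continuous_on \<Omega> \<phi> \<Longrightarrow> linear (pairing \<Omega> \<phi>)"
  by (rule linearI) (simp_all add: pairing_add_measure pairing_scale_measure)

lemma pairing_diff_measure:
  "continuous_on \<Omega> \<phi> \<Longrightarrow> pairing \<Omega> \<phi> (\<mu> - \<nu>) = pairing \<Omega> \<phi> \<mu> - pairing \<Omega> \<phi> \<nu>"
  by (rule linear_diff[OF linear_pairing])

lemma pairing_zero_measure [simp]: "continuous_on \<Omega> \<phi> \<Longrightarrow> pairing \<Omega> \<phi> 0 = 0"
  by (rule linear_0[OF linear_pairing])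

lemma set_integrable_pos_part:
  fixes \<phi> :: "'a \<Rightarrow> real"
  shows "continuous_on \<Omega> \<phi> \<Longrightarrow> set_integrable (pos_part \<mu>) \<Omega> \<phi>"
  by (rule set_integrable_continuous_compact[OF finite_measure_pos_part _ cpt]) simp_all

lemma pairing_add:
  "continuous_on \<Omega> \<phi> \<Longrightarrow> continuous_on \<Omega> \<psi> \<Longrightarrow> pairing \<Omega> (\<lambda>x. \<phi> x + \<psi> x) \<mu> = pairing \<Omega> \<phi> \<mu> + pairing \<Omega> \<psi> \<mu>"
  unfolding pairing_def by (simp add: set_integral_add set_integrable_pos_part)

lemma pairing_cmult: "pairing \<Omega> (\<lambda>x. a * \<phi> x) \<mu> = a * pairing \<Omega> \<phi> \<mu>"
  unfolding pairing_def by (simp add: right_diff_distrib)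

lemma pairing_diff:
  "continuous_on \<Omega> \<phi> \<Longrightarrow> continuous_on \<Omega> \<psi> \<Longrightarrow> pairing \<Omega> (\<lambda>x. \<phi> x - \<psi> x) \<mu> = pairing \<Omega> \<phi> \<mu> - pairing \<Omega> \<psi> \<mu>"
  unfolding pairing_def by (simp add: set_integral_diff set_integrable_pos_part)

lemma pairing_sum:
  "finite I \<Longrightarrow> (\<And>i. i \<in> I \<Longrightarrow> continuous_on \<Omega> (\<phi> i)) \<Longrightarrow>
    pairing \<Omega> (\<lambda>x. \<Sum>i\<in>I. \<phi> i x) \<mu> = (\<Sum>i\<in>I. pairing \<Omega> (\<phi> i) \<mu>)"
proof (induction I rule: finite_induct)
  case empty
  show ?case by (simp add: pairing_def)
next
  case (insert i I)
  then show ?case by (simp add: pairing_add continuous_on_sum)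
qed

lemma pairing_cong: "(\<And>x. x \<in> \<Omega> \<Longrightarrow> \<phi> x = \<psi> x) \<Longrightarrow> pairing \<Omega> \<phi> \<mu> = pairing \<Omega> \<psi> \<mu>"
proof -
  assume a: "\<And>x. x \<in> \<Omega> \<Longrightarrow> \<phi> x = \<psi> x"
  have "\<Omega> \<in> sets borel" using cpt by (rule borel_compact)
  then have "(LINT x:\<Omega>|pos_part \<nu>. \<phi> x) = (LINT x:\<Omega>|pos_part \<nu>. \<psi> x)" for \<nu>
    using a by (intro set_lebesgue_integral_cong) auto
  then show ?thesis unfolding pairing_def by simp
qed

end

section \<open>Nonnegative, Dirac and discrete measures\<close>

lemma mass_mono_nonneg:
  assumes "nonneg_measure \<mu>" "A \<in> sets borel" "B \<in> sets borel" "A \<subseteq> B"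
  shows "mass \<mu> A \<le> mass \<mu> B"
proof -
  have "mass \<mu> (A \<union> (B - A)) = mass \<mu> A + mass \<mu> (B - A)"
    using assms by (intro mass_Un) auto
  moreover have "A \<union> (B - A) = B" using assms(4) by auto
  moreover have "0 \<le> mass \<mu> (B - A)" using assms by (auto simp: nonneg_measure_def)
  ultimately show ?thesis by simp
qed

lemma measure_pos_part_nonneg:
  assumes "nonneg_measure \<mu>" "A \<in> sets borel"
  shows "measure (pos_part \<mu>) A = mass \<mu> A"
proof -
  have "emeasure (pos_part \<mu>) A = ennreal (mass \<mu> A)"
    unfolding emeasure_pos_part[OF assms(2)]
    by (rule antisym) (use assms mass_mono_nonneg in \<open>auto intro!: SUP_least ennreal_leI SUP_upper\<close>)
  then show ?thesis
    using assms by (simp add: measure_def nonneg_measure_def)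
qed

lemma finite_measure_null: "finite_measure (null_measure M)"
  by (rule finite_measureI) simp

lemma pairing_nonneg_measure:
  assumes "nonneg_measure \<mu>" "compact \<Omega>" "continuous_on \<Omega> \<phi>"
  shows "pairing \<Omega> \<phi> \<mu> = (LINT x:\<Omega>|pos_part \<mu>. \<phi> x)"
proof -
  have "pairing \<Omega> \<phi> \<mu> = (LINT x:\<Omega>|pos_part \<mu>. \<phi> x) - (LINT x:\<Omega>|null_measure borel. \<phi> x)"
    by (rule pairing_eq_diff)
      (use assms in \<open>simp_all add: measure_pos_part_nonneg finite_measure_pos_part finite_measure_null\<close>)
  then show ?thesis by (simp add: set_lebesgue_integral_def)
qed

lemma pairing_nonneg:
  assumes "nonneg_measure \<mu>" "compact \<Omega>" "continuous_on \<Omega> \<phi>" "\<And>x. x \<in> \<Omega> \<Longrightarrow> 0 \<le> \<phi> x"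
  shows "0 \<le> pairing \<Omega> \<phi> \<mu>"
  unfolding pairing_nonneg_measure[OF assms(1-3)] set_lebesgue_integral_def
  by (rule Bochner_Integration.integral_nonneg) (use assms in \<open>auto simp: indicator_def\<close>)

lemma pairing_mono:
  assumes "nonneg_measure \<mu>" "compact \<Omega>" "continuous_on \<Omega> \<phi>" "continuous_on \<Omega> \<psi>"
    "\<And>x. x \<in> \<Omega> \<Longrightarrow> \<phi> x \<le> \<psi> x"
  shows "pairing \<Omega> \<phi> \<mu> \<le> pairing \<Omega> \<psi> \<mu>"
  using pairing_nonneg[of \<mu> \<Omega> "\<lambda>x. \<psi> x - \<phi> x"] assms
  by (simp add: pairing_diff continuous_on_diff)

lemma mass_measures_on:
  assumes "\<mu> \<in> measures_on \<Omega>" "compact \<Omega>"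
  shows "mass \<mu> \<Omega> = mass \<mu> UNIV"
proof -
  have b: "\<Omega> \<in> sets borel" by (rule borel_compact[OF assms(2)])
  have "mass \<mu> (\<Omega> \<union> - \<Omega>) = mass \<mu> \<Omega> + mass \<mu> (- \<Omega>)" using b by (intro mass_Un) auto
  moreover have "mass \<mu> (- \<Omega>) = 0" using assms b unfolding measures_on_def by auto
  ultimately show ?thesis by simp
qed

lemma norm_nonneg_measure:
  assumes "nonneg_measure \<mu>"
  shows "norm \<mu> = mass \<mu> UNIV"
proof (rule antisym)
  have "y \<le> mass \<mu> UNIV" if "y \<in> partition_sums (mass \<mu>) UNIV" for y
  proof -
    obtain P where P: "finite P" "P \<subseteq> sets borel" "partition_on UNIV P" "y = (\<Sum>B\<in>P. \<bar>mass \<mu> B\<bar>)"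
      using \<open>y \<in> _\<close> unfolding partition_sums_def by auto
    interpret finite_measure "pos_part \<mu>" by (rule finite_measure_pos_part)
    have "disjoint_family_on (\<lambda>B. B) P"
      using P(3) by (auto simp: partition_on_def disjoint_def disjoint_family_on_def)
    then have "measure (pos_part \<mu>) (\<Union>B\<in>P. B) = (\<Sum>B\<in>P. measure (pos_part \<mu>) B)"
      using P by (intro finite_measure_finite_Union) auto
    moreover have "(\<Union>B\<in>P. B) = UNIV" using P(3) by (simp add: partition_on_def)
    moreover have "(\<Sum>B\<in>P. measure (pos_part \<mu>) B) = y"
      unfolding P(4) using P(2) assms measure_pos_part_nonneg[OF assms]
      by (intro sum.cong) (auto simp: nonneg_measure_def subset_eq)
    ultimately show ?thesis using measure_pos_part_nonneg[OF assms, of UNIV] by simp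
  qed
  then show "norm \<mu> \<le> mass \<mu> UNIV"
    unfolding norm_radon_def total_variation_def
    by (intro cSup_least partition_sums_nonempty) auto
qed (rule mass_le_norm)

text \<open>With \<open>c = 1\<close>, the norm of a nonnegative measure is a pairing with a test
  function. On such measures the regulariser is therefore linear and weak-* continuous.\<close>

lemma pairing_const:
  assumes "nonneg_measure \<mu>" "compact \<Omega>" "\<mu> \<in> measures_on \<Omega>"
  shows "pairing \<Omega> (\<lambda>_. c) \<mu> = c * norm \<mu>"
proof -
  have b: "\<Omega> \<in> sets borel" by (rule borel_compact[OF assms(2)])
  have "pairing \<Omega> (\<lambda>_. c) \<mu> = (LINT x:\<Omega>|pos_part \<mu>. c)"
    using assms by (simp add: pairing_nonneg_measure)
  also have "\<dots> = c * measure (pos_part \<mu>) \<Omega>"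
    using b unfolding set_lebesgue_integral_def by simp
  finally show ?thesis
    using assms b by (simp add: measure_pos_part_nonneg norm_nonneg_measure mass_measures_on)
qed

lemma pairing_bound:
  assumes "nonneg_measure \<mu>" "compact \<Omega>" "\<mu> \<in> measures_on \<Omega>" "continuous_on \<Omega> \<phi>"
    "\<And>x. x \<in> \<Omega> \<Longrightarrow> \<bar>\<phi> x\<bar> \<le> B"
  shows "\<bar>pairing \<Omega> \<phi> \<mu>\<bar> \<le> B * norm \<mu>"
proof -
  have "pairing \<Omega> \<phi> \<mu> \<le> pairing \<Omega> (\<lambda>_. B) \<mu>"
    using assms by (intro pairing_mono) (auto simp: abs_le_iff)
  moreover have "pairing \<Omega> (\<lambda>_. - B) \<mu> \<le> pairing \<Omega> \<phi> \<mu>"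
    using assms by (intro pairing_mono) (auto simp: abs_le_iff, force)
  ultimately show ?thesis using assms by (simp add: pairing_const)
qed

lemma mass_dirac: "A \<in> sets borel \<Longrightarrow> mass (dirac x) A = indicator A x"
  by (simp add: dirac.rep_eq measure_return)

lemma nonneg_dirac: "nonneg_measure (dirac x)"
  by (simp add: nonneg_measure_def mass_dirac)

lemma pairing_dirac:
  assumes "compact \<Omega>" "continuous_on \<Omega> \<phi>" "x \<in> \<Omega>"
  shows "pairing \<Omega> \<phi> (dirac x) = \<phi> x"
proof -
  have b: "\<Omega> \<in> sets borel" by (rule borel_compact[OF assms(1)])
  have "pairing \<Omega> \<phi> (dirac x) = (LINT y:\<Omega>|return borel x. \<phi> y) - (LINT y:\<Omega>|null_measure borel. \<phi> y)"
    by (rule pairing_eq_diff)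
      (use assms in \<open>simp_all add: mass_dirac measure_return prob_space.finite_measure prob_space_return finite_measure_null\<close>)
  also have "\<dots> = \<phi> x"
    using borel_measurable_continuous_on_indicator[OF b assms(2)] assms(3)
    by (simp add: set_lebesgue_integral_def integral_return)
  finally show ?thesis .
qed

lemma subspace_measures_on: "subspace (measures_on \<Omega>)"
  unfolding subspace_def measures_on_def
  by (auto simp: zero_radon.rep_eq plus_radon.rep_eq scaleR_radon.rep_eq)

lemma discrete_subset_measures_on: "discrete_measures \<Omega> \<subseteq> measures_on \<Omega>"
  unfolding discrete_measures_def
proof (rule span_minimal[OF _ subspace_measures_on])
  show "dirac ` \<Omega> \<subseteq> measures_on \<Omega>"
    by (auto simp: measures_on_def mass_dirac indicator_def)
qed

lemma measures_on_diff: "\<mu> \<in> measures_on \<Omega> \<Longrightarrow> \<nu> \<in> measures_on \<Omega> \<Longrightarrow> \<mu> - \<nu> \<in> measures_on \<Omega>"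
  by (rule subspace_diff[OF subspace_measures_on])

lemma nonneg_scale: "nonneg_measure \<mu> \<Longrightarrow> 0 \<le> c \<Longrightarrow> nonneg_measure (c *\<^sub>R \<mu>)"
  by (simp add: nonneg_measure_def scaleR_radon.rep_eq)

lemma nonneg_zero: "nonneg_measure 0"
  by (simp add: nonneg_measure_def zero_radon.rep_eq)

text \<open>The integrals of the functions \<open>max 0 (1 - n dist(x, K))\<close> determine the measure of a closed set \<open>K\<close>.\<close>

lemma pairing_eq_0_imp_zero:
  assumes \<Omega>: "compact \<Omega>" and \<mu>: "\<mu> \<in> measures_on \<Omega>"
    and zero: "\<And>\<phi>. continuous_on \<Omega> \<phi> \<Longrightarrow> pairing \<Omega> \<phi> \<mu> = 0"
  shows "\<mu> = 0"
proof -
  have b: "\<Omega> \<in> sets borel" by (rule borel_compact[OF \<Omega>])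
  have lim: "(\<lambda>n. LINT x:\<Omega>|pos_part \<nu>. max 0 (1 - real n * infdist x K)) \<longlonglongrightarrow> measure (pos_part \<nu>) (\<Omega> \<inter> K)"
    if K: "closed K" "K \<noteq> {}" for K \<nu>
  proof -
    interpret finite_measure "pos_part \<nu>" by (rule finite_measure_pos_part)
    have "(\<lambda>n. LINT x|pos_part \<nu>. indicator \<Omega> x *\<^sub>R max 0 (1 - real n * infdist x K)) \<longlonglongrightarrow>
      (LINT x|pos_part \<nu>. indicator (\<Omega> \<inter> K) x)"
    proof (rule integral_dominated_convergence[where w = "\<lambda>_. 1"])
      show "(indicator (\<Omega> \<inter> K) :: 'a \<Rightarrow> real) \<in> borel_measurable (pos_part \<nu>)"
        using b K by (auto intro!: borel_measurable_indicator)
      show "(\<lambda>x. indicator \<Omega> x *\<^sub>R max 0 (1 - real n * infdist x K)) \<in> borel_measurable (pos_part \<nu>)" for n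
        using b by (auto intro!: borel_measurable_continuous_on_indicator continuous_intros simp: measurable_cong_sets[OF sets_pos_part refl] simp del: real_scaleR_def)
      show "AE x in pos_part \<nu>. norm (indicator \<Omega> x *\<^sub>R max 0 (1 - real n * infdist x K)) \<le> 1" for n
        by (auto simp: indicator_def infdist_nonneg)
      show "AE x in pos_part \<nu>. (\<lambda>n. indicator \<Omega> x *\<^sub>R max 0 (1 - real n * infdist x K)) \<longlonglongrightarrow> indicator (\<Omega> \<inter> K) x"
      proof (rule AE_I2)
        fix x
        show "(\<lambda>n. indicator \<Omega> x *\<^sub>R max 0 (1 - real n * infdist x K)) \<longlonglongrightarrow> indicator (\<Omega> \<inter> K) x"
        proof (cases "x \<in> K")
          case False
          then have pos: "infdist x K > 0"
            using K by (simp add: infdist_pos_not_in_closed)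
          obtain N where N: "1 / infdist x K < real N" using reals_Archimedean2 by blast
          have "max 0 (1 - real n * infdist x K) = 0" if "n \<ge> N" for n
          proof -
            have "1 \<le> real N * infdist x K" using N pos by (simp add: field_simps)
            also have "\<dots> \<le> real n * infdist x K" using that pos by (intro mult_right_mono) auto
            finally show ?thesis by simp
          qed
          then have "\<forall>\<^sub>F n in sequentially. indicator \<Omega> x *\<^sub>R max 0 (1 - real n * infdist x K) = 0"
            unfolding eventually_sequentially by (intro exI[of _ N]) simp
          then show ?thesis using False by (simp add: tendsto_eventually)
        qed (simp add: indicator_def)
      qed
    qed simp
    then show ?thesis using b K by (simp add: set_lebesgue_integral_def)
  qed
  have cl: "measure (pos_part \<mu>) (\<Omega> \<inter> K) = measure (pos_part (- \<mu>)) (\<Omega> \<inter> K)" if K: "closed K" for K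
  \<comment> \<open>\<open>infdist\<close> to the empty set is 0 by convention, so
    \<open>lim\<close> would be false for it.\<close>
  proof (cases "K = {}")
    case False
    have "continuous_on \<Omega> (\<lambda>x. max 0 (1 - real n * infdist x K))" for n
      by (intro continuous_intros)
    then have "(LINT x:\<Omega>|pos_part \<mu>. max 0 (1 - real n * infdist x K)) =
      (LINT x:\<Omega>|pos_part (- \<mu>). max 0 (1 - real n * infdist x K))" for n
      using zero[of "\<lambda>x. max 0 (1 - real n * infdist x K)"] by (simp add: pairing_def)
    then show ?thesis using lim[OF K False, of \<mu>] lim[OF K False, of "- \<mu>"] LIMSEQ_unique by simp
  qed simp
  have b': "\<Omega> \<in> sets (pos_part \<nu>)" for \<nu> :: "'a radon" using b by simp
  \<comment> \<open>The density restricts both parts to \<Omega>. The closed sets form an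
    intersection-stable generator, and \<open>UNIV\<close> is itself closed and of finite measure,
    so a constant sequence exhausts the space.\<close>
  have "density (pos_part \<mu>) (indicator \<Omega>) = density (pos_part (- \<mu>)) (indicator \<Omega>)"
  proof (rule measure_eqI_generator_eq[where E = "Collect closed" and \<Omega> = UNIV and A = "\<lambda>_. UNIV"])
    fix K :: "'a set" assume "K \<in> Collect closed"
    then have K: "closed K" by simp
    have "emeasure (density (pos_part \<nu>) (indicator \<Omega>)) K = emeasure (pos_part \<nu>) (\<Omega> \<inter> K)" for \<nu> :: "'a radon"
      using K b by (subst emeasure_density) (auto simp flip: indicator_inter_arith intro: borel_measurable_indicator)
    then show "emeasure (density (pos_part \<mu>) (indicator \<Omega>)) K = emeasure (density (pos_part (- \<mu>)) (indicator \<Omega>)) K"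
      using cl[OF K] finite_measure_pos_part[of \<mu>] finite_measure_pos_part[of "- \<mu>"]
      by (simp add: finite_measure.emeasure_eq_measure)
  next
    show "sets (density (pos_part \<mu>) (indicator \<Omega>)) = sigma_sets UNIV (Collect closed)"
      "sets (density (pos_part (- \<mu>)) (indicator \<Omega>)) = sigma_sets UNIV (Collect closed)"
      by (simp_all add: borel_eq_closed)
    have "emeasure (density (pos_part \<mu>) (indicator \<Omega>)) UNIV \<le> emeasure (pos_part \<mu>) UNIV"
      using b by (subst emeasure_density) (auto intro!: borel_measurable_indicator simp: emeasure_mono)
    then show "emeasure (density (pos_part \<mu>) (indicator \<Omega>)) UNIV \<noteq> \<infinity>" for i :: nat
      using finite_measure.emeasure_finite[OF finite_measure_pos_part, of \<mu> UNIV] by (auto simp: top_unique)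
  qed (auto simp: Int_stable_def)
  then have eq: "measure (pos_part \<mu>) (\<Omega> \<inter> A) = measure (pos_part (- \<mu>)) (\<Omega> \<inter> A)" if "A \<in> sets borel" for A
  proof -
    have "emeasure (density (pos_part \<nu>) (indicator \<Omega>)) A = emeasure (pos_part \<nu>) (\<Omega> \<inter> A)" for \<nu> :: "'a radon"
      using that b by (subst emeasure_density) (auto simp flip: indicator_inter_arith intro: borel_measurable_indicator)
    then show ?thesis using \<open>density (pos_part \<mu>) _ = _\<close> by (metis measure_def)
  qed
  have "mass \<mu> A = 0" for A
  proof (cases "A \<in> sets borel")
    case True
    have "mass \<mu> ((\<Omega> \<inter> A) \<union> (A - \<Omega>)) = mass \<mu> (\<Omega> \<inter> A) + mass \<mu> (A - \<Omega>)"
      using True b by (intro mass_Un) auto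
    moreover have "mass \<mu> (A - \<Omega>) = 0" using \<mu> True b unfolding measures_on_def by auto
    moreover have "mass \<mu> (\<Omega> \<inter> A) = 0" using jordan_decomposition[of "\<Omega> \<inter> A" \<mu>] eq[OF True] True b by auto
    moreover have "(\<Omega> \<inter> A) \<union> (A - \<Omega>) = A" by auto
    ultimately show ?thesis by simp
  next
    case False
    then show ?thesis by transfer (simp add: signed_radon_def)
  qed
  then show ?thesis by transfer auto
qed

section \<open>Weak-* sequential compactness\<close>

text \<open>
  Schoenberg's space-filling curve. The function \<open>digit_wave\<close> has period 2 and reads off
  the first ternary digit of those \<open>t\<close> all of whose digits are 0 or 2.
\<close>

definition digit_wave :: "real \<Rightarrow> real" where
  "digit_wave t = max 0 (min 1 (1 / 2 - cos (pi * t)))"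

text \<open>A point of the Cantor set. With ternary digits 0 and 2 only, a gap of length 1/3
  separates the two choices of the first digit, which is what allows a continuous function to read
  it.\<close>

definition cantor_real :: "(nat \<Rightarrow> bool) \<Rightarrow> real" where
  "cantor_real a = (\<Sum>m. of_bool (a m) * (2 / 3) * (1 / 3) ^ m)"

lemma summable_cantor_real: "summable (\<lambda>m. of_bool (a m) * (2 / 3) * (1 / 3 :: real) ^ m)"
  by (rule summable_comparison_test'[where N = 0 and g = "\<lambda>m. (1 / 3) ^ m"])
    (auto simp: summable_geometric of_bool_def)

lemma cantor_real_rec: "cantor_real a = of_bool (a 0) * (2 / 3) + cantor_real (\<lambda>m. a (Suc m)) / 3"
proof -
  have "cantor_real a = of_bool (a 0) * (2 / 3) + (\<Sum>m. of_bool (a (Suc m)) * (2 / 3) * (1 / 3) ^ Suc m)"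
    unfolding cantor_real_def by (subst suminf_split_head[OF summable_cantor_real]) simp
  also have "(\<Sum>m. of_bool (a (Suc m)) * (2 / 3) * (1 / 3) ^ Suc m) =
      (\<Sum>m. (of_bool (a (Suc m)) * (2 / 3) * (1 / 3) ^ m) * (1 / 3 :: real))"
    by (simp add: field_simps)
  also have "\<dots> = cantor_real (\<lambda>m. a (Suc m)) * (1 / 3)"
    unfolding cantor_real_def by (rule suminf_mult2[symmetric, OF summable_cantor_real])
  finally show ?thesis by simp
qed

lemma cantor_real_bounds: "0 \<le> cantor_real a" "cantor_real a \<le> 1"
proof -
  show "0 \<le> cantor_real a"
    unfolding cantor_real_def by (intro suminf_nonneg summable_cantor_real) simp
  have "cantor_real a \<le> (\<Sum>m. (2 / 3) * (1 / 3 :: real) ^ m)"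
    unfolding cantor_real_def
    by (intro suminf_le summable_cantor_real summable_mult summable_geometric) (auto simp: of_bool_def)
  also have "\<dots> = 1" by (subst suminf_mult) (auto simp: suminf_geometric summable_geometric)
  finally show "cantor_real a \<le> 1" .
qed

lemma digit_wave_bounds: "0 \<le> digit_wave t" "digit_wave t \<le> 1"
  by (auto simp: digit_wave_def)

lemma digit_wave_periodic: "digit_wave (2 * real n + t) = digit_wave t"
proof -
  have "cos (pi * (2 * real n + t)) = cos (pi * t + 2 * real n * pi)" by (simp add: algebra_simps)
  also have "\<dots> = cos (pi * t)" by (simp add: cos_add sin_times_pi_eq_0)
  finally show ?thesis by (simp add: digit_wave_def)
qed

text \<open>The first digit puts the point into [0, 1/3] or into [2/3, 1]. There cos (pi * t) is at
  least 1/2 or at most -1/2, and the clipping sends these ranges exactly to 0 and 1.\<close>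

lemma digit_wave_cantor_real_0: "digit_wave (cantor_real a) = of_bool (a 0)"
proof -
  let ?r = "cantor_real (\<lambda>m. a (Suc m)) / 3"
  have r: "0 \<le> ?r" "?r \<le> 1 / 3" using cantor_real_bounds[of "\<lambda>m. a (Suc m)"] by auto
  show ?thesis
  proof (cases "a 0")
    case False
    then have c: "cantor_real a = ?r" by (subst cantor_real_rec) simp
    have "cos (pi * (1 / 3)) \<le> cos (pi * cantor_real a)"
      unfolding c using r by (intro cos_monotone_0_pi_le mult_left_mono) auto
    then have "1 / 2 \<le> cos (pi * cantor_real a)" using cos_60 by simp
    then show ?thesis using False by (simp add: digit_wave_def)
  next
    case True
    then have c: "cantor_real a = 2 / 3 + ?r" by (subst cantor_real_rec) simp
    have "cos (pi * cantor_real a) \<le> cos (pi * (2 / 3))"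
      unfolding c
    proof (rule cos_monotone_0_pi_le)
      have "pi * (2 / 3 + ?r) \<le> pi * 1" using r by (intro mult_left_mono) auto
      then show "pi * (2 / 3 + ?r) \<le> pi" by simp
      show "pi * (2 / 3) \<le> pi * (2 / 3 + ?r)" using r by (intro mult_left_mono) auto
    qed simp
    moreover have "cos (pi * (2 / 3)) = - (1 / 2)" using cos_120 by (simp add: field_simps)
    ultimately have "cos (pi * cantor_real a) \<le> - (1 / 2)" by linarith
    then show ?thesis using True by (simp add: digit_wave_def)
  qed
qed

text \<open>Multiplication by 3 shifts the expansion. A digit that has left contributes 0 or 2 times
  a power of 3, an even integer, and is removed by the period.\<close>

lemma digit_wave_cantor_real: "digit_wave (3 ^ k * cantor_real a) = of_bool (a k)"
proof (induction k arbitrary: a)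
  case (Suc k)
  have "3 ^ Suc k * cantor_real a = 2 * real (of_bool (a 0) * 3 ^ k) + 3 ^ k * cantor_real (\<lambda>m. a (Suc m))"
    by (subst cantor_real_rec) (simp add: algebra_simps)
  then have "digit_wave (3 ^ Suc k * cantor_real a) = digit_wave (3 ^ k * cantor_real (\<lambda>m. a (Suc m)))"
    by (simp only: digit_wave_periodic)
  then show ?case using Suc by simp
qed (simp add: digit_wave_cantor_real_0)

text \<open>The parity of the floor of 2^(j+1) * x is the binary digit of weight 2^-(j+1), and the
  N-th partial sum is the floor of 2^N * x divided by 2^N.\<close>

lemma binary_digits_sums:
  fixes x :: real
  assumes "0 \<le> x" "x < 1"
  shows "(\<lambda>j. (1 / 2) ^ Suc j * of_bool (odd \<lfloor>2 ^ Suc j * x\<rfloor>)) sums x"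
proof -
  have part: "(\<Sum>j<N. (1 / 2) ^ Suc j * of_bool (odd \<lfloor>2 ^ Suc j * x\<rfloor>)) = real_of_int \<lfloor>2 ^ N * x\<rfloor> * (1 / 2) ^ N" for N
  proof (induction N)
    case 0
    have "\<lfloor>x\<rfloor> = 0" using assms by linarith
    then show ?case by simp
  next
    case (Suc N)
    define y where "y = 2 ^ N * x"
    have "\<lfloor>2 * y\<rfloor> = 2 * \<lfloor>y\<rfloor> \<or> \<lfloor>2 * y\<rfloor> = 2 * \<lfloor>y\<rfloor> + 1" by linarith
    then have "real_of_int \<lfloor>2 * y\<rfloor> = 2 * real_of_int \<lfloor>y\<rfloor> + of_bool (odd \<lfloor>2 * y\<rfloor>)" by auto
    moreover have "2 ^ Suc N * x = 2 * y" by (simp add: y_def)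
    ultimately have st: "real_of_int \<lfloor>2 ^ Suc N * x\<rfloor> = 2 * real_of_int \<lfloor>2 ^ N * x\<rfloor> + of_bool (odd \<lfloor>2 ^ Suc N * x\<rfloor>)"
      by (simp only: y_def)
    have "u * (1 / 2) ^ N + (1 / 2) ^ Suc N * v = (2 * u + v) * (1 / 2) ^ Suc N" for u v :: real
      by (simp add: field_simps)
    then show ?case unfolding sum.lessThan_Suc Suc by (subst st)
  qed
  have "(\<lambda>N. real_of_int \<lfloor>2 ^ N * x\<rfloor> * (1 / 2) ^ N) \<longlonglongrightarrow> x"
  proof (rule LIMSEQ_I)
    fix e :: real assume "0 < e"
    then obtain N0 where N0: "(1 / 2) ^ N0 < e" using real_arch_pow_inv[of e "1 / 2"] by auto
    have "norm (real_of_int \<lfloor>2 ^ N * x\<rfloor> * (1 / 2) ^ N - x) < e" if "N \<ge> N0" for N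
    proof -
      have "\<bar>real_of_int \<lfloor>2 ^ N * x\<rfloor> - 2 ^ N * x\<bar> \<le> 1" by linarith
      then have "\<bar>real_of_int \<lfloor>2 ^ N * x\<rfloor> - 2 ^ N * x\<bar> * (1 / 2) ^ N \<le> (1 / 2) ^ N"
        by (simp add: mult_left_le_one_le)
      moreover have "(real_of_int \<lfloor>2 ^ N * x\<rfloor> - 2 ^ N * x) * (1 / 2) ^ N = real_of_int \<lfloor>2 ^ N * x\<rfloor> * (1 / 2) ^ N - x"
        by (simp add: algebra_simps power_one_over)
      then have "\<bar>real_of_int \<lfloor>2 ^ N * x\<rfloor> - 2 ^ N * x\<bar> * (1 / 2) ^ N = \<bar>real_of_int \<lfloor>2 ^ N * x\<rfloor> * (1 / 2) ^ N - x\<bar>"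
        by (metis abs_mult abs_of_nonneg zero_le_divide_1_iff zero_le_numeral zero_le_power)
      moreover have "(1 / 2 :: real) ^ N \<le> (1 / 2) ^ N0" using that by (intro power_decreasing) auto
      ultimately show ?thesis using N0 unfolding real_norm_def by linarith
    qed
    then show "\<exists>N0. \<forall>N\<ge>N0. norm (real_of_int \<lfloor>2 ^ N * x\<rfloor> * (1 / 2) ^ N - x) < e" by blast
  qed
  then show ?thesis unfolding sums_def part .
qed

lemma continuous_digit_wave_series:
  "continuous_on UNIV (\<lambda>t. \<Sum>j. (1 / 2) ^ Suc j * digit_wave (c j * t))"
proof -
  have "uniform_limit UNIV (\<lambda>n t. \<Sum>j<n. (1 / 2) ^ Suc j * digit_wave (c j * t))
    (\<lambda>t. \<Sum>j. (1 / 2) ^ Suc j * digit_wave (c j * t)) sequentially"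
  proof (rule Weierstrass_m_test[where M = "\<lambda>j. (1 / 2) ^ Suc j"])
    show "norm ((1 / 2) ^ Suc j * digit_wave (c j * t)) \<le> (1 / 2) ^ Suc j" for j t
      using digit_wave_bounds[of "c j * t"] by (simp add: abs_mult)
    show "summable (\<lambda>j. (1 / 2 :: real) ^ Suc j)"
      by (subst summable_Suc_iff) (simp add: summable_geometric)
  qed
  then show ?thesis
    by (rule uniform_limit_theorem[rotated])
      (auto simp: digit_wave_def intro!: always_eventually continuous_intros)
qed

text \<open>\<open>s\<close> stores the binary digits of all coordinates in a single Cantor point,
  indexed through \<open>prod_encode\<close>, and \<open>H\<close> reads them back. \<open>H\<close>
  is continuous by uniform convergence, whereas \<open>s\<close> is shown to be Borel. The cube is
  half-open because the floors produce only zero digits at 1.\<close>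

lemma space_filling_curve_unit_cube:
  obtains s :: "'a::euclidean_space \<Rightarrow> real" and H :: "real \<Rightarrow> 'a"
  where "s \<in> borel_measurable borel" "\<And>x. s x \<in> {0..1}" "continuous_on UNIV H"
    "\<And>x. (\<And>b. b \<in> Basis \<Longrightarrow> 0 \<le> x \<bullet> b \<and> x \<bullet> b < 1) \<Longrightarrow> H (s x) = x"
proof -
  define idx where "idx = to_nat_on (Basis :: 'a set)"
  define D where "D x m = (case prod_decode m of (i, j) \<Rightarrow>
    odd \<lfloor>2 ^ Suc j * (x \<bullet> from_nat_into (Basis :: 'a set) i)\<rfloor>)" for x :: 'a and m
  define s where "s x = cantor_real (D x)" for x
  define H where "H t = (\<Sum>b\<in>Basis. (\<Sum>j. (1 / 2) ^ Suc j * digit_wave (3 ^ prod_encode (idx b, j) * t)) *\<^sub>R b)"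
    for t :: real
  have "s \<in> borel_measurable borel"
    unfolding s_def cantor_real_def D_def by (simp add: split_beta')
  moreover have "s x \<in> {0..1}" for x using cantor_real_bounds by (simp add: s_def)
  moreover have "continuous_on UNIV H"
    unfolding H_def by (intro continuous_on_sum continuous_on_scaleR continuous_digit_wave_series continuous_on_const)
  moreover have "H (s x) = x" if x: "\<And>b. b \<in> Basis \<Longrightarrow> 0 \<le> x \<bullet> b \<and> x \<bullet> b < 1" for x
  proof -
    have "(\<Sum>j. (1 / 2) ^ Suc j * digit_wave (3 ^ prod_encode (idx b, j) * s x)) = x \<bullet> b" if b: "b \<in> Basis" for b
    proof -
      have "from_nat_into Basis (idx b) = b"
        unfolding idx_def using b by (intro from_nat_into_to_nat_on) (auto simp: countable_finite)
      then have "digit_wave (3 ^ prod_encode (idx b, j) * s x) = of_bool (odd \<lfloor>2 ^ Suc j * (x \<bullet> b)\<rfloor>)" for j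
        unfolding s_def digit_wave_cantor_real by (simp add: D_def)
      then show ?thesis using sums_unique[OF binary_digits_sums, of "x \<bullet> b"] x[OF b] by simp
    qed
    then show ?thesis unfolding H_def by (simp add: euclidean_representation)
  qed
  ultimately show thesis by (rule that)
qed

lemma space_filling_curve:
  fixes \<Omega> :: "'a::euclidean_space set"
  assumes "bounded \<Omega>"
  obtains s :: "'a \<Rightarrow> real" and H :: "real \<Rightarrow> 'a"
  where "s \<in> borel_measurable borel" "\<And>x. s x \<in> {0..1}" "continuous_on UNIV H"
    "\<And>x. x \<in> \<Omega> \<Longrightarrow> H (s x) = x"
proof -
  obtain c where c: "c > 0" "\<And>x. x \<in> \<Omega> \<Longrightarrow> norm x < c"
    using assms bounded_pos_less by metis
  obtain s :: "'a \<Rightarrow> real" and H :: "real \<Rightarrow> 'a"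
    where s: "s \<in> borel_measurable borel" "\<And>x. s x \<in> {0..1}" and H: "continuous_on UNIV H"
    and Hs: "\<And>x. (\<And>b. b \<in> Basis \<Longrightarrow> 0 \<le> x \<bullet> b \<and> x \<bullet> b < 1) \<Longrightarrow> H (s x) = x"
    using space_filling_curve_unit_cube by blast
  \<comment> \<open>Coordinates of points of \<Omega> lie in (-c, c), so \<open>?T\<close> maps
    \<Omega> into the open unit cube.\<close>
  let ?T = "\<lambda>x. (1 / (2 * c)) *\<^sub>R (x + c *\<^sub>R One)"
  show thesis
  proof (rule that[of "\<lambda>x. s (?T x)" "\<lambda>t. (2 * c) *\<^sub>R H t - c *\<^sub>R One"])
    show "(\<lambda>x. s (?T x)) \<in> borel_measurable borel"
      by (rule measurable_compose[OF _ s(1)]) simp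
    show "s (?T x) \<in> {0..1}" for x using s(2) .
    show "continuous_on UNIV (\<lambda>t. (2 * c) *\<^sub>R H t - c *\<^sub>R One)" using H by (intro continuous_intros)
    show "(2 * c) *\<^sub>R H (s (?T x)) - c *\<^sub>R One = x" if "x \<in> \<Omega>" for x
    proof -
      have "H (s (?T x)) = ?T x"
      proof (rule Hs)
        fix b :: 'a assume b: "b \<in> Basis"
        have "\<bar>x \<bullet> b\<bar> < c" using c(2)[OF that] Basis_le_norm[OF b, of x] by linarith
        then show "0 \<le> ?T x \<bullet> b \<and> ?T x \<bullet> b < 1"
          using b c(1) by (simp add: inner_add_left field_simps abs_less_iff)
      qed
      then show ?thesis using c(1) by simp
    qed
  qed
qed

lemma borel_measurable_if_sets_borel:
  "f \<in> borel_measurable borel \<Longrightarrow> sets M = sets borel \<Longrightarrow> f \<in> borel_measurable M"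
  by (simp cong: measurable_cong_sets)

text \<open>The images under the Borel map \<open>s\<close> live on [0, 1] and are tight, so a
  subsequence converges weakly on the line; its limit is pushed forward by \<open>H\<close>. As
  \<open>H\<close> is continuous and inverts \<open>s\<close> on \<Omega>, a continuous test
  function \<psi> becomes the continuous function \<psi> o H and keeps its integral.\<close>

lemma prob_weak_compact:
  fixes \<Omega> :: "'a::euclidean_space set" and M :: "nat \<Rightarrow> 'a measure"
  assumes \<Omega>: "compact \<Omega>" and M: "\<And>k. prob_space (M k)" "\<And>k. sets (M k) = sets borel"
    and conc: "\<And>k. AE x in M k. x \<in> \<Omega>"
  obtains r :: "nat \<Rightarrow> nat" and M' where "strict_mono r" "prob_space M'" "sets M' = sets borel"
    "AE x in M'. x \<in> \<Omega>"
    "\<And>\<phi> :: 'a \<Rightarrow> real. continuous_on \<Omega> \<phi> \<Longrightarrow>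
      (\<lambda>k. LINT x:\<Omega>|M (r k). \<phi> x) \<longlonglongrightarrow> (LINT x:\<Omega>|M'. \<phi> x)"
proof -
  obtain s :: "'a \<Rightarrow> real" and H :: "real \<Rightarrow> 'a"
    where s: "s \<in> borel_measurable borel" "\<And>x. s x \<in> {0..1}" and H: "continuous_on UNIV H"
    and Hs: "\<And>x. x \<in> \<Omega> \<Longrightarrow> H (s x) = x"
    using space_filling_curve[OF compact_imp_bounded[OF \<Omega>]] by blast
  have Hm: "H \<in> borel_measurable borel" using H by (rule borel_measurable_continuous_onI)
  define N where "N k = distr (M k) borel s" for k
  have sM: "s \<in> borel_measurable (M k)" for k by (rule borel_measurable_if_sets_borel[OF s(1) M(2)])
  have N: "real_distribution (N k)" for k
    unfolding N_def real_distribution_def real_distribution_axioms_def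
    using prob_space.prob_space_distr[OF M(1) sM] by simp
  have "tight N"
    unfolding tight_def
  proof (intro conjI allI impI N)
    fix e :: real assume "0 < e"
    \<comment> \<open>Tightness is stated with intervals open on the left, and \<open>s\<close> may
      take the value 0; hence the left end -1.\<close>
    have "measure (N k) {-1<..1} = 1" for k
    proof -
      interpret prob_space "M k" by (rule M(1))
      have s1: "-1 < s x" for x using s(2)[of x] by simp
      have "s -` {-1<..1} \<inter> space (M k) = space (M k)" using s1 s(2) by auto
      then show ?thesis unfolding N_def using sM by (simp add: measure_distr prob_space)
    qed
    then show "\<exists>a b. a < b \<and> (\<forall>k. 1 - e < measure (N k) {a<..b})"
      using \<open>0 < e\<close> by (intro exI[of _ "-1"] exI[of _ 1]) simp
  qed
  then obtain r N' where r: "strict_mono r" "real_distribution N'" "weak_conv_m (N \<circ> r) N'"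
    using tight_imp_convergent_subsubsequence[of N id] by (auto simp: strict_mono_id)
  interpret N': real_distribution N' by fact
  define M' where "M' = distr N' borel H"
  have HN: "H \<in> borel_measurable N'" using Hm by simp
  have M': "prob_space M'" "sets M' = sets borel"
    unfolding M'_def using N'.prob_space_distr[OF HN] by auto
  have conv: "(\<lambda>k. LINT x|M (r k). \<psi> x) \<longlonglongrightarrow> (LINT x|M'. \<psi> x)"
    if \<psi>: "continuous_on UNIV \<psi>" "\<And>x. norm (\<psi> x) \<le> B" for \<psi> :: "'a \<Rightarrow> real" and B
  proof -
    have \<psi>m: "\<psi> \<in> borel_measurable borel" using \<psi>(1) by (rule borel_measurable_continuous_onI)
    have "(\<lambda>k. LINT t|(N \<circ> r) k. \<psi> (H t)) \<longlonglongrightarrow> (LINT t|N'. \<psi> (H t))"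
    proof (rule weak_conv_imp_integral_bdd_continuous_conv[where B = B])
      show "isCont (\<lambda>t. \<psi> (H t)) t" for t
        using continuous_on_compose2[OF \<psi>(1) H] by (simp add: continuous_on_eq_continuous_at)
      show "\<And>x. norm (\<psi> (H x)) \<le> B" using \<psi>(2) by blast
    qed (use r N in \<open>auto simp: comp_def\<close>)
    moreover have "(LINT t|(N \<circ> r) k. \<psi> (H t)) = (LINT x|M (r k). \<psi> x)" for k
    proof -
      have "(LINT t|(N \<circ> r) k. \<psi> (H t)) = (LINT x|M (r k). \<psi> (H (s x)))"
        unfolding N_def comp_def using sM Hm \<psi>m by (subst integral_distr) auto
      also have "\<dots> = (LINT x|M (r k). \<psi> x)"
      proof (rule integral_cong_AE)
        show "(\<lambda>x. \<psi> (H (s x))) \<in> borel_measurable (M (r k))"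
          by (rule measurable_compose[OF sM]) (rule measurable_compose[OF Hm \<psi>m])
        show "\<psi> \<in> borel_measurable (M (r k))" by (rule borel_measurable_if_sets_borel[OF \<psi>m M(2)])
        show "AE x in M (r k). \<psi> (H (s x)) = \<psi> x"
          using conc[of "r k"] by eventually_elim (simp add: Hs)
      qed
      finally show ?thesis .
    qed
    moreover have "(LINT t|N'. \<psi> (H t)) = (LINT x|M'. \<psi> x)"
      unfolding M'_def using HN \<psi>m by (simp add: integral_distr)
    ultimately show ?thesis by simp
  qed
  \<comment> \<open>Required below because \<open>infdist\<close> to the empty set is identically
    0.\<close>
  have ne: "\<Omega> \<noteq> {}"
  proof
    assume "\<Omega> = {}"
    then have "AE x in M 0. False" using conc[of 0] by simp
    then show False using prob_space.AE_False[OF M(1)] by blast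
  qed
  have conc': "AE x in M'. x \<in> \<Omega>"
  proof -
    interpret M': prob_space M' by (rule M'(1))
    \<comment> \<open>Concentration on \<Omega> passes to the limit: this bounded continuous
      function has integral 0 under each measure of the subsequence, hence under the limit, and it
      vanishes only on the closed set \<Omega>.\<close>
    let ?d = "\<lambda>x. min 1 (infdist x \<Omega>)"
    have c: "continuous_on UNIV ?d" by (intro continuous_intros)
    have b: "norm (?d x) \<le> 1" for x by (simp add: infdist_nonneg)
    have dm: "?d \<in> borel_measurable M'"
      by (rule borel_measurable_if_sets_borel[OF borel_measurable_continuous_onI[OF c] M'(2)])
    have "(LINT x|M (r k). ?d x) = 0" for k
      by (rule integral_eq_zero_AE) (use conc[of "r k"] in eventually_elim, simp)
    then have "(LINT x|M'. ?d x) = 0"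
      using conv[OF c b] LIMSEQ_unique[OF _ tendsto_const] by fastforce
    moreover have "integrable M' ?d"
      by (rule M'.integrable_const_bound[of _ 1]) (use b dm in auto)
    ultimately have "AE x in M'. ?d x = 0"
      by (subst (asm) integral_nonneg_eq_0_iff_AE) (auto simp: infdist_nonneg)
    then show ?thesis
      by eventually_elim (use ne compact_imp_closed[OF \<Omega>] in_closed_iff_infdist_zero in \<open>auto simp: min_def split: if_splits\<close>)
  qed
  show thesis
  proof (rule that[OF r(1) M' conc'])
    fix \<phi> :: "'a \<Rightarrow> real" assume \<phi>: "continuous_on \<Omega> \<phi>"
    have "bounded (\<phi> ` \<Omega>)" using \<Omega> \<phi> by (simp add: compact_continuous_image compact_imp_bounded)
    then obtain B where B: "0 < B" "\<And>x. x \<in> \<Omega> \<Longrightarrow> norm (\<phi> x) \<le> B" unfolding bounded_pos by auto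
    \<comment> \<open>Test functions are continuous on \<Omega> only. The Tietze extension keeps
      their bound, and the integrals do not change because all measures involved are concentrated on
      \<Omega>.\<close>
    have "closedin (top_of_set UNIV) \<Omega>" using compact_imp_closed[OF \<Omega>] by simp
    then obtain \<psi> where \<psi>: "continuous_on UNIV \<psi>" "\<And>x. x \<in> \<Omega> \<Longrightarrow> \<psi> x = \<phi> x" "\<And>x. norm (\<psi> x) \<le> B"
      using Tietze[OF \<phi>, of UNIV B] B by (metis UNIV_I less_imp_le)
    have "(LINT x:\<Omega>|K. \<phi> x) = (LINT x|K. \<psi> x)" if K: "sets K = sets borel" "AE x in K. x \<in> \<Omega>" for K
      unfolding set_lebesgue_integral_def
    proof (rule integral_cong_AE)
      show "(\<lambda>x. indicator \<Omega> x *\<^sub>R \<phi> x) \<in> borel_measurable K"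
        by (rule borel_measurable_if_sets_borel[OF borel_measurable_continuous_on_indicator[OF borel_compact[OF \<Omega>] \<phi>] K(1)])
      show "\<psi> \<in> borel_measurable K"
        by (rule borel_measurable_if_sets_borel[OF borel_measurable_continuous_onI[OF \<psi>(1)] K(1)])
      show "AE x in K. indicator \<Omega> x *\<^sub>R \<phi> x = \<psi> x"
        using K(2) by eventually_elim (simp add: \<psi>(2))
    qed
    then show "(\<lambda>k. LINT x:\<Omega>|M (r k). \<phi> x) \<longlonglongrightarrow> (LINT x:\<Omega>|M'. \<phi> x)"
      using conv[OF \<psi>(1,3)] M(2) conc M'(2) conc' by simp
  qed
qed

lemma weak_star_compact_norm_1:
  fixes \<Omega> :: "'a::euclidean_space set"
  assumes \<Omega>: "compact \<Omega>" and \<mu>: "\<And>k. \<mu> k \<in> measures_on \<Omega>" "\<And>k. nonneg_measure (\<mu> k)" "\<And>k. norm (\<mu> k) = 1"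
  obtains r \<nu> where "strict_mono (r :: nat \<Rightarrow> nat)" "nonneg_measure \<nu>" "weak_star_tendsto \<Omega> (\<mu> \<circ> r) \<nu>"
proof -
  have b: "\<Omega> \<in> sets borel" using \<Omega> by (rule borel_compact)
  have M: "prob_space (pos_part (\<mu> k))" for k
  proof -
    interpret finite_measure "pos_part (\<mu> k)" by (rule finite_measure_pos_part)
    show ?thesis
      by (rule prob_spaceI)
        (use measure_pos_part_nonneg[OF \<mu>(2), of UNIV k] norm_nonneg_measure[OF \<mu>(2), of k] \<mu>(3)
          in \<open>simp add: emeasure_eq_measure\<close>)
  qed
  have conc: "AE x in pos_part (\<mu> k). x \<in> \<Omega>" for k
  proof -
    interpret finite_measure "pos_part (\<mu> k)" by (rule finite_measure_pos_part)
    have "measure (pos_part (\<mu> k)) (- \<Omega>) = 0"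
      using measure_pos_part_nonneg[OF \<mu>(2), of "- \<Omega>" k] b \<mu>(1)[of k] unfolding measures_on_def by auto
    then have "- \<Omega> \<in> null_sets (pos_part (\<mu> k))" using b by (auto simp: emeasure_eq_measure)
    then show ?thesis using AE_not_in by force
  qed
  obtain r M' where r: "strict_mono r" and M': "prob_space M'" "sets M' = sets borel" and AE: "AE x in M'. x \<in> \<Omega>"
    and conv: "\<And>\<phi> :: 'a \<Rightarrow> real. continuous_on \<Omega> \<phi> \<Longrightarrow>
      (\<lambda>k. LINT x:\<Omega>|pos_part (\<mu> (r k)). \<phi> x) \<longlonglongrightarrow> (LINT x:\<Omega>|M'. \<phi> x)"
    using prob_weak_compact[of \<Omega> "\<lambda>k. pos_part (\<mu> k)", OF \<Omega> M sets_pos_part conc] by blast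
  interpret M': prob_space M' by fact
  have fin: "finite_measure M'" by unfold_locales
  define \<nu> where "\<nu> = Radon (measure M')"
  have mass: "mass \<nu> = measure M'"
    unfolding \<nu>_def using signed_radon_measure[OF fin M'(2)] by (simp add: Radon_inverse)
  have "\<nu> \<in> measures_on \<Omega>"
    unfolding measures_on_def
  proof (intro CollectI ballI impI)
    fix A :: "'a set" assume A: "A \<in> sets borel" "A \<inter> \<Omega> = {}"
    have "AE x in M'. x \<notin> A" using AE by eventually_elim (use A in auto)
    then have "A \<in> null_sets M'" using A M'(2) by (simp add: AE_iff_null_sets)
    then show "mass \<nu> A = 0" unfolding mass by (auto simp: measure_def)
  qed
  moreover have "pairing \<Omega> \<phi> \<nu> = (LINT x:\<Omega>|M'. \<phi> x)" if "continuous_on \<Omega> \<phi>" for \<phi>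
  proof -
    have "pairing \<Omega> \<phi> \<nu> = (LINT x:\<Omega>|M'. \<phi> x) - (LINT x:\<Omega>|null_measure borel. \<phi> x)"
      by (rule pairing_eq_diff[OF fin M'(2) finite_measure_null]) (use \<Omega> that mass in auto)
    then show ?thesis by (simp add: set_lebesgue_integral_def)
  qed
  moreover have "pairing \<Omega> \<phi> (\<mu> k) = (LINT x:\<Omega>|pos_part (\<mu> k). \<phi> x)" if "continuous_on \<Omega> \<phi>" for \<phi> k
    by (rule pairing_nonneg_measure[OF \<mu>(2) \<Omega> that])
  ultimately have "weak_star_tendsto \<Omega> (\<mu> \<circ> r) \<nu>"
    unfolding weak_star_tendsto_def using conv by (simp add: C0_def)
  moreover have "nonneg_measure \<nu>" unfolding nonneg_measure_def mass by simp
  ultimately show thesis using that r by blast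
qed

text \<open>A measure is its norm times a measure of norm 1. One subsequence makes the normalised
  measures converge, a further one the norms in the compact interval [0, C]; the limit is the
  product.\<close>

lemma weak_star_compact:
  fixes \<Omega> :: "'a::euclidean_space set"
  assumes \<Omega>: "compact \<Omega>" and \<mu>: "\<And>k. \<mu> k \<in> measures_on \<Omega>" "\<And>k. nonneg_measure (\<mu> k)" "\<And>k. norm (\<mu> k) \<le> C"
  obtains r \<nu> where "strict_mono (r :: nat \<Rightarrow> nat)" "nonneg_measure \<nu>" "weak_star_tendsto \<Omega> (\<mu> \<circ> r) \<nu>"
proof (cases "\<Omega> = {}")
  case True
  have "\<mu> k = 0" for k
    using pairing_const[OF \<mu>(2) \<Omega> \<mu>(1), of 1 k] True by (simp add: pairing_def set_lebesgue_integral_def)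
  moreover have "0 \<in> measures_on \<Omega>" by (rule subspace_0[OF subspace_measures_on])
  ultimately show thesis
    by (intro that[of id 0]) (auto simp: strict_mono_id nonneg_zero weak_star_tendsto_def)
next
  case False
  then obtain p where p: "p \<in> \<Omega>" by blast
  \<comment> \<open>A zero measure has no direction; \<open>dirac p\<close> is an arbitrary
    substitute, multiplied by the norm 0 afterwards.\<close>
  define u where "u k = (if \<mu> k = 0 then dirac p else (1 / norm (\<mu> k)) *\<^sub>R \<mu> k)" for k
  have dp: "dirac p \<in> measures_on \<Omega>"
    using p discrete_subset_measures_on[of \<Omega>] unfolding discrete_measures_def by (meson image_eqI span_base subsetD)
  have nd: "norm (dirac p) = 1"
    using norm_nonneg_measure[OF nonneg_dirac, of p] by (simp add: mass_dirac)
  have u: "u k \<in> measures_on \<Omega>" "nonneg_measure (u k)" "norm (u k) = 1" for k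
    using dp nd \<mu> by (auto simp: u_def nonneg_dirac intro!: subspace_scale[OF subspace_measures_on] nonneg_scale)
  obtain r \<nu> where r: "strict_mono r" "nonneg_measure \<nu>" "weak_star_tendsto \<Omega> (u \<circ> r) \<nu>"
    by (rule weak_star_compact_norm_1[OF \<Omega> u])
  have eq: "\<mu> k = norm (\<mu> k) *\<^sub>R u k" for k by (simp add: u_def)
  have "\<forall>k. norm (\<mu> (r k)) \<in> {0..C}" using \<mu>(3) by simp
  then obtain l r' where r': "l \<in> {0..C}" "strict_mono r'" "((\<lambda>k. norm (\<mu> (r k))) \<circ> r') \<longlonglongrightarrow> l"
    using seq_compactE[OF compact_imp_seq_compact[OF compact_Icc]] by (metis (no_types, lifting))
  have "weak_star_tendsto \<Omega> (\<mu> \<circ> (r \<circ> r')) (l *\<^sub>R \<nu>)"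
    unfolding weak_star_tendsto_def
  proof (intro conjI ballI)
    show "l *\<^sub>R \<nu> \<in> measures_on \<Omega>"
      using r(3) by (intro subspace_scale[OF subspace_measures_on]) (simp add: weak_star_tendsto_def)
    fix \<phi> assume \<phi>: "\<phi> \<in> C0 \<Omega>"
    then have c: "continuous_on \<Omega> \<phi>" by (simp add: C0_def)
    have "(\<lambda>k. pairing \<Omega> \<phi> ((u \<circ> r) k)) \<longlonglongrightarrow> pairing \<Omega> \<phi> \<nu>"
      using r(3) \<phi> by (simp add: weak_star_tendsto_def)
    from LIMSEQ_subseq_LIMSEQ[OF this r'(2)]
    have "(\<lambda>k. norm (\<mu> (r (r' k))) * pairing \<Omega> \<phi> (u (r (r' k)))) \<longlonglongrightarrow> l * pairing \<Omega> \<phi> \<nu>"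
      using r'(3) by (intro tendsto_mult) (auto simp: comp_def)
    moreover have "pairing \<Omega> \<phi> (\<mu> k) = norm (\<mu> k) * pairing \<Omega> \<phi> (u k)" for k
      by (subst eq) (simp add: pairing_scale_measure[OF \<Omega> c])
    ultimately show "(\<lambda>k. pairing \<Omega> \<phi> ((\<mu> \<circ> (r \<circ> r')) k)) \<longlonglongrightarrow> pairing \<Omega> \<phi> (l *\<^sub>R \<nu>)"
      by (simp add: pairing_scale_measure[OF \<Omega> c])
  qed
  moreover have "strict_mono (r \<circ> r')" using r(1) r'(2) by (rule strict_mono_o)
  moreover have "nonneg_measure (l *\<^sub>R \<nu>)" using r(2) r'(1) by (intro nonneg_scale) auto
  ultimately show thesis using that by blast
qed

section \<open>Positive definite functions\<close>

lemma borel_measurable_cis [measurable]: "cis \<in> borel_measurable borel"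
  unfolding cis_conv_exp[abs_def] by measurable

lemma lborel_affine_integral:
  fixes f :: "'a::euclidean_space \<Rightarrow> 'b::{banach, second_countable_topology}"
  assumes c: "c \<noteq> 0"
  shows "integrable lborel f \<Longrightarrow> integrable lborel (\<lambda>x. f (t + c *\<^sub>R x))"
    and "f \<in> borel_measurable borel \<Longrightarrow> (LINT x|lborel. f x) = \<bar>c\<bar> ^ DIM('a) *\<^sub>R (LINT x|lborel. f (t + c *\<^sub>R x))"
proof -
  assume f: "integrable lborel f"
  then have m: "f \<in> borel_measurable borel" using borel_measurable_integrable by force
  have "integrable (density (distr lborel borel (\<lambda>x. t + c *\<^sub>R x)) (\<lambda>_. \<bar>c\<bar> ^ DIM('a))) f"
    using f lborel_affine[OF c, of t] by simp
  then have "integrable lborel (\<lambda>x. \<bar>c\<bar> ^ DIM('a) *\<^sub>R f (t + c *\<^sub>R x))"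
    using m by (subst (asm) integrable_density) (auto simp: integrable_distr_eq)
  from integrable_scaleR_right[OF this, of "inverse (\<bar>c\<bar> ^ DIM('a))"]
  show "integrable lborel (\<lambda>x. f (t + c *\<^sub>R x))" using c by simp
next
  assume m: "f \<in> borel_measurable borel"
  have "(LINT x|lborel. f x) = (LINT x|density (distr lborel borel (\<lambda>x. t + c *\<^sub>R x)) (\<lambda>_. \<bar>c\<bar> ^ DIM('a)). f x)"
    using lborel_affine[OF c, of t] by simp
  also have "\<dots> = \<bar>c\<bar> ^ DIM('a) *\<^sub>R (LINT x|lborel. f (t + c *\<^sub>R x))"
    using m by (subst integral_density) (auto simp: integral_distr)
  finally show "(LINT x|lborel. f x) = \<bar>c\<bar> ^ DIM('a) *\<^sub>R (LINT x|lborel. f (t + c *\<^sub>R x))" .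
qed

lemma lborel_integral_prod_Basis:
  fixes f :: "'a::euclidean_space \<Rightarrow> real \<Rightarrow> 'b::{real_normed_field, banach, second_countable_topology}"
  assumes f: "\<And>b. b \<in> Basis \<Longrightarrow> integrable lborel (f b)"
  shows "integrable lborel (\<lambda>x::'a. \<Prod>b\<in>Basis. f b (x \<bullet> b))"
    and "(LINT x|lborel. (\<Prod>b\<in>Basis. f b ((x::'a) \<bullet> b))) = (\<Prod>b\<in>Basis. (LINT t|lborel. f b t))"
proof -
  interpret product_sigma_finite "\<lambda>b::'a. lborel :: real measure" by unfold_locales
  let ?T = "\<lambda>g::'a \<Rightarrow> real. \<Sum>b\<in>Basis. g b *\<^sub>R b"
  have L: "(lborel :: 'a measure) = distr (\<Pi>\<^sub>M b\<in>Basis. lborel) borel ?T"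
    by (simp add: lborel_def[where 'a = 'a] lborel_eq_real)
  have m: "(\<lambda>x::'a. \<Prod>b\<in>Basis. f b (x \<bullet> b)) \<in> borel_measurable borel"
  proof (rule borel_measurable_prod)
    fix b :: 'a assume "b \<in> Basis"
    then have "f b \<in> borel_measurable borel" using borel_measurable_integrable[OF f] by simp
    then show "(\<lambda>x. f b (x \<bullet> b)) \<in> borel_measurable borel" by (rule measurable_compose[rotated]) simp
  qed
  have T: "?T \<in> (\<Pi>\<^sub>M b\<in>Basis. lborel) \<rightarrow>\<^sub>M borel" by measurable
  have eq: "(\<Prod>b\<in>Basis. f b (?T g \<bullet> b)) = (\<Prod>b\<in>Basis. f b (g b))" for g
    by (rule prod.cong) (auto simp: inner_sum_left inner_Basis if_distrib sum.delta cong: if_cong)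
  show "integrable lborel (\<lambda>x::'a. \<Prod>b\<in>Basis. f b (x \<bullet> b))"
    unfolding L integrable_distr_eq[OF T m] eq using f by (intro product_integrable_prod) auto
  show "(LINT x|lborel. (\<Prod>b\<in>Basis. f b ((x::'a) \<bullet> b))) = (\<Prod>b\<in>Basis. (LINT t|lborel. f b t))"
    unfolding L integral_distr[OF T m] eq using f by (intro product_integral_prod) auto
qed

section \<open>Gaussians and their Fourier transforms\<close>

lemma integrable_exp_neg_square: "integrable lborel (\<lambda>t::real. exp (- (t\<^sup>2 / 2)))"
proof -
  have "integrable lborel (\<lambda>t. sqrt (2 * pi) * std_normal_density t)"
    by (intro integrable_mult_right integrable_normal_density) simp
  then show ?thesis by (simp add: normal_density_def)
qed

text \<open>Up to normalisation this is the characteristic function of the standard normal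
  distribution at 2 * pi * x.\<close>

lemma fourier_exp_neg_square:
  "(LINT t|lborel. cis (2 * pi * x * t) * of_real (exp (- (t\<^sup>2 / 2)))) =
     of_real (sqrt (2 * pi) * exp (- ((2 * pi * x)\<^sup>2 / 2)))"
proof -
  have "of_real (exp (- ((2 * pi * x)\<^sup>2) / 2)) = char std_normal_distribution (2 * pi * x)"
    by (simp add: char_std_normal_distribution)
  also have "\<dots> = (LINT t|lborel. std_normal_density t *\<^sub>R iexp (2 * pi * x * t))"
    unfolding char_def by (subst integral_density) auto
  also have "\<dots> = (LINT t|lborel. of_real (1 / sqrt (2 * pi)) * (cis (2 * pi * x * t) * of_real (exp (- (t\<^sup>2 / 2)))))"
    by (rule Bochner_Integration.integral_cong) (auto simp: normal_density_def cis_conv_exp scaleR_conv_of_real)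
  also have "\<dots> = of_real (1 / sqrt (2 * pi)) * (LINT t|lborel. cis (2 * pi * x * t) * of_real (exp (- (t\<^sup>2 / 2))))"
    by simp
  finally show ?thesis by (simp add: field_simps)
qed

text \<open>This is exp (- norm \<xi> ^ 2 / 2), written as a product so that its integrals factor
  over the coordinates.\<close>

definition gauss :: "'a::euclidean_space \<Rightarrow> real" where
  "gauss \<xi> = (\<Prod>b\<in>Basis. exp (- ((\<xi> \<bullet> b)\<^sup>2 / 2)))"

text \<open>The Fourier transform of \<open>gauss\<close> with frequencies scaled by 2 * pi as in
  \<open>fourier_L1\<close>; the sign in the exponent does not matter since \<open>gauss\<close> is
  even.\<close>

definition gauss_hat :: "'a::euclidean_space \<Rightarrow> real" where
  "gauss_hat z = (\<Prod>b\<in>Basis. sqrt (2 * pi) * exp (- ((2 * pi * (z \<bullet> b))\<^sup>2 / 2)))"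

lemma gauss_pos: "0 < gauss \<xi>" and gauss_le_1: "gauss \<xi> \<le> 1"
  unfolding gauss_def by (auto intro!: prod_pos prod_le_1)

lemma gauss_hat_pos: "0 < gauss_hat z"
  unfolding gauss_hat_def by (auto intro!: prod_pos)

lemma borel_measurable_gauss [measurable]: "gauss \<in> borel_measurable borel"
  "gauss_hat \<in> borel_measurable borel"
  unfolding gauss_def[abs_def] gauss_hat_def[abs_def] by measurable

lemma integrable_gauss: "integrable lborel gauss"
  unfolding gauss_def[abs_def] by (intro lborel_integral_prod_Basis integrable_exp_neg_square)

lemma gauss_hat_eq: "gauss_hat z = sqrt (2 * pi) ^ DIM('a) * gauss ((2 * pi) *\<^sub>R (z :: 'a::euclidean_space))"
  unfolding gauss_hat_def gauss_def prod.distrib by (simp add: mult.commute)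

lemma integrable_gauss_hat: "integrable lborel (gauss_hat :: 'a::euclidean_space \<Rightarrow> real)"
  unfolding gauss_hat_eq[abs_def]
  using lborel_affine_integral(1)[OF _ integrable_gauss, of "2 * pi" 0] by simp

lemma fourier_gauss:
  "(LINT \<xi>|lborel. cis (2 * pi * (z \<bullet> \<xi>)) * of_real (gauss \<xi>)) = of_real (gauss_hat (z :: 'a::euclidean_space))"
proof -
  have c: "cis (\<Sum>b\<in>B. g b) = (\<Prod>b\<in>B. cis (g b))" if "finite B" for B :: "'a set" and g
    using that by (induction B rule: finite_induct) (auto simp: cis_mult[symmetric])
  have "cis (2 * pi * (z \<bullet> \<xi>)) * of_real (gauss \<xi>) =
    (\<Prod>b\<in>Basis. cis (2 * pi * (z \<bullet> b) * (\<xi> \<bullet> b)) * of_real (exp (- ((\<xi> \<bullet> b)\<^sup>2 / 2))))" for \<xi> :: 'a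
    unfolding gauss_def prod.distrib of_real_prod
    by (subst euclidean_inner) (simp add: sum_distrib_left c[symmetric] mult.assoc)
  moreover have "integrable lborel (\<lambda>t. cis (2 * pi * (z \<bullet> b) * t) * of_real (exp (- (t\<^sup>2 / 2))))" for b
    by (rule Bochner_Integration.integrable_bound[OF integrable_exp_neg_square]) (auto simp: norm_mult)
  ultimately show ?thesis
    using lborel_integral_prod_Basis(2)[of "\<lambda>b t. cis (2 * pi * (z \<bullet> b) * t) * of_real (exp (- (t\<^sup>2 / 2)))"]
    by (simp add: fourier_exp_neg_square gauss_hat_def)
qed

lemma fourier_gauss_scale:
  fixes z :: "'a::euclidean_space"
  assumes s: "0 < s"
  shows "(LINT \<xi>|lborel. cis (2 * pi * (z \<bullet> \<xi>)) * of_real (gauss (s *\<^sub>R \<xi>))) = of_real (gauss_hat (z /\<^sub>R s) / s ^ DIM('a))"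
proof -
  have "of_real (gauss_hat (z /\<^sub>R s)) =
    (LINT \<xi>|lborel. cis (2 * pi * ((z /\<^sub>R s) \<bullet> \<xi>)) * of_real (gauss \<xi>))"
    by (rule fourier_gauss[symmetric])
  also have "\<dots> = s ^ DIM('a) *\<^sub>R
    (LINT \<xi>|lborel. cis (2 * pi * ((z /\<^sub>R s) \<bullet> (0 + s *\<^sub>R \<xi>))) * of_real (gauss (0 + s *\<^sub>R \<xi>)))"
    by (subst lborel_affine_integral(2)[of s _ 0]) (use s in auto)
  also have "\<dots> = s ^ DIM('a) *\<^sub>R (LINT \<xi>|lborel. cis (2 * pi * (z \<bullet> \<xi>)) * of_real (gauss (s *\<^sub>R \<xi>)))"
  proof -
    have zs: "(z /\<^sub>R s) \<bullet> (0 + s *\<^sub>R \<xi>) = z \<bullet> \<xi>" for \<xi>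
      using s by (simp add: field_simps)
    show ?thesis unfolding zs by simp
  qed
  finally show ?thesis using s by (simp add: scaleR_conv_of_real)
qed

lemma integrable_gauss_scale:
  fixes s :: real
  assumes "0 < s"
  shows "integrable lborel (\<lambda>\<xi>::'a::euclidean_space. gauss (s *\<^sub>R \<xi>))"
  using lborel_affine_integral(1)[OF _ integrable_gauss, of s 0] assms by simp

text \<open>On the Fourier side the quadratic form of a sum of Dirac measures has a squared modulus
  as its weight; this is where positivity originates.\<close>

lemma norm_double_sum_cis:
  fixes x :: "'i \<Rightarrow> 'a::real_inner" and c :: "'i \<Rightarrow> real"
  shows "(\<Sum>i\<in>I. \<Sum>j\<in>I. of_real (c i * c j) * cis (2 * pi * ((x i - x j) \<bullet> \<xi>))) =
    of_real ((cmod (\<Sum>i\<in>I. of_real (c i) * cis (2 * pi * (x i \<bullet> \<xi>))))\<^sup>2)"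
proof -
  have "of_real ((cmod (\<Sum>i\<in>I. of_real (c i) * cis (2 * pi * (x i \<bullet> \<xi>))))\<^sup>2) =
    (\<Sum>i\<in>I. of_real (c i) * cis (2 * pi * (x i \<bullet> \<xi>))) * cnj (\<Sum>i\<in>I. of_real (c i) * cis (2 * pi * (x i \<bullet> \<xi>)))"
    by (rule complex_norm_square)
  also have "\<dots> = (\<Sum>i\<in>I. \<Sum>j\<in>I. (of_real (c i) * cis (2 * pi * (x i \<bullet> \<xi>))) * (of_real (c j) * cis (- (2 * pi * (x j \<bullet> \<xi>)))))"
    by (simp add: sum_product cis_cnj)
  also have "\<dots> = (\<Sum>i\<in>I. \<Sum>j\<in>I. of_real (c i * c j) * cis (2 * pi * ((x i - x j) \<bullet> \<xi>)))"
  proof (intro sum.cong refl)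
    fix i j
    have "cis (2 * pi * (x i \<bullet> \<xi>)) * cis (- (2 * pi * (x j \<bullet> \<xi>))) = cis (2 * pi * ((x i - x j) \<bullet> \<xi>))"
      by (simp add: cis_mult inner_diff_left right_diff_distrib)
    then show "(of_real (c i) * cis (2 * pi * (x i \<bullet> \<xi>))) * (of_real (c j) * cis (- (2 * pi * (x j \<bullet> \<xi>)))) =
      of_real (c i * c j) * cis (2 * pi * ((x i - x j) \<bullet> \<xi>))"
      by (metis (no_types, lifting) mult.assoc mult.left_commute of_real_mult)
  qed
  finally show ?thesis by simp
qed

text \<open>
  Tested against the Gaussian regularisation of a finite sum of Dirac measures, the
  \<open>L2\<close>-convergent truncated Fourier transforms of \<open>\<rho>\<close> give the Fourier
  representation of a regularised quadratic form without Plancherel's theorem.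
\<close>

lemma regularised_form_nonneg:
  fixes \<rho> :: "'a::euclidean_space \<Rightarrow> real" and x :: "'i \<Rightarrow> 'a" and c :: "'i \<Rightarrow> real"
  assumes meas: "\<rho> \<in> borel_measurable borel" and B: "\<And>z. \<bar>\<rho> z\<bar> \<le> B"
    and hat: "has_fourier_L2 \<rho> \<rho>_hat" and pos: "AE \<xi> in lborel. \<rho>_hat \<xi> \<in> \<real>\<^sub>\<ge>\<^sub>0"
    and I: "finite I" and s: "0 < s"
  shows "0 \<le> (\<Sum>i\<in>I. \<Sum>j\<in>I. c i * c j * (LINT z|lborel. \<rho> z * gauss_hat ((x i - x j - z) /\<^sub>R s)))"
proof -
  note [measurable] = meas
  \<comment> \<open>The weight of the regularised form on the Fourier side. It is nonnegative and
    below a multiple of a Gaussian, hence both integrable and square-integrable.\<close>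
  define W where "W \<xi> = (cmod (\<Sum>i\<in>I. of_real (c i) * cis (2 * pi * (x i \<bullet> \<xi>))))\<^sup>2 * gauss (s *\<^sub>R \<xi>)" for \<xi>
  define \<rho>R where "\<rho>R R z = indicator (cball 0 R) z * \<rho> z" for R z
  define T where "T f = (\<Sum>i\<in>I. \<Sum>j\<in>I. c i * c j * (LINT z|lborel. f z * gauss_hat ((x i - x j - z) /\<^sub>R s)))"
    for f :: "'a \<Rightarrow> real"
  have Wm [measurable]: "W \<in> borel_measurable borel" unfolding W_def[abs_def] by measurable
  define C where "C = (\<Sum>i\<in>I. \<bar>c i\<bar>)\<^sup>2"
  have C0: "0 \<le> C" unfolding C_def by simp
  have W0: "0 \<le> W \<xi>" for \<xi> unfolding W_def by (simp add: less_imp_le[OF gauss_pos])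
  have WC: "W \<xi> \<le> C * gauss (s *\<^sub>R \<xi>)" for \<xi>
  proof -
    have "cmod (\<Sum>i\<in>I. of_real (c i) * cis (2 * pi * (x i \<bullet> \<xi>))) \<le> (\<Sum>i\<in>I. \<bar>c i\<bar>)"
      by (rule order_trans[OF norm_sum]) (simp add: norm_mult)
    then show ?thesis unfolding W_def C_def
      by (intro mult_right_mono power_mono) (auto simp: less_imp_le[OF gauss_pos])
  qed
  have g: "integrable lborel (\<lambda>\<xi>::'a. gauss (s *\<^sub>R \<xi>))" by (rule integrable_gauss_scale[OF s])
  have Wi: "integrable lborel W"
    by (rule Bochner_Integration.integrable_bound[of _ "\<lambda>\<xi>. C * gauss (s *\<^sub>R \<xi>)"])
      (use g W0 in \<open>auto intro: order_trans[OF WC abs_ge_self]\<close>)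
  have WC': "W \<xi> \<le> C" for \<xi>
    using WC[of \<xi>] mult_left_le[OF gauss_le_1 C0, of "s *\<^sub>R \<xi>"] by simp
  have W2i: "integrable lborel (\<lambda>\<xi>. (W \<xi>)\<^sup>2)"
  proof (rule Bochner_Integration.integrable_bound[of _ "\<lambda>\<xi>. C * W \<xi>"])
    show "AE \<xi> in lborel. norm ((W \<xi>)\<^sup>2) \<le> norm (C * W \<xi>)"
      using mult_right_mono[OF WC' W0] W0 C0 by (simp add: power2_eq_square)
  qed (use Wi in auto)
  have \<rho>Rm [measurable]: "\<rho>R R \<in> borel_measurable borel" for R
    unfolding \<rho>R_def[abs_def] by (intro borel_measurable_times borel_measurable_indicator meas) simp
  have \<rho>Ri: "integrable lborel (\<rho>R R)" for R
  proof (rule Bochner_Integration.integrable_bound[of _ "\<lambda>z. B * indicator (cball 0 R) z"])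
    show "integrable lborel (\<lambda>z::'a. B * indicator (cball 0 R) z)"
      using emeasure_bounded_finite[of "cball (0::'a) R"]
      by (intro integrable_mult_right integrable_real_indicator) auto
    show "AE z in lborel. norm (\<rho>R R z) \<le> norm (B * indicator (cball 0 R) z)"
      using B by (intro AE_I2) (auto simp: \<rho>R_def indicator_def intro: order_trans[OF _ abs_ge_self])
  qed simp
  have hatm [measurable]: "\<rho>_hat \<in> borel_measurable borel"
    and hat2: "integrable lborel (\<lambda>\<xi>. (cmod (\<rho>_hat \<xi>))\<^sup>2)"
    using hat by (auto simp: has_fourier_L2_def L2_def)
  have fm [measurable]: "fourier_L1 (\<rho>R R) \<in> borel_measurable borel" for R
    unfolding fourier_L1_def[abs_def] by measurable
  \<comment> \<open>Fubini moves the Fourier transform from the truncated kernel to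
    \<open>W\<close>, whose transform is a combination of shifted Gaussians. The truncation makes
    the kernel integrable, so that the double integral converges absolutely.\<close>
  have fourier: "of_real (T (\<rho>R R)) = s ^ DIM('a) * (LINT \<xi>|lborel. of_real (W \<xi>) * fourier_L1 (\<rho>R R) \<xi>)" for R
  proof -
    have "(LINT \<xi>|lborel. of_real (W \<xi>) * fourier_L1 (\<rho>R R) \<xi>) =
      (LINT \<xi>|lborel. (LINT z|lborel. of_real (W \<xi>) * (cis (- 2 * pi * (z \<bullet> \<xi>)) * of_real (\<rho>R R z))))"
      unfolding fourier_L1_def by simp
    also have "\<dots> = (LINT z|lborel. (LINT \<xi>|lborel. of_real (W \<xi>) * (cis (- 2 * pi * (z \<bullet> \<xi>)) * of_real (\<rho>R R z))))"
    proof (rule lborel_pair.Fubini_integral)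
      show "integrable (lborel \<Otimes>\<^sub>M lborel) (\<lambda>(z, \<xi>). of_real (W \<xi>) * (cis (- 2 * pi * (z \<bullet> \<xi>)) * complex_of_real (\<rho>R R z)))"
      proof (rule lborel_pair.Fubini_integrable)
        show "(\<lambda>(z, \<xi>). of_real (W \<xi>) * (cis (- 2 * pi * (z \<bullet> \<xi>)) * complex_of_real (\<rho>R R z))) \<in> borel_measurable (lborel \<Otimes>\<^sub>M lborel)"
          by measurable
        show "integrable lborel (\<lambda>z. LINT \<xi>|lborel. norm (case (z, \<xi>) of (z, \<xi>) \<Rightarrow> of_real (W \<xi>) * (cis (- 2 * pi * (z \<bullet> \<xi>)) * complex_of_real (\<rho>R R z))))"
          using \<rho>Ri[of R] W0 by (simp add: norm_mult)
        show "AE z in lborel. integrable lborel (\<lambda>\<xi>. case (z, \<xi>) of (z, \<xi>) \<Rightarrow> of_real (W \<xi>) * (cis (- 2 * pi * (z \<bullet> \<xi>)) * complex_of_real (\<rho>R R z)))"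
        proof (rule AE_I2)
          fix z :: 'a
          show "integrable lborel (\<lambda>\<xi>. case (z, \<xi>) of (z, \<xi>) \<Rightarrow> of_real (W \<xi>) * (cis (- 2 * pi * (z \<bullet> \<xi>)) * complex_of_real (\<rho>R R z)))"
            by (rule Bochner_Integration.integrable_bound[of _ "\<lambda>\<xi>. W \<xi> * \<rho>R R z"])
              (use Wi in \<open>auto simp: norm_mult abs_mult\<close>)
        qed
      qed
    qed
    also have "\<dots> = (LINT z|lborel. (\<Sum>i\<in>I. \<Sum>j\<in>I. of_real (c i * c j * (\<rho>R R z * gauss_hat ((x i - x j - z) /\<^sub>R s) / s ^ DIM('a)))))"
    proof (rule Bochner_Integration.integral_cong[OF refl])
      fix z :: 'a
      have "of_real (W \<xi>) * (cis (- 2 * pi * (z \<bullet> \<xi>)) * complex_of_real (\<rho>R R z)) =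
        (\<Sum>i\<in>I. \<Sum>j\<in>I. of_real (c i * c j * \<rho>R R z) * (cis (2 * pi * ((x i - x j - z) \<bullet> \<xi>)) * of_real (gauss (s *\<^sub>R \<xi>))))" for \<xi>
      proof -
        have "cis (2 * pi * ((x i - x j - z) \<bullet> \<xi>)) = cis (2 * pi * ((x i - x j) \<bullet> \<xi>)) * cis (- 2 * pi * (z \<bullet> \<xi>))" for i j
          by (simp add: cis_mult inner_diff_left right_diff_distrib)
        then show ?thesis
          unfolding W_def of_real_mult norm_double_sum_cis[symmetric]
          by (simp add: sum_distrib_right sum_distrib_left mult_ac)
      qed
      moreover have ii: "integrable lborel (\<lambda>\<xi>. cis (2 * pi * (y \<bullet> \<xi>)) * complex_of_real (gauss (s *\<^sub>R \<xi>)))" for y :: 'a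
        by (rule Bochner_Integration.integrable_bound[OF g]) (auto simp: norm_mult)
      ultimately have "(LINT \<xi>|lborel. of_real (W \<xi>) * (cis (- 2 * pi * (z \<bullet> \<xi>)) * complex_of_real (\<rho>R R z))) =
        (\<Sum>i\<in>I. \<Sum>j\<in>I. of_real (c i * c j * \<rho>R R z) * (LINT \<xi>|lborel. cis (2 * pi * ((x i - x j - z) \<bullet> \<xi>)) * of_real (gauss (s *\<^sub>R \<xi>))))"
        by (simp add: Bochner_Integration.integral_sum Bochner_Integration.integrable_sum)
      then show "(LINT \<xi>|lborel. of_real (W \<xi>) * (cis (- 2 * pi * (z \<bullet> \<xi>)) * complex_of_real (\<rho>R R z))) =
        (\<Sum>i\<in>I. \<Sum>j\<in>I. of_real (c i * c j * (\<rho>R R z * gauss_hat ((x i - x j - z) /\<^sub>R s) / s ^ DIM('a))))"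
        unfolding fourier_gauss_scale[OF s] by (simp add: mult.assoc)
    qed
    also have "\<dots> = of_real (LINT z|lborel. (\<Sum>i\<in>I. \<Sum>j\<in>I. c i * c j * (\<rho>R R z * gauss_hat ((x i - x j - z) /\<^sub>R s) / s ^ DIM('a))))"
      by (simp only: of_real_sum[symmetric] integral_complex_of_real)
    also have "(LINT z|lborel. (\<Sum>i\<in>I. \<Sum>j\<in>I. c i * c j * (\<rho>R R z * gauss_hat ((x i - x j - z) /\<^sub>R s) / s ^ DIM('a)))) =
      (\<Sum>i\<in>I. \<Sum>j\<in>I. c i * c j * ((LINT z|lborel. \<rho>R R z * gauss_hat ((x i - x j - z) /\<^sub>R s)) / s ^ DIM('a)))"
    proof -
      have "integrable lborel (\<lambda>z. \<rho>R R z * gauss_hat ((y - z) /\<^sub>R s))" for y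
      proof (rule Bochner_Integration.integrable_bound[of _ "\<lambda>z. \<rho>R R z * sqrt (2 * pi) ^ DIM('a)"])
        show "AE z in lborel. norm (\<rho>R R z * gauss_hat ((y - z) /\<^sub>R s)) \<le> norm (\<rho>R R z * sqrt (2 * pi) ^ DIM('a))"
        proof (rule AE_I2)
          fix z
          have "gauss_hat ((y - z) /\<^sub>R s) \<le> sqrt (2 * pi) ^ DIM('a)"
            unfolding gauss_hat_eq by (rule mult_left_le[OF gauss_le_1]) simp
          then show "norm (\<rho>R R z * gauss_hat ((y - z) /\<^sub>R s)) \<le> norm (\<rho>R R z * sqrt (2 * pi) ^ DIM('a))"
            using gauss_hat_pos[of "(y - z) /\<^sub>R s"] by (simp add: abs_mult mult_left_mono)
        qed
      qed (use \<rho>Ri[of R] in auto)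
      then show ?thesis by (simp add: Bochner_Integration.integral_sum Bochner_Integration.integrable_sum)
    qed
    also have "\<dots> = T (\<rho>R R) / s ^ DIM('a)"
      unfolding T_def by (simp add: sum_divide_distrib)
    finally show ?thesis using s by simp
  qed
  have Whi: "integrable lborel (\<lambda>\<xi>. of_real (W \<xi>) * \<rho>_hat \<xi>)"
  proof (rule Bochner_Integration.integrable_bound[of _ "\<lambda>\<xi>. (W \<xi>)\<^sup>2 + (cmod (\<rho>_hat \<xi>))\<^sup>2"])
    have "a * b \<le> a\<^sup>2 + b\<^sup>2" for a b :: real
      using sum_squares_bound[of a b] zero_le_power2[of a] zero_le_power2[of b] by linarith
    then show "AE \<xi> in lborel. norm (of_real (W \<xi>) * \<rho>_hat \<xi>) \<le> norm ((W \<xi>)\<^sup>2 + (cmod (\<rho>_hat \<xi>))\<^sup>2)"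
      using W0 by (simp add: norm_mult)
  qed (use W2i hat2 in auto)
  have Re0: "0 \<le> Re (LINT \<xi>|lborel. of_real (W \<xi>) * \<rho>_hat \<xi>)"
  proof -
    have "Re (LINT \<xi>|lborel. of_real (W \<xi>) * \<rho>_hat \<xi>) = (LINT \<xi>|lborel. Re (of_real (W \<xi>) * \<rho>_hat \<xi>))"
      by (rule integral_bounded_linear[OF bounded_linear_Re Whi, symmetric])
    also have "0 \<le> \<dots>"
      by (rule integral_nonneg_AE) (use pos W0 in \<open>auto elim!: eventually_mono simp: complex_nonneg_Reals_iff\<close>)
    finally show ?thesis .
  qed
  define N where "N R = (\<integral>\<^sup>+ \<xi>. ennreal ((cmod (fourier_L1 (\<rho>R R) \<xi> - \<rho>_hat \<xi>))\<^sup>2) \<partial>lborel)" for R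
  have N0: "(N \<longlongrightarrow> 0) at_top"
    using hat unfolding has_fourier_L2_def N_def[abs_def] \<rho>R_def[abs_def] by blast
  have fWi: "integrable lborel (\<lambda>\<xi>. of_real (W \<xi>) * fourier_L1 (\<rho>R R) \<xi>)" for R
  proof (rule Bochner_Integration.integrable_bound[of _ "\<lambda>\<xi>. W \<xi> * (LINT z|lborel. \<bar>\<rho>R R z\<bar>)"])
    have "cmod (fourier_L1 (\<rho>R R) \<xi>) \<le> (LINT z|lborel. \<bar>\<rho>R R z\<bar>)" for \<xi>
      unfolding fourier_L1_def by (rule order_trans[OF integral_norm_bound]) (simp add: norm_mult)
    then show "AE \<xi> in lborel. norm (of_real (W \<xi>) * fourier_L1 (\<rho>R R) \<xi>) \<le> norm (W \<xi> * (LINT z|lborel. \<bar>\<rho>R R z\<bar>))"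
      using W0 by (simp add: norm_mult mult_left_mono)
  qed (use Wi in auto)
  \<comment> \<open>Replacing the truncated transform by \<open>\<rho>_hat\<close> changes the
    integral by at most the root of A * N R, where A is the integral of W^2. The threshold for
    \<open>N R\<close> keeps this below e / s^DIM('a); the denominator is A + 1 because A may
    vanish.\<close>
  have lower: "- e \<le> T (\<rho>R R)" if e: "0 < e" and R: "N R < ennreal ((e / s ^ DIM('a))\<^sup>2 / ((LINT \<xi>|lborel. (W \<xi>)\<^sup>2) + 1))" for e R
  proof -
    define A where "A = (LINT \<xi>|lborel. (W \<xi>)\<^sup>2)"
    have A0: "0 \<le> A" unfolding A_def by simp
    let ?d = "\<lambda>\<xi>. fourier_L1 (\<rho>R R) \<xi> - \<rho>_hat \<xi>"
    have eq: "(LINT \<xi>|lborel. of_real (W \<xi>) * fourier_L1 (\<rho>R R) \<xi>) =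
      (LINT \<xi>|lborel. of_real (W \<xi>) * \<rho>_hat \<xi>) + (LINT \<xi>|lborel. of_real (W \<xi>) * ?d \<xi>)"
      using fWi Whi by (simp add: right_diff_distrib)
    have di: "integrable lborel (\<lambda>\<xi>. of_real (W \<xi>) * ?d \<xi>)"
      using fWi Whi by (simp add: right_diff_distrib)
    have "ennreal (cmod (LINT \<xi>|lborel. of_real (W \<xi>) * ?d \<xi>)) \<le> (\<integral>\<^sup>+ \<xi>. ennreal (W \<xi>) * ennreal (cmod (?d \<xi>)) \<partial>lborel)"
      using integral_norm_bound_ennreal[OF di] W0 by (simp add: norm_mult ennreal_mult)
    then have "(ennreal (cmod (LINT \<xi>|lborel. of_real (W \<xi>) * ?d \<xi>)))\<^sup>2 \<le> (\<integral>\<^sup>+ \<xi>. ennreal (W \<xi>) * ennreal (cmod (?d \<xi>)) \<partial>lborel)\<^sup>2"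
      by (rule power_mono) simp
    also have "\<dots> \<le> (\<integral>\<^sup>+ \<xi>. (ennreal (W \<xi>))\<^sup>2 \<partial>lborel) * (\<integral>\<^sup>+ \<xi>. (ennreal (cmod (?d \<xi>)))\<^sup>2 \<partial>lborel)"
      by (rule Cauchy_Schwarz_nn_integral) auto
    also have "\<dots> = ennreal A * N R"
      unfolding A_def N_def using W0 W2i by (simp add: ennreal_power nn_integral_eq_integral)
    also have "\<dots> \<le> ennreal A * ennreal ((e / s ^ DIM('a))\<^sup>2 / (A + 1))"
      using R by (intro mult_left_mono) (auto simp: A_def)
    also have "\<dots> = ennreal (A / (A + 1) * (e / s ^ DIM('a))\<^sup>2)"
      using A0 by (simp add: ennreal_mult[symmetric])
    also have "\<dots> \<le> ennreal ((e / s ^ DIM('a))\<^sup>2)"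
      using A0 by (intro ennreal_leI mult_left_le_one_le) auto
    finally have "(cmod (LINT \<xi>|lborel. of_real (W \<xi>) * ?d \<xi>))\<^sup>2 \<le> (e / s ^ DIM('a))\<^sup>2"
      by (simp add: ennreal_power)
    then have "cmod (LINT \<xi>|lborel. of_real (W \<xi>) * ?d \<xi>) \<le> e / s ^ DIM('a)"
      by (rule power2_le_imp_le) (use e s in simp)
    then have "- (e / s ^ DIM('a)) \<le> Re (LINT \<xi>|lborel. of_real (W \<xi>) * ?d \<xi>)"
      using abs_Re_le_cmod[of "LINT \<xi>|lborel. of_real (W \<xi>) * ?d \<xi>"] by linarith
    then have "- (e / s ^ DIM('a)) \<le> Re (LINT \<xi>|lborel. of_real (W \<xi>) * fourier_L1 (\<rho>R R) \<xi>)"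
      unfolding eq using Re0 by simp
    moreover have "T (\<rho>R R) = s ^ DIM('a) * Re (LINT \<xi>|lborel. of_real (W \<xi>) * fourier_L1 (\<rho>R R) \<xi>)"
      using arg_cong[OF fourier[of R], of Re] s by (simp flip: of_real_power)
    ultimately have "s ^ DIM('a) * - (e / s ^ DIM('a)) \<le> T (\<rho>R R)"
      using s by (simp only:) (intro mult_left_mono, auto)
    then show ?thesis using s by simp
  qed
  have gi: "integrable lborel (\<lambda>z::'a. gauss_hat ((y - z) /\<^sub>R s))" for y
    using lborel_affine_integral(1)[OF _ integrable_gauss_hat, of "- inverse s" "y /\<^sub>R s"] s
    by (simp add: scaleR_diff_right)
  have lim: "((\<lambda>R. T (\<rho>R R)) \<longlongrightarrow> T \<rho>) at_top"
    unfolding T_def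
  proof (intro tendsto_sum tendsto_mult_left)
    fix i j
    show "((\<lambda>R. LINT z|lborel. \<rho>R R z * gauss_hat ((x i - x j - z) /\<^sub>R s)) \<longlongrightarrow>
      (LINT z|lborel. \<rho> z * gauss_hat ((x i - x j - z) /\<^sub>R s))) at_top"
    proof (rule integral_dominated_convergence_at_top[where w = "\<lambda>z. B * gauss_hat ((x i - x j - z) /\<^sub>R s)"])
      show "integrable lborel (\<lambda>z. B * gauss_hat ((x i - x j - z) /\<^sub>R s))" using gi by simp
      show "\<forall>\<^sub>F R in at_top. AE z in lborel. norm (\<rho>R R z * gauss_hat ((x i - x j - z) /\<^sub>R s)) \<le> B * gauss_hat ((x i - x j - z) /\<^sub>R s)"
      proof (intro always_eventually allI AE_I2)
        fix R z
        have "\<bar>\<rho>R R z\<bar> \<le> B" using B[of z] by (auto simp: \<rho>R_def indicator_def)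
        then show "norm (\<rho>R R z * gauss_hat ((x i - x j - z) /\<^sub>R s)) \<le> B * gauss_hat ((x i - x j - z) /\<^sub>R s)"
          using less_imp_le[OF gauss_hat_pos[of "(x i - x j - z) /\<^sub>R s"]] by (simp add: abs_mult mult_right_mono)
      qed
      show "AE z in lborel. ((\<lambda>R. \<rho>R R z * gauss_hat ((x i - x j - z) /\<^sub>R s)) \<longlongrightarrow> \<rho> z * gauss_hat ((x i - x j - z) /\<^sub>R s)) at_top"
      proof (intro AE_I2 tendsto_eventually)
        fix z
        show "\<forall>\<^sub>F R in at_top. \<rho>R R z * gauss_hat ((x i - x j - z) /\<^sub>R s) = \<rho> z * gauss_hat ((x i - x j - z) /\<^sub>R s)"
          using eventually_ge_at_top[of "norm z"] by eventually_elim (simp add: \<rho>R_def)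
      qed
    qed auto
  qed
  have "- e \<le> T \<rho>" if e: "0 < e" for e
  proof (rule tendsto_lowerbound[OF lim])
    have "0 < ennreal ((e / s ^ DIM('a))\<^sup>2 / ((LINT \<xi>|lborel. (W \<xi>)\<^sup>2) + 1))"
    proof -
      have "0 \<le> (LINT \<xi>|lborel. (W \<xi>)\<^sup>2)" by simp
      then have "0 < (LINT \<xi>|lborel. (W \<xi>)\<^sup>2) + 1" by linarith
      then show ?thesis using e s by simp
    qed
    then show "\<forall>\<^sub>F R in at_top. - e \<le> T (\<rho>R R)"
      by (intro eventually_mono[OF order_tendstoD(2)[OF N0]] lower[OF e])
  qed simp
  from this[of "- T \<rho> / 2"] have "0 \<le> T \<rho>" by (cases "0 \<le> T \<rho>") auto
  then show ?thesis by (simp add: T_def)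
qed

text \<open>The width of the Gaussian tends to 0. By continuity of \<rho> and dominated convergence
  the regularised forms tend to the form of \<rho> times the total integral of
  \<open>gauss_hat\<close>, which is positive.\<close>

lemma positive_definite_of_fourier:
  fixes \<rho> :: "'a::euclidean_space \<Rightarrow> real" and x :: "'i \<Rightarrow> 'a" and c :: "'i \<Rightarrow> real"
  assumes cont: "continuous_on UNIV \<rho>" and B: "\<And>z. \<bar>\<rho> z\<bar> \<le> B"
    and hat: "has_fourier_L2 \<rho> \<rho>_hat" and pos: "AE \<xi> in lborel. \<rho>_hat \<xi> \<in> \<real>\<^sub>\<ge>\<^sub>0"
    and I: "finite I"
  shows "0 \<le> (\<Sum>i\<in>I. \<Sum>j\<in>I. c i * c j * \<rho> (x i - x j))"
proof -
  have [measurable]: "\<rho> \<in> borel_measurable borel" using cont by (rule borel_measurable_continuous_onI)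
  define s where "s n = inverse (real (Suc n))" for n
  have s: "0 < s n" for n by (simp add: s_def)
  define K where "K n = (\<Sum>i\<in>I. \<Sum>j\<in>I. c i * c j * (LINT u|lborel. \<rho> (x i - x j - s n *\<^sub>R u) * gauss_hat u))" for n
  have K0: "0 \<le> K n" for n
  proof -
    \<comment> \<open>The substitution z = y - s n * u leaves a fixed Gaussian in the integrand,
      which then dominates for all n. The Jacobian is positive and can be divided out.\<close>
    have "(LINT z|lborel. \<rho> z * gauss_hat ((y - z) /\<^sub>R s n)) = s n ^ DIM('a) * (LINT u|lborel. \<rho> (y - s n *\<^sub>R u) * gauss_hat u)" for y :: 'a
      using s[of n] by (subst lborel_affine_integral(2)[of "- s n" _ y]) auto
    then have "0 \<le> (\<Sum>i\<in>I. \<Sum>j\<in>I. c i * c j * (s n ^ DIM('a) * (LINT u|lborel. \<rho> (x i - x j - s n *\<^sub>R u) * gauss_hat u)))"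
      using regularised_form_nonneg[OF _ B hat pos I s[of n], of c x] by simp
    also have "\<dots> = s n ^ DIM('a) * K n"
      unfolding K_def by (simp add: sum_distrib_left mult_ac)
    finally show ?thesis
      using zero_less_power[OF s[of n]] by (metis mult_le_cancel_left_pos mult_zero_right)
  qed
  have "K \<longlonglongrightarrow> (\<Sum>i\<in>I. \<Sum>j\<in>I. c i * c j * (LINT u::'a|lborel. \<rho> (x i - x j) * gauss_hat u))"
    unfolding K_def
  proof (intro tendsto_sum tendsto_mult_left)
    fix i j
    show "(\<lambda>n. LINT u|lborel. \<rho> (x i - x j - s n *\<^sub>R u) * gauss_hat u) \<longlonglongrightarrow> (LINT u::'a|lborel. \<rho> (x i - x j) * gauss_hat u)"
    proof (rule integral_dominated_convergence[where w = "\<lambda>u::'a. B * gauss_hat u"])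
      show "integrable lborel (\<lambda>u::'a. B * gauss_hat u)"
        by (intro integrable_mult_right integrable_gauss_hat)
      show "AE u in lborel. norm (\<rho> (x i - x j - s n *\<^sub>R u) * gauss_hat u) \<le> B * gauss_hat u" for n
        using B by (simp add: abs_mult abs_of_pos[OF gauss_hat_pos] mult_right_mono less_imp_le[OF gauss_hat_pos])
      show "AE u in lborel. (\<lambda>n. \<rho> (x i - x j - s n *\<^sub>R u) * gauss_hat u) \<longlonglongrightarrow> \<rho> (x i - x j) * gauss_hat u"
      proof (intro AE_I2 tendsto_mult_right)
        fix u :: 'a
        have "(\<lambda>n. x i - x j - s n *\<^sub>R u) \<longlonglongrightarrow> x i - x j - 0 *\<^sub>R u"
          unfolding s_def by (intro tendsto_intros LIMSEQ_inverse_real_of_nat)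
        then show "(\<lambda>n. \<rho> (x i - x j - s n *\<^sub>R u)) \<longlonglongrightarrow> \<rho> (x i - x j)"
          using continuous_on_tendsto_compose[OF cont] by simp
      qed
    qed auto
  qed
  then have "0 \<le> (\<Sum>i\<in>I. \<Sum>j\<in>I. c i * c j * (LINT u::'a|lborel. \<rho> (x i - x j) * gauss_hat u))"
    by (rule LIMSEQ_le_const) (use K0 in auto)
  also have "\<dots> = (LINT u::'a|lborel. gauss_hat u) * (\<Sum>i\<in>I. \<Sum>j\<in>I. c i * c j * \<rho> (x i - x j))"
    by (simp add: sum_distrib_left mult_ac)
  finally have nn: "0 \<le> (LINT u::'a|lborel. gauss_hat u) * (\<Sum>i\<in>I. \<Sum>j\<in>I. c i * c j * \<rho> (x i - x j))" .
  have "0 < (LINT u::'a|lborel. gauss_hat u)"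
  proof -
    have "(LINT u::'a|lborel. gauss_hat u) \<noteq> 0"
    proof
      assume "(LINT u::'a|lborel. gauss_hat u) = 0"
      then have "AE u::'a in lborel. gauss_hat u = 0"
        using integral_nonneg_eq_0_iff_AE[OF integrable_gauss_hat[where 'a = 'a]]
        by (simp add: less_imp_le[OF gauss_hat_pos])
      then have "AE u::'a in lborel. False"
        by eventually_elim (use gauss_hat_pos in \<open>metis less_irrefl\<close>)
      then have "UNIV \<in> null_sets (lborel :: 'a measure)" using AE_iff_null_sets[of "UNIV :: 'a set" lborel] by simp
      then show False by (simp add: null_sets_def)
    qed
    moreover have "0 \<le> (LINT u::'a|lborel. gauss_hat u)"
      by (rule Bochner_Integration.integral_nonneg) (simp add: less_imp_le[OF gauss_hat_pos])
    ultimately show ?thesis by simp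
  qed
  then show ?thesis using nn by (simp add: zero_le_mult_iff)
qed

section \<open>Square-integrable functions whose self-convolution vanishes\<close>

text \<open>The common source of the Cauchy-Schwarz inequality in \<open>L2\<close>, of the almost
  orthogonality of \<open>\<psi> - q\<close> and of the bound of \<open>D\<close> by
  \<open>Q\<close>.\<close>

lemma quadratic_nonneg_imp_discriminant:
  fixes A B C :: real
  assumes "\<And>s. 0 \<le> A + 2 * s * B + s\<^sup>2 * C" and "0 \<le> C"
  shows "B\<^sup>2 \<le> A * C"
proof (cases "C = 0")
  case True
  have "B = 0"
  proof (rule ccontr)
    assume "B \<noteq> 0"
    \<comment> \<open>For \<open>C = 0\<close> the quadratic is affine in s, and this s gives it the
      value -1.\<close>
    then show False using assms(1)[of "- (A + 1) / (2 * B)"] True by (simp add: field_simps)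
  qed
  then show ?thesis using True by simp
next
  case False
  with \<open>0 \<le> C\<close> have "C > 0" by simp
  then show ?thesis using assms(1)[of "- B / C"]
    by (simp add: field_simps power2_eq_square)
qed

section \<open>The inner product of real square-integrable functions\<close>

definition ip :: "('a::euclidean_space \<Rightarrow> real) \<Rightarrow> ('a \<Rightarrow> real) \<Rightarrow> real" where
  "ip f g = (LINT x|lborel. f x * g x)"

lemma L2_real_iff:
  "(f :: 'a::euclidean_space \<Rightarrow> real) \<in> L2 \<longleftrightarrow> f \<in> borel_measurable borel \<and> integrable lborel (\<lambda>x. (f x)\<^sup>2)"
  by (simp add: L2_def)

lemma L2_measurable: "(f :: 'a::euclidean_space \<Rightarrow> real) \<in> L2 \<Longrightarrow> f \<in> borel_measurable borel"
  by (simp add: L2_real_iff)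

lemma L2_mult_integrable:
  fixes f g :: "'a::euclidean_space \<Rightarrow> real"
  assumes "f \<in> L2" "g \<in> L2"
  shows "integrable lborel (\<lambda>x. f x * g x)"
proof (rule Bochner_Integration.integrable_bound[of _ "\<lambda>x. (f x)\<^sup>2 + (g x)\<^sup>2"])
  show "integrable lborel (\<lambda>x. (f x)\<^sup>2 + (g x)\<^sup>2)" using assms by (simp add: L2_real_iff)
  have "\<bar>a * b\<bar> \<le> a\<^sup>2 + b\<^sup>2" for a b :: real
    using sum_squares_bound[of "\<bar>a\<bar>" "\<bar>b\<bar>"] zero_le_power2[of a] zero_le_power2[of b]
    unfolding abs_mult power2_abs by linarith
  then show "AE x in lborel. norm (f x * g x) \<le> norm ((f x)\<^sup>2 + (g x)\<^sup>2)"
    by (auto intro: order_trans[OF _ abs_ge_self])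
qed (use assms in \<open>auto simp: L2_real_iff\<close>)

lemma L2_scale: "f \<in> L2 \<Longrightarrow> (\<lambda>x::'a::euclidean_space. c * f x :: real) \<in> L2"
  by (auto simp: L2_real_iff power_mult_distrib)

lemma L2_add:
  fixes f g :: "'a::euclidean_space \<Rightarrow> real"
  assumes "f \<in> L2" "g \<in> L2"
  shows "(\<lambda>x. f x + g x) \<in> L2"
  using assms L2_mult_integrable[OF assms]
  by (auto simp: L2_real_iff power2_sum mult.assoc)

lemma L2_diff:
  fixes f g :: "'a::euclidean_space \<Rightarrow> real"
  assumes "f \<in> L2" "g \<in> L2"
  shows "(\<lambda>x. f x - g x) \<in> L2"
  using L2_add[OF assms(1) L2_scale[OF assms(2), of "-1"]] by simp

lemma L2_affine:
  fixes f :: "'a::euclidean_space \<Rightarrow> real"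
  assumes "f \<in> L2" "c \<noteq> 0"
  shows "(\<lambda>x. f (t + c *\<^sub>R x)) \<in> L2"
proof -
  have "(\<lambda>x. t + c *\<^sub>R x) \<in> borel_measurable borel" by measurable
  then have "(\<lambda>x. f (t + c *\<^sub>R x)) \<in> borel_measurable borel"
    by (rule measurable_compose) (rule L2_measurable[OF assms(1)])
  then show ?thesis
    using lborel_affine_integral(1)[OF assms(2), of "\<lambda>x. (f x)\<^sup>2" t] assms(1) by (simp add: L2_real_iff)
qed

lemma L2_translate: "(f :: 'a::euclidean_space \<Rightarrow> real) \<in> L2 \<Longrightarrow> (\<lambda>x. f (x - y)) \<in> L2"
  using L2_affine[of f 1 "- y"] by simp

lemma L2_reflect: "(f :: 'a::euclidean_space \<Rightarrow> real) \<in> L2 \<Longrightarrow> (\<lambda>x. f (y - x)) \<in> L2"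
  using L2_affine[of f "-1" y] by simp

lemma ip_commute: "ip f g = ip g f"
  by (simp add: ip_def mult.commute)

lemma ip_nonneg: "0 \<le> ip f f"
  by (simp add: ip_def)

lemma ip_diff_left: "f \<in> L2 \<Longrightarrow> g \<in> L2 \<Longrightarrow> h \<in> L2 \<Longrightarrow> ip (\<lambda>x. f x - g x) h = ip f h - ip g h"
  by (simp add: ip_def left_diff_distrib L2_mult_integrable)

lemma ip_add_left: "f \<in> L2 \<Longrightarrow> g \<in> L2 \<Longrightarrow> h \<in> L2 \<Longrightarrow> ip (\<lambda>x. f x + g x) h = ip f h + ip g h"
  by (simp add: ip_def distrib_right L2_mult_integrable)

lemma ip_scale_left: "ip (\<lambda>x. c * f x) h = c * ip f h"
  by (simp add: ip_def mult.assoc)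

lemma ip_affine:
  fixes f g :: "'a::euclidean_space \<Rightarrow> real"
  assumes "f \<in> borel_measurable borel" "g \<in> borel_measurable borel" "\<bar>c\<bar> = 1"
  shows "ip (\<lambda>x. f (t + c *\<^sub>R x)) (\<lambda>x. g (t + c *\<^sub>R x)) = ip f g"
  unfolding ip_def using assms by (subst (2) lborel_affine_integral(2)[of c _ t]) auto

lemma ip_translate:
  fixes f g :: "'a::euclidean_space \<Rightarrow> real"
  assumes "f \<in> L2" "g \<in> L2"
  shows "ip (\<lambda>x. f (x - y)) (\<lambda>x. g (x - y)) = ip f g"
  using ip_affine[of f g 1 "- y"] assms by (simp add: L2_real_iff)

lemma ip_reflect:
  fixes f g :: "'a::euclidean_space \<Rightarrow> real"
  assumes "f \<in> L2" "g \<in> L2"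
  shows "ip (\<lambda>x. f (y - x)) (\<lambda>x. g (y - x)) = ip f g"
  using ip_affine[of f g "-1" y] assms by (simp add: L2_real_iff)

lemma ip_add_scale:
  fixes f g :: "'a::euclidean_space \<Rightarrow> real"
  assumes f: "f \<in> L2" and g: "g \<in> L2"
  shows "ip (\<lambda>x. f x + s * g x) (\<lambda>x. f x + s * g x) = ip f f + 2 * s * ip f g + s\<^sup>2 * ip g g"
proof -
  have "ip (\<lambda>x. f x + s * g x) (\<lambda>x. f x + s * g x) = ip f (\<lambda>x. f x + s * g x) + s * ip g (\<lambda>x. f x + s * g x)"
    using f g by (simp add: ip_add_left L2_add L2_scale ip_scale_left)
  moreover have "ip h (\<lambda>x. f x + s * g x) = ip h f + s * ip h g" if "h \<in> L2" for h
    using f g that by (simp add: ip_commute[of h] ip_add_left L2_scale ip_scale_left)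
  ultimately show ?thesis using f g ip_commute[of g f] by (simp add: power2_eq_square algebra_simps)
qed

lemma ip_Cauchy_Schwarz:
  fixes f g :: "'a::euclidean_space \<Rightarrow> real"
  assumes "f \<in> L2" "g \<in> L2"
  shows "(ip f g)\<^sup>2 \<le> ip f f * ip g g"
proof (rule quadratic_nonneg_imp_discriminant)
  show "0 \<le> ip f f + 2 * s * ip f g + s\<^sup>2 * ip g g" for s
    unfolding ip_add_scale[OF assms, symmetric] by (rule ip_nonneg)
qed (rule ip_nonneg)

lemma ip_Cauchy_Schwarz_sqrt:
  fixes f g :: "'a::euclidean_space \<Rightarrow> real"
  assumes "f \<in> L2" "g \<in> L2"
  shows "\<bar>ip f g\<bar> \<le> sqrt (ip f f) * sqrt (ip g g)"
  using real_sqrt_le_mono[OF ip_Cauchy_Schwarz[OF assms]] by (simp add: real_sqrt_mult)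

section \<open>The span of the translates of a function\<close>

inductive_set trans_span :: "('a::euclidean_space \<Rightarrow> real) \<Rightarrow> ('a \<Rightarrow> real) set"
  for a :: "'a \<Rightarrow> real" where
  translate: "(\<lambda>x. a (x - y)) \<in> trans_span a"
| add: "f \<in> trans_span a \<Longrightarrow> g \<in> trans_span a \<Longrightarrow> (\<lambda>x. f x + g x) \<in> trans_span a"
| scale: "f \<in> trans_span a \<Longrightarrow> (\<lambda>x. c * f x) \<in> trans_span a"

lemma trans_span_L2: "f \<in> trans_span a \<Longrightarrow> a \<in> L2 \<Longrightarrow> f \<in> L2"
  by (induction rule: trans_span.induct) (simp_all add: L2_translate L2_add L2_scale)

lemma trans_span_translate: "f \<in> trans_span a \<Longrightarrow> (\<lambda>x. f (x - y)) \<in> trans_span a"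
proof (induction rule: trans_span.induct)
  case (translate z)
  have "(\<lambda>x. a (x - y - z)) = (\<lambda>x. a (x - (y + z)))" by (simp add: algebra_simps)
  then show ?case by (simp add: trans_span.translate)
qed (auto intro: trans_span.intros)

text \<open>A vanishing convolution is preserved by translating one factor and is linear in that
  factor.\<close>

lemma trans_span_conv_zero:
  assumes "q \<in> trans_span a" "a \<in> L2" and z: "\<And>x. (LINT t|lborel. a (x - t) * a t) = 0"
  shows "(LINT t|lborel. q (x - t) * a t) = 0"
  using assms(1)
proof (induction arbitrary: x rule: trans_span.induct)
  case (translate y)
  show ?case using z[of "x - y"] by (simp add: algebra_simps)
next
  case (add f g)
  have "integrable lborel (\<lambda>t. h (x - t) * a t)" if "h \<in> trans_span a" for h
    by (rule L2_mult_integrable[OF L2_reflect[OF trans_span_L2[OF that assms(2)]] assms(2)])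
  then show ?case using add by (simp add: distrib_right)
next
  case (scale f c)
  then show ?case by (simp add: mult.assoc)
qed

text \<open>The integral over x of the product of a translate of f with g is bounded by
  Cauchy-Schwarz independently of the translation t, so integrability of \<psi> suffices for the
  double integral.\<close>

lemma convolution_Fubini:
  fixes \<psi> f g :: "'a::euclidean_space \<Rightarrow> real"
  assumes \<psi>: "integrable lborel \<psi>" and f: "f \<in> L2" and g: "g \<in> L2"
  shows "integrable lborel (\<lambda>x. (LINT t|lborel. \<psi> t * f (x - t)) * g x)"
    and "(LINT x|lborel. (LINT t|lborel. \<psi> t * f (x - t)) * g x) = (LINT t|lborel. \<psi> t * ip (\<lambda>x. f (x - t)) g)"
proof -
  have [measurable]: "\<psi> \<in> borel_measurable borel" "f \<in> borel_measurable borel" "g \<in> borel_measurable borel"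
    using \<psi> f g by (auto simp: L2_real_iff dest: borel_measurable_integrable)
  have i: "integrable (lborel \<Otimes>\<^sub>M lborel) (\<lambda>(t, x). \<psi> t * f (x - t) * g x)"
  proof (rule lborel_pair.Fubini_integrable)
    show "(\<lambda>(t, x). \<psi> t * f (x - t) * g x) \<in> borel_measurable (lborel \<Otimes>\<^sub>M lborel)" by measurable
    have af: "(\<lambda>x. \<bar>f x\<bar>) \<in> L2" and ag: "(\<lambda>x. \<bar>g x\<bar>) \<in> L2" using f g by (auto simp: L2_real_iff)
    have bd: "(LINT x|lborel. \<bar>f (x - t)\<bar> * \<bar>g x\<bar>) \<le> sqrt (ip (\<lambda>x. \<bar>f x\<bar>) (\<lambda>x. \<bar>f x\<bar>)) * sqrt (ip (\<lambda>x. \<bar>g x\<bar>) (\<lambda>x. \<bar>g x\<bar>))" for t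
      using ip_Cauchy_Schwarz_sqrt[OF L2_translate[OF af, of t] ag] ip_translate[OF af af, of t]
      by (simp add: ip_def)
    let ?C = "sqrt (ip (\<lambda>x. \<bar>f x\<bar>) (\<lambda>x. \<bar>f x\<bar>)) * sqrt (ip (\<lambda>x. \<bar>g x\<bar>) (\<lambda>x. \<bar>g x\<bar>))"
    have eq: "(LINT x|lborel. norm (case (t, x) of (t, x) \<Rightarrow> \<psi> t * f (x - t) * g x)) =
      \<bar>\<psi> t\<bar> * (LINT x|lborel. \<bar>f (x - t)\<bar> * \<bar>g x\<bar>)" for t
      by (simp add: abs_mult mult.assoc)
    show "integrable lborel (\<lambda>t. LINT x|lborel. norm (case (t, x) of (t, x) \<Rightarrow> \<psi> t * f (x - t) * g x))"
      unfolding eq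
    proof (rule Bochner_Integration.integrable_bound[of _ "\<lambda>t. \<psi> t * ?C"])
      show "integrable lborel (\<lambda>t. \<psi> t * ?C)" using \<psi> by simp
      show "AE t in lborel. norm (\<bar>\<psi> t\<bar> * (LINT x|lborel. \<bar>f (x - t)\<bar> * \<bar>g x\<bar>)) \<le> norm (\<psi> t * ?C)"
      proof (rule AE_I2)
        fix t
        have "0 \<le> (LINT x|lborel. \<bar>f (x - t)\<bar> * \<bar>g x\<bar>)" by (rule Bochner_Integration.integral_nonneg) simp
        then show "norm (\<bar>\<psi> t\<bar> * (LINT x|lborel. \<bar>f (x - t)\<bar> * \<bar>g x\<bar>)) \<le> norm (\<psi> t * ?C)"
          using bd[of t] by (simp add: abs_mult mult_left_mono ip_nonneg)
      qed
    qed measurable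
    show "AE t in lborel. integrable lborel (\<lambda>x. case (t, x) of (t, x) \<Rightarrow> \<psi> t * f (x - t) * g x)"
      using L2_mult_integrable[OF L2_translate[OF f] g] by (simp add: mult.assoc)
  qed
  have "integrable lborel (\<lambda>x. LINT t|lborel. (\<psi> t * f (x - t) * g x))"
    using lborel_pair.integrable_snd[OF i] by simp
  moreover have eq: "(LINT t|lborel. \<psi> t * f (x - t) * g x) = (LINT t|lborel. \<psi> t * f (x - t)) * g x" for x
    by simp
  ultimately show "integrable lborel (\<lambda>x. (LINT t|lborel. \<psi> t * f (x - t)) * g x)" by (simp only:)
  have "(LINT x|lborel. (LINT t|lborel. \<psi> t * f (x - t) * g x)) = (LINT t|lborel. (LINT x|lborel. \<psi> t * f (x - t) * g x))"
    by (rule lborel_pair.Fubini_integral[OF i])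
  moreover have "(LINT x|lborel. \<psi> t * f (x - t) * g x) = \<psi> t * ip (\<lambda>x. f (x - t)) g" for t
    by (simp add: ip_def mult.assoc)
  ultimately show "(LINT x|lborel. (LINT t|lborel. \<psi> t * f (x - t)) * g x) = (LINT t|lborel. \<psi> t * ip (\<lambda>x. f (x - t)) g)"
    by (simp only: eq)
qed

text \<open>Young's inequality for an integrable and a square-integrable factor, in dual form: the
  convolution is only ever paired with a function of \<open>L2\<close>.\<close>

lemma integral_mult_ip_bound:
  fixes \<psi> f g :: "'a::euclidean_space \<Rightarrow> real"
  assumes \<psi>: "integrable lborel \<psi>" and f: "f \<in> L2" and g: "g \<in> L2"
  shows "\<bar>LINT x|lborel. (LINT t|lborel. \<psi> t * f (x - t)) * g x\<bar> \<le> (LINT t|lborel. \<bar>\<psi> t\<bar>) * (sqrt (ip f f) * sqrt (ip g g))"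
proof -
  have [measurable]: "\<psi> \<in> borel_measurable borel" "f \<in> borel_measurable borel" "g \<in> borel_measurable borel"
    using \<psi> f g by (auto simp: L2_real_iff dest: borel_measurable_integrable)
  have b: "\<bar>ip (\<lambda>x. f (x - t)) g\<bar> \<le> sqrt (ip f f) * sqrt (ip g g)" for t
    using ip_Cauchy_Schwarz_sqrt[OF L2_translate[OF f, of t] g] ip_translate[OF f f, of t] by simp
  have "\<bar>LINT t|lborel. \<psi> t * ip (\<lambda>x. f (x - t)) g\<bar> \<le> (LINT t|lborel. \<bar>\<psi> t\<bar> * (sqrt (ip f f) * sqrt (ip g g)))"
  proof (rule integral_abs_bound_integral)
    show "integrable lborel (\<lambda>t. \<bar>\<psi> t\<bar> * (sqrt (ip f f) * sqrt (ip g g)))" using \<psi> by simp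
    show "integrable lborel (\<lambda>t. \<psi> t * ip (\<lambda>x. f (x - t)) g)"
    proof (rule Bochner_Integration.integrable_bound[of _ "\<lambda>t. \<psi> t * (sqrt (ip f f) * sqrt (ip g g))"])
      show "AE t in lborel. norm (\<psi> t * ip (\<lambda>x. f (x - t)) g) \<le> norm (\<psi> t * (sqrt (ip f f) * sqrt (ip g g)))"
        using b by (auto simp: abs_mult ip_nonneg intro!: mult_left_mono)
      show "(\<lambda>t. \<psi> t * ip (\<lambda>x. f (x - t)) g) \<in> borel_measurable lborel" unfolding ip_def by measurable
    qed (use \<psi> in simp)
    show "\<And>t. t \<in> space lborel \<Longrightarrow> \<bar>\<psi> t * ip (\<lambda>x. f (x - t)) g\<bar> \<le> \<bar>\<psi> t\<bar> * (sqrt (ip f f) * sqrt (ip g g))"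
      using b by (auto simp: abs_mult intro!: mult_left_mono)
  qed
  then show ?thesis by (simp add: convolution_Fubini(2)[OF \<psi> f g])
qed

text \<open>
  For an even bump \<open>\<psi>\<close>, let \<open>q\<close> almost minimise the distance of \<open>\<psi>\<close>
  to the span of the translates of \<open>a\<close>. Then \<open>\<psi> - q\<close> is almost orthogonal to the
  translates of \<open>q\<close>, and the autocorrelation of \<open>q\<close> is even, so the odd part of
  \<open>\<psi> * q\<close> is small. As \<open>q * a = 0\<close>, convolving this odd part with \<open>a\<close> shows
  that the correlation of \<open>\<psi> * \<psi>\<close> with \<open>a\<close> vanishes.
\<close>

lemma almost_minimiser:
  fixes a \<psi> :: "'a::euclidean_space \<Rightarrow> real"
  assumes a: "a \<in> L2" and \<psi>: "\<psi> \<in> L2" and \<delta>: "0 < \<delta>" "\<delta> \<le> 1"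
  obtains q where "q \<in> trans_span a" "ip q q \<le> 4 * ip \<psi> \<psi> + 4"
    "\<forall>h\<in>trans_span a. (ip (\<lambda>x. \<psi> x - q x) h)\<^sup>2 \<le> \<delta> * ip h h"
proof -
  let ?N = "\<lambda>q. ip (\<lambda>x. \<psi> x - q x) (\<lambda>x. \<psi> x - q x)"
  define d where "d = (INF q\<in>trans_span a. ?N q)"
  have bdd: "bdd_below (?N ` trans_span a)" by (rule bdd_belowI[of _ 0]) (auto simp: ip_nonneg)
  have ne: "trans_span a \<noteq> {}" using trans_span.translate by blast
  have d_le: "d \<le> ?N q" if "q \<in> trans_span a" for q
    unfolding d_def by (rule cINF_lower[OF bdd that])
  \<comment> \<open>The zero function, as an element of the span; it bounds the infimum by
    \<open>ip \<psi> \<psi>\<close>.\<close>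
  have "(\<lambda>x. 0 * a (x - 0)) \<in> trans_span a" by (intro trans_span.intros)
  then have d\<psi>: "d \<le> ip \<psi> \<psi>" using d_le by fastforce
  obtain q where q: "q \<in> trans_span a" "?N q < d + \<delta>"
    using cINF_less_iff[OF ne bdd, of "d + \<delta>"] \<delta> unfolding d_def by auto
  have qL: "q \<in> L2" by (rule trans_span_L2[OF q(1) a])
  have eL: "(\<lambda>x. \<psi> x - q x) \<in> L2" by (rule L2_diff[OF \<psi> qL])
  show thesis
  proof (rule that[OF q(1)], goal_cases)
    case 1
    have e1: "?N q = ip \<psi> \<psi> - 2 * ip \<psi> q + ip q q"
      using ip_add_scale[OF \<psi> qL, of "-1"] by simp
    \<comment> \<open>The square of q - 2 \<psi>. Almost minimality gives ip q q - 2 * ip \<psi> q <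
      \<delta>; subtracting this square from its double eliminates the mixed term.\<close>
    have e2: "0 \<le> ip q q - 4 * ip \<psi> q + 4 * ip \<psi> \<psi>"
      using ip_add_scale[OF qL \<psi>, of "-2"] ip_nonneg[of "\<lambda>x. q x + - 2 * \<psi> x"] ip_commute[of q \<psi>] by simp
    show ?case
      using e1 e2 q(2) \<delta> d\<psi> by linarith
  next
    case 2
    show ?case
    proof
    fix h assume h: "h \<in> trans_span a"
    have hL: "h \<in> L2" by (rule trans_span_L2[OF h a])
    show "(ip (\<lambda>x. \<psi> x - q x) h)\<^sup>2 \<le> \<delta> * ip h h"
    proof (rule quadratic_nonneg_imp_discriminant)
      fix s
      \<comment> \<open>Moving q by -s * h within the span lowers the squared distance to \<psi> by
        at most \<delta>, for every s; the discriminant of this quadratic in s is the claim.\<close>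
      have "(\<lambda>x. q x + (- s) * h x) \<in> trans_span a" by (intro trans_span.intros q(1) h)
      from d_le[OF this] have "d \<le> ip (\<lambda>x. (\<psi> x - q x) + s * h x) (\<lambda>x. (\<psi> x - q x) + s * h x)"
        by (simp add: algebra_simps)
      then show "0 \<le> \<delta> + 2 * s * ip (\<lambda>x. \<psi> x - q x) h + s\<^sup>2 * ip h h"
        using q(2) unfolding ip_add_scale[OF eL hL] by linarith
    qed (rule ip_nonneg)
    qed
  qed
qed

text \<open>The odd part of \<psi> * q is small uniformly, while in the \<open>L2\<close> sense it
  is merely bounded. Its integral against the reflection b of a is therefore split: on a ball b is
  integrable and uniform smallness suffices, outside the ball b has small \<open>L2\<close> norm.
  The radius is fixed first and \<delta> is chosen afterwards.\<close>

lemma selfconv_zero_correlation: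
  fixes a \<psi> :: "'a::euclidean_space \<Rightarrow> real"
  assumes a: "a \<in> L2" and z0: "\<And>x. (LINT t|lborel. a (x - t) * a t) = 0"
    and \<psi>L: "\<psi> \<in> L2" and \<psi>: "integrable lborel \<psi>" and even: "\<And>x. \<psi> (- x) = \<psi> x"
  shows "(LINT t|lborel. \<psi> t * ip \<psi> (\<lambda>u. a (u + z - t))) = 0"
proof -
  have am: "a \<in> borel_measurable borel" and \<psi>m: "\<psi> \<in> borel_measurable borel"
    using a \<psi>L by (auto simp: L2_real_iff)
  note [measurable] = am \<psi>m
  let ?P = "LINT t|lborel. \<psi> t * ip \<psi> (\<lambda>u. a (u + z - t))"
  define b where "b x = a (z - x)" for x
  have b: "b \<in> L2" unfolding b_def[abs_def] by (rule L2_reflect[OF a])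
  define A where "A = sqrt (ip a a)"
  define I where "I = (LINT t|lborel. \<bar>\<psi> t\<bar>)"
  define C where "C = 4 * ip \<psi> \<psi> + 4"
  have C0: "0 \<le> C" unfolding C_def by (simp add: ip_nonneg)
  have I0: "0 \<le> I" unfolding I_def by simp
  define tail where "tail R x = indicator (- cball 0 R) x * b x" for R :: real and x
  have tail: "tail R \<in> L2" for R
  proof -
    have "integrable lborel (\<lambda>x. indicator (- cball 0 R) x *\<^sub>R (b x)\<^sup>2)"
      using b by (intro integrable_mult_indicator) (auto simp: L2_real_iff)
    moreover have "(tail R x)\<^sup>2 = indicator (- cball 0 R) x *\<^sub>R (b x)\<^sup>2" for x
      by (auto simp: tail_def indicator_def)
    moreover have "tail R \<in> borel_measurable borel"
      unfolding tail_def[abs_def] by (intro borel_measurable_times borel_measurable_indicator L2_measurable[OF b]) auto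
    ultimately show ?thesis by (simp add: L2_real_iff)
  qed
  have tail0: "((\<lambda>R. ip (tail R) (tail R)) \<longlongrightarrow> 0) at_top"
  proof -
    have "((\<lambda>R. ip (tail R) (tail R)) \<longlongrightarrow> (LINT x::'a|lborel. 0)) at_top"
      unfolding ip_def
    proof (rule integral_dominated_convergence_at_top[where w = "\<lambda>x. (b x)\<^sup>2"])
      show "integrable lborel (\<lambda>x. (b x)\<^sup>2)" using b by (simp add: L2_real_iff)
      show "\<forall>\<^sub>F R in at_top. AE x in lborel. norm (tail R x * tail R x) \<le> (b x)\<^sup>2"
        by (intro always_eventually allI AE_I2) (auto simp: tail_def indicator_def power2_eq_square)
      show "AE x in lborel. ((\<lambda>R. tail R x * tail R x) \<longlongrightarrow> 0) at_top"
      proof (intro AE_I2 tendsto_eventually)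
        fix x :: 'a
        show "\<forall>\<^sub>F R in at_top. tail R x * tail R x = 0"
          using eventually_ge_at_top[of "norm x"] by eventually_elim (simp add: tail_def)
      qed
      show "(\<lambda>x. tail R x * tail R x) \<in> borel_measurable lborel" for R
        using L2_measurable[OF tail] by simp
    qed simp
    then show ?thesis by simp
  qed
  define core where "core R = (LINT x|lborel. \<bar>indicator (cball 0 R) x * b x\<bar>)" for R :: real
  have core_i: "integrable lborel (\<lambda>x. indicator (cball 0 R) x * b x)" for R
  proof -
    have "(\<lambda>x::'a. indicator (cball 0 R) x :: real) \<in> L2"
    proof -
      have sq: "(indicator (cball 0 R) x :: real)\<^sup>2 = indicator (cball 0 R) x" for x :: 'a
        by (simp add: indicator_def)
      have "integrable lborel (indicator (cball 0 R) :: 'a \<Rightarrow> real)"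
        using emeasure_bounded_finite[of "cball (0 :: 'a) R"] by (intro integrable_real_indicator) auto
      moreover have "(indicator (cball 0 R) :: 'a \<Rightarrow> real) \<in> borel_measurable borel"
        by (rule borel_measurable_indicator) simp
      ultimately show ?thesis unfolding L2_real_iff sq by simp
    qed
    then show ?thesis using b by (rule L2_mult_integrable)
  qed
  \<comment> \<open>The three terms are the cost of replacing the inner \<psi> by q, the difference
    \<open>U - V\<close> on the ball, and \<open>U\<close> and \<open>V\<close> against the
    tail.\<close>
  have key: "\<bar>?P\<bar> \<le> sqrt \<delta> * A * I + 2 * sqrt (\<delta> * C) * core R + 2 * I * (sqrt C * sqrt (ip (tail R) (tail R)))"
    if \<delta>: "0 < \<delta>" "\<delta> \<le> 1" for \<delta> R
  proof -
    obtain q where q: "q \<in> trans_span a" and qC: "ip q q \<le> C"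
      and "\<forall>h\<in>trans_span a. (ip (\<lambda>x. \<psi> x - q x) h)\<^sup>2 \<le> \<delta> * ip h h"
      unfolding C_def by (rule almost_minimiser[OF a \<psi>L \<delta>])
    then have orth: "\<And>h. h \<in> trans_span a \<Longrightarrow> (ip (\<lambda>x. \<psi> x - q x) h)\<^sup>2 \<le> \<delta> * ip h h" by blast
    have qL: "q \<in> L2" by (rule trans_span_L2[OF q a])
    have [measurable]: "q \<in> borel_measurable borel" by (rule L2_measurable[OF qL])
    have rqL: "(\<lambda>x. q (- x)) \<in> L2" using L2_reflect[OF qL, of 0] by simp
    have ip_rq: "ip (\<lambda>x. q (- x)) (\<lambda>x. q (- x)) = ip q q" using ip_reflect[OF qL qL, of 0] by simp
    \<comment> \<open>\<open>V\<close> is the convolution of \<psi> and q, and \<open>U\<close> is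
      its reflection \<open>U x = V (- x)\<close>, because \<psi> is even.\<close>
    define U where "U x = (LINT t|lborel. \<psi> t * q (- (x - t)))" for x
    define V where "V x = (LINT t|lborel. \<psi> t * q (x - t))" for x
    have U_eq: "U x = ip \<psi> (\<lambda>t. q (t - x))" for x unfolding U_def ip_def by simp
    have V_eq: "V x = ip \<psi> (\<lambda>t. q (t - (- x)))" for x
      using ip_reflect[of \<psi> "\<lambda>t. q (t - (- x))" 0] \<psi>L L2_translate[OF qL, of "- x"]
      unfolding V_def ip_def by (simp add: even)
    have UV: "\<bar>U x - V x\<bar> \<le> 2 * sqrt (\<delta> * C)" for x
    proof -
      have e: "\<bar>ip \<psi> (\<lambda>t. q (t - y)) - ip q (\<lambda>t. q (t - y))\<bar> \<le> sqrt (\<delta> * C)" for y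
      proof -
        have "(ip \<psi> (\<lambda>t. q (t - y)) - ip q (\<lambda>t. q (t - y)))\<^sup>2 \<le> \<delta> * ip q q"
          using orth[OF trans_span_translate[OF q, of y]] ip_translate[OF qL qL, of y]
            ip_diff_left[OF \<psi>L qL L2_translate[OF qL, of y]] by simp
        also have "\<dots> \<le> \<delta> * C" using qC \<delta> by (intro mult_left_mono) auto
        finally show ?thesis using real_le_rsqrt by (metis power2_abs)
      qed
      have "ip q (\<lambda>t. q (t - x)) = ip q (\<lambda>t. q (t - (- x)))"
        using ip_translate[OF qL L2_translate[OF qL, of x], of "- x"] ip_commute[of q "\<lambda>t. q (t - (- x))"] by simp
      then show ?thesis unfolding U_eq V_eq using e[of x] e[of "- x"] by linarith
    qed
    have Ug: "integrable lborel (\<lambda>x. U x * g x)" and Ub: "\<bar>LINT x|lborel. U x * g x\<bar> \<le> I * (sqrt C * sqrt (ip g g))"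
      if "g \<in> L2" for g
    proof -
      show "integrable lborel (\<lambda>x. U x * g x)"
        unfolding U_def using convolution_Fubini(1)[OF \<psi> rqL that] by simp
      have "\<bar>LINT x|lborel. U x * g x\<bar> \<le> I * (sqrt (ip q q) * sqrt (ip g g))"
        unfolding U_def I_def using integral_mult_ip_bound[OF \<psi> rqL that] ip_rq by simp
      also have "\<dots> \<le> I * (sqrt C * sqrt (ip g g))"
        using qC I0 by (intro mult_left_mono mult_right_mono) (auto simp: ip_nonneg)
      finally show "\<bar>LINT x|lborel. U x * g x\<bar> \<le> I * (sqrt C * sqrt (ip g g))" .
    qed
    have Vg: "integrable lborel (\<lambda>x. V x * g x)" and Vb: "\<bar>LINT x|lborel. V x * g x\<bar> \<le> I * (sqrt C * sqrt (ip g g))"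
      if "g \<in> L2" for g
    proof -
      show "integrable lborel (\<lambda>x. V x * g x)"
        unfolding V_def using convolution_Fubini(1)[OF \<psi> qL that] by simp
      have "\<bar>LINT x|lborel. V x * g x\<bar> \<le> I * (sqrt (ip q q) * sqrt (ip g g))"
        unfolding V_def I_def using integral_mult_ip_bound[OF \<psi> qL that] by simp
      also have "\<dots> \<le> I * (sqrt C * sqrt (ip g g))"
        using qC I0 by (intro mult_left_mono mult_right_mono) (auto simp: ip_nonneg)
      finally show "\<bar>LINT x|lborel. V x * g x\<bar> \<le> I * (sqrt C * sqrt (ip g g))" .
    qed
    \<comment> \<open>Reflection by x to z - x turns the pairing of a translate of q with b into a
      value of the convolution of q and a, which vanishes.\<close>
    have V0: "(LINT x|lborel. V x * b x) = 0"
    proof -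
      have "ip (\<lambda>x. q (x - t)) b = 0" for t
      proof -
        have "ip (\<lambda>x. q (x - t)) b = ip (\<lambda>x. q (z - t - x)) a"
          using ip_reflect[of "\<lambda>x. q (x - t)" b z] L2_translate[OF qL, of t] b
          by (simp add: b_def algebra_simps)
        then show ?thesis using trans_span_conv_zero[OF q a z0, of "z - t"] by (simp add: ip_def)
      qed
      then show ?thesis unfolding V_def using convolution_Fubini(2)[OF \<psi> qL b] by simp
    qed
    \<comment> \<open>For \<open>U\<close> a reflection gives \<open>?P\<close> with q in place of
      the inner \<psi>; \<open>PU\<close> below compares the two.\<close>
    have Uq: "(LINT x|lborel. U x * b x) = (LINT t|lborel. \<psi> t * ip q (\<lambda>u. a (u + z - t)))"
    proof -
      have "ip (\<lambda>x. q (- (x - t))) b = ip q (\<lambda>u. a (u + z - t))" for t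
        using ip_reflect[of q "\<lambda>u. a (u + z - t)" t] qL L2_translate[OF a, of "t - z"]
        by (simp add: b_def[abs_def] algebra_simps)
      then show ?thesis unfolding U_def using convolution_Fubini(2)[OF \<psi> rqL b] by simp
    qed
    have shift: "(\<lambda>u. a (u + z - t)) \<in> trans_span a" "(\<lambda>u. a (u + z - t)) \<in> L2" for t
      using trans_span.translate[of a "t - z"] L2_translate[OF a, of "t - z"] by (simp_all add: algebra_simps)
    have ip_shift: "ip (\<lambda>u. a (u + z - t)) (\<lambda>u. a (u + z - t)) = ip a a" for t
      using ip_translate[OF a a, of "t - z"] by (simp add: algebra_simps)
    have mi: "integrable lborel (\<lambda>t. \<psi> t * ip f (\<lambda>u. a (u + z - t)))" if f: "f \<in> L2" for f
    proof (rule Bochner_Integration.integrable_bound[of _ "\<lambda>t. \<psi> t * (sqrt (ip f f) * A)"])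
      have [measurable]: "f \<in> borel_measurable borel" by (rule L2_measurable[OF f])
      show "(\<lambda>t. \<psi> t * ip f (\<lambda>u. a (u + z - t))) \<in> borel_measurable lborel" unfolding ip_def by measurable
      show "AE t in lborel. norm (\<psi> t * ip f (\<lambda>u. a (u + z - t))) \<le> norm (\<psi> t * (sqrt (ip f f) * A))"
      proof (rule AE_I2)
        fix t
        have "\<bar>ip f (\<lambda>u. a (u + z - t))\<bar> \<le> sqrt (ip f f) * A"
          using ip_Cauchy_Schwarz_sqrt[OF f shift(2), of t] unfolding ip_shift A_def .
        also have "\<dots> \<le> \<bar>sqrt (ip f f) * A\<bar>" by (rule abs_ge_self)
        finally show "norm (\<psi> t * ip f (\<lambda>u. a (u + z - t))) \<le> norm (\<psi> t * (sqrt (ip f f) * A))"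
          unfolding real_norm_def abs_mult[of "\<psi> t"] by (rule mult_left_mono) simp
      qed
    qed (use \<psi> in simp)
    have "\<bar>?P - (LINT x|lborel. U x * b x)\<bar> = \<bar>LINT t|lborel. \<psi> t * ip (\<lambda>x. \<psi> x - q x) (\<lambda>u. a (u + z - t))\<bar>"
      unfolding Uq ip_diff_left[OF \<psi>L qL shift(2)] right_diff_distrib
      using mi[OF \<psi>L] mi[OF qL] by simp
    also have "\<dots> \<le> (LINT t|lborel. \<bar>\<psi> t\<bar> * (sqrt \<delta> * A))"
    proof (rule integral_abs_bound_integral)
      show "integrable lborel (\<lambda>t. \<psi> t * ip (\<lambda>x. \<psi> x - q x) (\<lambda>u. a (u + z - t)))"
        by (rule mi[OF L2_diff[OF \<psi>L qL]])
      show "integrable lborel (\<lambda>t. \<bar>\<psi> t\<bar> * (sqrt \<delta> * A))" using \<psi> by simp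
      fix t
      have "(ip (\<lambda>x. \<psi> x - q x) (\<lambda>u. a (u + z - t)))\<^sup>2 \<le> \<delta> * ip a a"
        using orth[OF shift(1), of t] unfolding ip_shift .
      then have "\<bar>ip (\<lambda>x. \<psi> x - q x) (\<lambda>u. a (u + z - t))\<bar> \<le> sqrt \<delta> * A"
        unfolding A_def real_sqrt_mult[symmetric] by (metis power2_abs real_le_rsqrt)
      then show "\<bar>\<psi> t * ip (\<lambda>x. \<psi> x - q x) (\<lambda>u. a (u + z - t))\<bar> \<le> \<bar>\<psi> t\<bar> * (sqrt \<delta> * A)"
        by (simp add: abs_mult mult_left_mono)
    qed
    also have "\<dots> = sqrt \<delta> * A * I" unfolding I_def by simp
    finally have PU: "\<bar>?P - (LINT x|lborel. U x * b x)\<bar> \<le> sqrt \<delta> * A * I" .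
    let ?c = "\<lambda>x. indicator (cball 0 R) x * b x"
    have split: "b x = ?c x + tail R x" for x by (auto simp: tail_def indicator_def)
    have ci: "integrable lborel (\<lambda>x. (U x - V x) * ?c x)"
    proof -
      have "(U x - V x) * ?c x = (U x * b x - V x * b x) - (U x * tail R x - V x * tail R x)" for x
        by (subst (2 3) split) (simp add: algebra_simps)
      then show ?thesis using Ug[OF b] Vg[OF b] Ug[OF tail, of R] Vg[OF tail, of R] by simp
    qed
    have "(LINT x|lborel. U x * b x) = (LINT x|lborel. U x * b x - V x * b x)"
      using Ug[OF b] Vg[OF b] V0 by simp
    also have "\<dots> = (LINT x|lborel. (U x - V x) * ?c x + (U x * tail R x - V x * tail R x))"
      by (rule Bochner_Integration.integral_cong[OF refl], subst (1 2) split) (simp add: algebra_simps)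
    also have "\<dots> = (LINT x|lborel. (U x - V x) * ?c x) + ((LINT x|lborel. U x * tail R x) - (LINT x|lborel. V x * tail R x))"
      using ci Ug[OF tail, of R] Vg[OF tail, of R] by simp
    finally have Ueq: "(LINT x|lborel. U x * b x) = (LINT x|lborel. (U x - V x) * ?c x) + ((LINT x|lborel. U x * tail R x) - (LINT x|lborel. V x * tail R x))" .
    have "\<bar>LINT x|lborel. (U x - V x) * ?c x\<bar> \<le> (LINT x|lborel. (2 * sqrt (\<delta> * C)) * \<bar>?c x\<bar>)"
    proof (rule integral_abs_bound_integral[OF ci])
      show "integrable lborel (\<lambda>x. (2 * sqrt (\<delta> * C)) * \<bar>?c x\<bar>)"
        using core_i[of R] by (intro integrable_mult_right integrable_abs)
      show "\<bar>(U x - V x) * ?c x\<bar> \<le> (2 * sqrt (\<delta> * C)) * \<bar>?c x\<bar>" for x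
        unfolding abs_mult[of "U x - V x"] by (rule mult_right_mono[OF UV]) simp
    qed
    also have "\<dots> = 2 * sqrt (\<delta> * C) * core R" unfolding core_def by simp
    finally show ?thesis
      using PU Ub[OF tail, of R] Vb[OF tail, of R] unfolding Ueq by linarith
  qed
  have "\<bar>?P\<bar> \<le> e" if e: "0 < e" for e
  proof -
    have "((\<lambda>R. 2 * I * (sqrt C * sqrt (ip (tail R) (tail R)))) \<longlongrightarrow> 2 * I * (sqrt C * sqrt 0)) at_top"
      by (intro tendsto_intros tail0)
    then have "\<forall>\<^sub>F R in at_top. 2 * I * (sqrt C * sqrt (ip (tail R) (tail R))) < e / 2"
      using e by (intro order_tendstoD(2)) auto
    then obtain R where R: "2 * I * (sqrt C * sqrt (ip (tail R) (tail R))) < e / 2"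
      using eventually_happens'[OF trivial_limit_at_top_linorder] by blast
    have "(\<lambda>n. sqrt (inverse (real (Suc n))) * A * I + 2 * sqrt (inverse (real (Suc n)) * C) * core R)
      \<longlonglongrightarrow> sqrt 0 * A * I + 2 * sqrt (0 * C) * core R"
      by (intro tendsto_intros LIMSEQ_inverse_real_of_nat)
    then have "\<forall>\<^sub>F n in sequentially. sqrt (inverse (real (Suc n))) * A * I + 2 * sqrt (inverse (real (Suc n)) * C) * core R < e / 2"
      using e by (intro order_tendstoD(2)) auto
    then obtain n where n: "sqrt (inverse (real (Suc n))) * A * I + 2 * sqrt (inverse (real (Suc n)) * C) * core R < e / 2"
      using eventually_happens'[OF sequentially_bot] by blast
    have "0 < inverse (real (Suc n))" "inverse (real (Suc n)) \<le> 1" by (auto simp: inverse_le_1_iff)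
    from key[OF this, of R] show ?thesis using R n by linarith
  qed
  from this[of "\<bar>?P\<bar> / 2"] show ?thesis by (cases "?P = 0") auto
qed

text \<open>Replacing a by -a, it is enough to exclude a positive value at z. By continuity a stays
  above half that value within distance \<eta> of z. With a bump of radius \<eta> / 2 the points u +
  z - t remain in that ball, so the correlation of the previous lemma would be positive.\<close>

lemma selfconv_zero_imp_zero:
  fixes a :: "'a::euclidean_space \<Rightarrow> real"
  assumes a: "a \<in> L2" and cont: "continuous_on UNIV a" and z0: "\<And>x. (LINT t|lborel. a (x - t) * a t) = 0"
  shows "a z = 0"
proof -
  have nonpos: "a z \<le> 0"
    if a: "a \<in> L2" and cont: "continuous_on UNIV a" and z0: "\<And>x. (LINT t|lborel. a (x - t) * a t) = 0"
    for a :: "'a \<Rightarrow> real"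
  proof (rule ccontr)
    assume "\<not> a z \<le> 0"
    then have az: "0 < a z" by simp
    have "isCont a z" using cont by (simp add: continuous_on_eq_continuous_at)
    then obtain \<eta> where \<eta>: "0 < \<eta>" "\<And>x. dist x z < \<eta> \<Longrightarrow> dist (a x) (a z) < a z / 2"
      using half_gt_zero[OF az] unfolding continuous_at_eps_delta by blast
    have lo: "a z / 2 \<le> a x" if "dist x z < \<eta>" for x
      using \<eta>(2)[OF that] az unfolding dist_real_def by linarith
    define \<psi> where "\<psi> x = max 0 (\<eta> / 2 - norm x)" for x :: 'a
    have [measurable]: "\<psi> \<in> borel_measurable borel" unfolding \<psi>_def[abs_def] by measurable
    have \<psi>0: "0 \<le> \<psi> x" for x by (simp add: \<psi>_def)
    have supp: "\<psi> x = 0" if "\<eta> / 2 \<le> norm x" for x using that by (simp add: \<psi>_def)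
    have fin: "emeasure lborel (cball (0 :: 'a) (\<eta> / 2)) < \<infinity>" by (rule emeasure_bounded_finite) simp
    have \<psi>i: "integrable lborel \<psi>"
    proof (rule Bochner_Integration.integrable_bound[of _ "\<lambda>x. (\<eta> / 2) * indicator (cball 0 (\<eta> / 2)) x"])
      show "integrable lborel (\<lambda>x::'a. (\<eta> / 2) * indicator (cball 0 (\<eta> / 2)) x)"
        using fin by (intro integrable_mult_right integrable_real_indicator) auto
    qed (use \<eta>(1) in \<open>auto simp: \<psi>_def indicator_def\<close>)
    have \<psi>L: "\<psi> \<in> L2"
    proof -
      have "integrable lborel (\<lambda>x. (\<psi> x)\<^sup>2)"
      proof (rule Bochner_Integration.integrable_bound[of _ "\<lambda>x. (\<eta> / 2) * \<psi> x"])
        show "AE x in lborel. norm ((\<psi> x)\<^sup>2) \<le> norm ((\<eta> / 2) * \<psi> x)"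
        proof (rule AE_I2)
          fix x
          have "\<psi> x \<le> \<eta> / 2" using \<eta>(1) norm_ge_zero[of x] unfolding \<psi>_def by (intro max.boundedI) linarith+
          from mult_right_mono[OF this \<psi>0] show "norm ((\<psi> x)\<^sup>2) \<le> norm ((\<eta> / 2) * \<psi> x)"
            using \<psi>0[of x] \<eta>(1) by (simp add: power2_eq_square abs_mult)
        qed
      qed (use \<psi>i in auto)
      then show ?thesis by (simp add: L2_real_iff)
    qed
    have J: "0 < (LINT t|lborel. \<psi> t)"
    proof -
      \<comment> \<open>The bump is at least \<eta> / 4 on the ball of radius \<eta> / 4.\<close>
      have "\<eta> / 4 * measure lborel (ball (0 :: 'a) (\<eta> / 4)) = (LINT t::'a|lborel. \<eta> / 4 * indicator (ball 0 (\<eta> / 4)) t)"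
        by simp
      also have "\<dots> \<le> (LINT t|lborel. \<psi> t)"
      proof (rule integral_mono[OF _ \<psi>i])
        show "integrable lborel (\<lambda>t::'a. \<eta> / 4 * indicator (ball 0 (\<eta> / 4)) t)"
          using emeasure_bounded_finite[of "ball (0 :: 'a) (\<eta> / 4)"]
          by (intro integrable_mult_right integrable_real_indicator) auto
        show "\<eta> / 4 * indicator (ball 0 (\<eta> / 4)) t \<le> \<psi> t" for t :: 'a
          using \<psi>0[of t] by (auto simp: \<psi>_def indicator_def max_def)
      qed
      finally show ?thesis
        using content_ball_pos[of "\<eta> / 4" "0 :: 'a"] \<eta>(1) by (smt (verit) divide_pos_pos mult_pos_pos)
    qed
    have aL: "(\<lambda>u. a (u + z - t)) \<in> L2" for t using L2_translate[OF a, of "t - z"] by (simp add: algebra_simps)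
    have [measurable]: "a \<in> borel_measurable borel" by (rule L2_measurable[OF a])
    have inner: "\<psi> t * (a z / 2 * (LINT u|lborel. \<psi> u)) \<le> \<psi> t * ip \<psi> (\<lambda>u. a (u + z - t))" for t
    proof (cases "\<eta> / 2 \<le> norm t")
      case False
      have "(LINT u|lborel. a z / 2 * \<psi> u) \<le> (LINT u|lborel. \<psi> u * a (u + z - t))"
      proof (rule integral_mono)
        show "integrable lborel (\<lambda>u. a z / 2 * \<psi> u)" using \<psi>i by simp
        show "integrable lborel (\<lambda>u. \<psi> u * a (u + z - t))" by (rule L2_mult_integrable[OF \<psi>L aL])
        fix u
        show "a z / 2 * \<psi> u \<le> \<psi> u * a (u + z - t)"
        proof (cases "\<eta> / 2 \<le> norm u")
          case u: False
          have "dist (u + z - t) z < \<eta>"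
            using norm_triangle_ineq4[of u t] u False by (simp add: dist_norm)
          then show ?thesis using mult_left_mono[OF lo \<psi>0] by (simp add: mult.commute)
        qed (simp add: supp)
      qed
      then have "a z / 2 * (LINT u|lborel. \<psi> u) \<le> ip \<psi> (\<lambda>u. a (u + z - t))" by (simp add: ip_def)
      then show ?thesis by (rule mult_left_mono[OF _ \<psi>0])
    qed (simp add: supp)
    have bnd: "\<bar>ip \<psi> (\<lambda>u. a (u + z - t))\<bar> \<le> sqrt (ip \<psi> \<psi>) * sqrt (ip a a)" for t
      using ip_Cauchy_Schwarz_sqrt[OF \<psi>L aL[of t]] ip_translate[OF a a, of "t - z"] by (simp add: algebra_simps)
    have "(LINT t|lborel. \<psi> t * (a z / 2 * (LINT u|lborel. \<psi> u))) \<le> (LINT t|lborel. \<psi> t * ip \<psi> (\<lambda>u. a (u + z - t)))"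
    proof (rule integral_mono[OF _ _ inner])
      show "integrable lborel (\<lambda>t. \<psi> t * ip \<psi> (\<lambda>u. a (u + z - t)))"
      proof (rule Bochner_Integration.integrable_bound[of _ "\<lambda>t. \<psi> t * (sqrt (ip \<psi> \<psi>) * sqrt (ip a a))"])
        show "(\<lambda>t. \<psi> t * ip \<psi> (\<lambda>u. a (u + z - t))) \<in> borel_measurable lborel" unfolding ip_def by measurable
        show "AE t in lborel. norm (\<psi> t * ip \<psi> (\<lambda>u. a (u + z - t))) \<le> norm (\<psi> t * (sqrt (ip \<psi> \<psi>) * sqrt (ip a a)))"
          using bnd \<psi>0 by (auto simp: abs_mult ip_nonneg intro!: mult_left_mono)
      qed (use \<psi>i in simp)
    qed (use \<psi>i in simp)
    also have "\<dots> = 0"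
      by (rule selfconv_zero_correlation[OF a z0 \<psi>L \<psi>i]) (simp add: \<psi>_def)
    finally have "(LINT t|lborel. \<psi> t) * (a z / 2 * (LINT u|lborel. \<psi> u)) \<le> 0" by simp
    moreover have "0 < (LINT t|lborel. \<psi> t) * (a z / 2 * (LINT u|lborel. \<psi> u))" using J az by simp
    ultimately show False by linarith
  qed
  have "(\<lambda>x. - a x) \<in> L2" using L2_scale[OF a, of "-1"] by simp
  moreover have "continuous_on UNIV (\<lambda>x. - a x)" using cont by (rule continuous_on_minus)
  ultimately have "- a z \<le> 0" by (rule nonpos) (use z0 in simp)
  then show ?thesis using nonpos[OF a cont z0] by simp
qed

section \<open>The convolution operator\<close>

text \<open>Dominated convergence on each Jordan part. It serves both the continuity of
  \<open>D \<mu>\<close> and that of the correlation with \<open>\<rho>h\<close> in the last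
  part.\<close>

lemma continuous_on_pairing_parameter:
  fixes K :: "'b::metric_space \<Rightarrow> 'a::euclidean_space \<Rightarrow> real"
  assumes \<Omega>: "compact \<Omega>" and K: "\<And>z. continuous_on \<Omega> (K z)" "\<And>z y. y \<in> \<Omega> \<Longrightarrow> \<bar>K z y\<bar> \<le> B"
    and cont: "\<And>y. y \<in> \<Omega> \<Longrightarrow> continuous_on UNIV (\<lambda>z. K z y)"
  shows "continuous_on UNIV (\<lambda>z. pairing \<Omega> (K z) \<mu>)"
proof -
  have "continuous_on UNIV (\<lambda>z. LINT y:\<Omega>|pos_part \<nu>. K z y)" for \<nu> :: "'a radon"
    unfolding continuous_on_sequentially
  proof (intro ballI allI impI)
    fix z :: 'b and x :: "nat \<Rightarrow> 'b" assume x: "(\<forall>n. x n \<in> UNIV) \<and> x \<longlonglongrightarrow> z"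
    interpret finite_measure "pos_part \<nu>" by (rule finite_measure_pos_part)
    have m: "(\<lambda>y. indicator \<Omega> y *\<^sub>R K z y) \<in> borel_measurable (pos_part \<nu>)" for z
      by (rule borel_measurable_if_sets_borel[OF borel_measurable_continuous_on_indicator[OF borel_compact[OF \<Omega>] K(1)] sets_pos_part])
    have "(\<lambda>n. LINT y|pos_part \<nu>. indicator \<Omega> y *\<^sub>R K (x n) y) \<longlonglongrightarrow> (LINT y|pos_part \<nu>. indicator \<Omega> y *\<^sub>R K z y)"
    proof (rule integral_dominated_convergence[where w = "\<lambda>_. \<bar>B\<bar>", OF m m])
      show "AE y in pos_part \<nu>. (\<lambda>n. indicator \<Omega> y *\<^sub>R K (x n) y) \<longlonglongrightarrow> indicator \<Omega> y *\<^sub>R K z y"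
      proof (rule AE_I2)
        fix y
        show "(\<lambda>n. indicator \<Omega> y *\<^sub>R K (x n) y) \<longlonglongrightarrow> indicator \<Omega> y *\<^sub>R K z y"
        proof (cases "y \<in> \<Omega>")
          case True
          have "(\<lambda>n. K (x n) y) \<longlonglongrightarrow> K z y"
            using continuous_on_tendsto_compose[OF cont[OF True], of x z] x by simp
          then show ?thesis using True by simp
        qed simp
      qed
      show "AE y in pos_part \<nu>. norm (indicator \<Omega> y *\<^sub>R K (x n) y) \<le> \<bar>B\<bar>" for n
        using K(2) by (intro AE_I2) (auto simp: indicator_def intro: order_trans[OF _ abs_ge_self])
    qed simp
    then show "((\<lambda>z. LINT y:\<Omega>|pos_part \<nu>. K z y) \<circ> x) \<longlonglongrightarrow> (LINT y:\<Omega>|pos_part \<nu>. K z y)"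
      by (simp add: comp_def set_lebesgue_integral_def)
  qed
  then show ?thesis unfolding pairing_def by (intro continuous_on_diff)
qed

lemma discrete_measure_representation:
  assumes "\<mu> \<in> discrete_measures \<Omega>"
  obtains X c where "finite X" "X \<subseteq> \<Omega>" "\<mu> = (\<Sum>x\<in>X. c x *\<^sub>R dirac x)"
proof -
  obtain T u where T: "finite T" "T \<subseteq> dirac ` \<Omega>" and \<mu>: "\<mu> = (\<Sum>v\<in>T. u v *\<^sub>R v)"
    using assms unfolding discrete_measures_def span_explicit by blast
  obtain X where X: "X \<subseteq> \<Omega>" "inj_on dirac X" "T = dirac ` X"
    using subset_image_inj[of T dirac \<Omega>] T(2) by auto
  have eq: "\<mu> = (\<Sum>x\<in>X. u (dirac x) *\<^sub>R dirac x)"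
    unfolding \<mu> X(3) by (rule sum.reindex_cong[OF X(2)]) simp_all
  have "finite X" using T(1) X by (simp add: finite_image_iff)
  then show thesis using X(1) eq by (rule that)
qed

lemma discrete_diff: "\<mu> \<in> discrete_measures \<Omega> \<Longrightarrow> \<nu> \<in> discrete_measures \<Omega> \<Longrightarrow> \<mu> - \<nu> \<in> discrete_measures \<Omega>"
  unfolding discrete_measures_def by (rule span_diff)

text \<open>The Fourier hypothesis enters through \<open>\<rho>_pd\<close>. The index type
  \<open>'a option\<close> leaves room for one atom in addition to those of a discrete measure,
  possibly at the same position as one of them.\<close>

locale convolution_kernel =
  fixes \<Omega> :: "'a::euclidean_space set" and \<rho> :: "'a \<Rightarrow> real" and B :: real
  assumes cpt: "compact \<Omega>" and \<rho>_cont: "continuous_on UNIV \<rho>" and \<rho>_bound: "\<And>z. \<bar>\<rho> z\<bar> \<le> B"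
    and \<rho>_even: "\<And>z. \<rho> (- z) = \<rho> z"
    and \<rho>_pd: "\<And>(I :: 'a option set) c x. finite I \<Longrightarrow> 0 \<le> (\<Sum>i\<in>I. \<Sum>j\<in>I. c i * c j * \<rho> (x i - x j))"
begin

abbreviation "D \<equiv> conv_op \<rho> \<Omega>"
abbreviation "P \<equiv> pairing \<Omega>"

text \<open>The squared seminorm. Estimates are stated for \<open>Q\<close> and not for its root,
  since its sign is established on discrete measures only.\<close>

definition Q :: "'a radon \<Rightarrow> real" where "Q \<mu> = P (D \<mu>) \<mu>"

lemma B_nonneg: "0 \<le> B"
  using \<rho>_bound[of 0] by linarith

lemma continuous_kernel: "continuous_on \<Omega> (\<lambda>y. \<rho> (x - y))"
  by (rule continuous_on_compose2[OF \<rho>_cont]) (auto intro!: continuous_intros)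

lemma continuous_D_UNIV: "continuous_on UNIV (D \<mu>)"
  unfolding conv_op_def[abs_def]
  by (rule continuous_on_pairing_parameter[OF cpt continuous_kernel \<rho>_bound])
    (rule continuous_on_compose2[OF \<rho>_cont], auto intro!: continuous_intros)

lemma continuous_D: "continuous_on \<Omega> (D \<mu>)"
  by (rule continuous_on_subset[OF continuous_D_UNIV]) simp

lemma D_diff: "D (\<mu> - \<nu>) x = D \<mu> x - D \<nu> x"
  unfolding conv_op_def by (rule pairing_diff_measure[OF cpt continuous_kernel])

lemma P_D_diff: "P (D (\<mu> - \<nu>)) \<xi> = P (D \<mu>) \<xi> - P (D \<nu>) \<xi>"
  unfolding D_diff[abs_def] by (rule pairing_diff[OF cpt continuous_D continuous_D])

lemma P_diff: "P (D \<mu>) (\<nu> - \<xi>) = P (D \<mu>) \<nu> - P (D \<mu>) \<xi>"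
  by (rule pairing_diff_measure[OF cpt continuous_D])

lemma pairing_discrete:
  assumes "finite X" "X \<subseteq> \<Omega>" "continuous_on \<Omega> \<phi>"
  shows "P \<phi> (\<Sum>x\<in>X. c x *\<^sub>R dirac x) = (\<Sum>x\<in>X. c x * \<phi> x)"
proof -
  have "P \<phi> (\<Sum>x\<in>X. c x *\<^sub>R dirac x) = (\<Sum>x\<in>X. P \<phi> (c x *\<^sub>R dirac x))"
    by (rule linear_sum[OF linear_pairing[OF cpt assms(3)]])
  also have "\<dots> = (\<Sum>x\<in>X. c x * \<phi> x)"
    using assms cpt by (intro sum.cong refl) (auto simp: pairing_scale_measure pairing_dirac subset_eq)
  finally show ?thesis .
qed

lemma D_discrete:
  assumes "finite X" "X \<subseteq> \<Omega>"
  shows "D (\<Sum>x\<in>X. c x *\<^sub>R dirac x) z = (\<Sum>x\<in>X. c x * \<rho> (z - x))"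
  unfolding conv_op_def by (rule pairing_discrete[OF assms continuous_kernel])

text \<open>With one discrete argument, symmetry is the evenness of \<rho> applied under a finite
  sum, for an arbitrary signed measure in the other argument.\<close>

lemma P_D_commute:
  assumes "\<mu> \<in> discrete_measures \<Omega>"
  shows "P (D \<mu>) \<nu> = P (D \<nu>) \<mu>"
proof -
  obtain X c where X: "finite X" "X \<subseteq> \<Omega>" and \<mu>: "\<mu> = (\<Sum>x\<in>X. c x *\<^sub>R dirac x)"
    by (rule discrete_measure_representation[OF assms])
  have ev: "\<rho> (z - x) = \<rho> (x - z)" for x z using \<rho>_even[of "x - z"] by simp
  have "P (D \<mu>) \<nu> = P (\<lambda>z. \<Sum>x\<in>X. c x * \<rho> (x - z)) \<nu>"
    unfolding \<mu> by (rule pairing_cong[OF cpt]) (simp add: D_discrete[OF X] ev)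
  also have "\<dots> = (\<Sum>x\<in>X. c x * D \<nu> x)"
    unfolding conv_op_def using X(1)
    by (subst pairing_sum[OF cpt]) (auto intro!: continuous_intros continuous_kernel simp: pairing_cmult[OF cpt])
  also have "\<dots> = P (D \<nu>) \<mu>"
    unfolding \<mu> by (rule pairing_discrete[OF X continuous_D, symmetric])
  finally show ?thesis .
qed

text \<open>The right-hand side is the form of \<mu> with an atom of weight t added at z. The point
  z may lie outside \<Omega>, where \<open>pairing\<close> would not see the atom, so positive
  definiteness of the kernel is applied directly.\<close>

lemma Q_dirac_perturbation:
  assumes "\<mu> \<in> discrete_measures \<Omega>"
  shows "0 \<le> Q \<mu> + 2 * t * D \<mu> z + t\<^sup>2 * \<rho> 0"
proof -
  obtain X c where X: "finite X" "X \<subseteq> \<Omega>" and \<mu>: "\<mu> = (\<Sum>x\<in>X. c x *\<^sub>R dirac x)"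
    by (rule discrete_measure_representation[OF assms])
  let ?c = "\<lambda>i. case i of None \<Rightarrow> t | Some x \<Rightarrow> c x" and ?x = "\<lambda>i. case i of None \<Rightarrow> z | Some x \<Rightarrow> x"
  have ev: "\<rho> (x - z) = \<rho> (z - x)" for x using \<rho>_even[of "z - x"] by simp
  have D: "D \<mu> y = (\<Sum>x\<in>X. c x * \<rho> (y - x))" for y unfolding \<mu> by (rule D_discrete[OF X])
  have Q: "Q \<mu> = (\<Sum>x\<in>X. c x * (\<Sum>y\<in>X. c y * \<rho> (x - y)))"
    unfolding Q_def \<mu> pairing_discrete[OF X continuous_D] D_discrete[OF X] ..
  have "0 \<le> (\<Sum>i\<in>insert None (Some ` X). \<Sum>j\<in>insert None (Some ` X). ?c i * ?c j * \<rho> (?x i - ?x j))"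
    by (rule \<rho>_pd) (simp add: X)
  also have "\<dots> = Q \<mu> + 2 * t * D \<mu> z + t\<^sup>2 * \<rho> 0"
    unfolding Q D using X(1)
    by (simp add: sum.reindex sum.distrib ev power2_eq_square sum_distrib_left algebra_simps)
  finally show ?thesis .
qed

lemma Q_discrete_nonneg: "\<mu> \<in> discrete_measures \<Omega> \<Longrightarrow> 0 \<le> Q \<mu>"
  using Q_dirac_perturbation[of \<mu> 0] by simp

lemma \<rho>_0_nonneg: "0 \<le> \<rho> 0"
proof -
  have "D 0 0 = 0" unfolding conv_op_def by (rule pairing_zero_measure[OF cpt continuous_kernel])
  moreover have "Q 0 = 0" unfolding Q_def by (rule pairing_zero_measure[OF cpt continuous_D])
  ultimately show ?thesis
    using Q_dirac_perturbation[of 0 1 0] by (simp add: discrete_measures_def span_zero)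
qed

text \<open>Cauchy-Schwarz against a Dirac measure: smallness in the seminorm implies uniform
  smallness of \<open>D \<mu>\<close> on the whole space.\<close>

lemma D_le_Q:
  assumes "\<mu> \<in> discrete_measures \<Omega>"
  shows "(D \<mu> z)\<^sup>2 \<le> Q \<mu> * \<rho> 0"
  by (rule quadratic_nonneg_imp_discriminant) (rule Q_dirac_perturbation[OF assms], rule \<rho>_0_nonneg)

lemma pairing_diff_bound:
  assumes "nonneg_measure \<mu>" "\<mu> \<in> measures_on \<Omega>" "nonneg_measure \<nu>" "\<nu> \<in> measures_on \<Omega>"
    and \<phi>: "continuous_on \<Omega> \<phi>" "\<And>x. x \<in> \<Omega> \<Longrightarrow> \<bar>\<phi> x\<bar> \<le> b"
  shows "\<bar>P \<phi> (\<mu> - \<nu>)\<bar> \<le> b * (norm \<mu> + norm \<nu>)"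
  using pairing_bound[OF assms(1) cpt assms(2) \<phi>] pairing_bound[OF assms(3) cpt assms(4) \<phi>]
  unfolding pairing_diff_measure[OF cpt \<phi>(1)] by (simp add: distrib_left)

text \<open>A crude bound by the sup norm of \<rho>. It supplies the lower bound for
  \<open>Q\<close> at differences that are not discrete.\<close>

lemma Q_diff_bound:
  assumes "nonneg_measure \<mu>" "\<mu> \<in> measures_on \<Omega>" "nonneg_measure \<nu>" "\<nu> \<in> measures_on \<Omega>"
  shows "\<bar>Q (\<mu> - \<nu>)\<bar> \<le> B * (norm \<mu> + norm \<nu>)\<^sup>2"
proof -
  have "\<bar>D (\<mu> - \<nu>) x\<bar> \<le> B * (norm \<mu> + norm \<nu>)" for x
    unfolding conv_op_def by (rule pairing_diff_bound[OF assms continuous_kernel \<rho>_bound])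
  from pairing_diff_bound[OF assms continuous_D this]
  show ?thesis unfolding Q_def by (simp add: power2_eq_square mult.assoc)
qed

text \<open>Weak-* convergence gives pointwise convergence of \<open>D (n k)\<close>. Bounded mass
  and uniform continuity of \<rho> make these functions equicontinuous, so convergence on a finite
  net of the compact set \<Omega> suffices.\<close>

lemma uniform_convergence_D:
  assumes n: "\<And>k. nonneg_measure (n k)" "\<And>k. n k \<in> measures_on \<Omega>" "\<And>k. norm (n k) \<le> C"
    and \<nu>: "nonneg_measure \<nu>" "norm \<nu> \<le> C" and conv: "weak_star_tendsto \<Omega> n \<nu>" and e: "0 < e"
  shows "\<forall>\<^sub>F k in sequentially. \<forall>x\<in>\<Omega>. \<bar>D (n k) x - D \<nu> x\<bar> < e"
proof -
  have \<nu>on: "\<nu> \<in> measures_on \<Omega>" using conv by (simp add: weak_star_tendsto_def)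
  have C0: "0 \<le> C" using \<nu>(2) norm_ge_zero order_trans by blast
  \<comment> \<open>A variation of \<rho> by e' changes \<open>D\<close> by at most e' * C, which is
    at most e / 4; adding 1 covers \<open>C = 0\<close>.\<close>
  define e' where "e' = e / (4 * (C + 1))"
  have e': "0 < e'" using e C0 by (simp add: e'_def)
  \<comment> \<open>The compact difference set of \<Omega>, containing all arguments at which \<rho>
    is evaluated.\<close>
  define K where "K = (\<lambda>(x, y). x - y) ` (\<Omega> \<times> \<Omega>)"
  have "compact K" unfolding K_def using cpt
    by (intro compact_continuous_image compact_Times) (auto intro!: continuous_intros simp: split_beta')
  then have "uniformly_continuous_on K \<rho>"
    by (intro compact_uniformly_continuous continuous_on_subset[OF \<rho>_cont]) auto
  then obtain d where d: "0 < d" "\<And>u v. u \<in> K \<Longrightarrow> v \<in> K \<Longrightarrow> dist v u < d \<Longrightarrow> dist (\<rho> v) (\<rho> u) < e'"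
    unfolding uniformly_continuous_on_def using e' by metis
  have eq: "\<bar>D \<eta> x - D \<eta> x'\<bar> \<le> e' * C"
    if \<eta>: "nonneg_measure \<eta>" "\<eta> \<in> measures_on \<Omega>" "norm \<eta> \<le> C" and x: "x \<in> \<Omega>" "x' \<in> \<Omega>" "dist x x' < d" for \<eta> x x'
  proof -
    have "\<bar>\<rho> (x - y) - \<rho> (x' - y)\<bar> \<le> e'" if "y \<in> \<Omega>" for y
    proof -
      have "dist (\<rho> (x - y)) (\<rho> (x' - y)) < e'"
      proof (rule d(2))
        show "x' - y \<in> K" using x(2) that by (auto simp: K_def intro!: image_eqI[of _ _ "(x', y)"])
        show "x - y \<in> K" using x(1) that by (auto simp: K_def intro!: image_eqI[of _ _ "(x, y)"])
      qed (use x(3) in \<open>simp add: dist_norm\<close>)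
      then show ?thesis by (simp add: dist_real_def)
    qed
    then have "\<bar>P (\<lambda>y. \<rho> (x - y) - \<rho> (x' - y)) \<eta>\<bar> \<le> e' * norm \<eta>"
      by (intro pairing_bound[OF \<eta>(1) cpt \<eta>(2)] continuous_on_diff continuous_kernel)
    also have "\<dots> \<le> e' * C" using \<eta>(3) e' by (intro mult_left_mono) auto
    finally show ?thesis unfolding conv_op_def pairing_diff[OF cpt continuous_kernel continuous_kernel] .
  qed
  obtain N where "N \<subseteq> \<Omega>" "finite N" "\<Omega> \<subseteq> (\<Union>x\<in>N. ball x d)"
    by (rule compactE_image[OF cpt, of \<Omega> "\<lambda>x. ball x d"]) (use d(1) in auto)
  then have N: "finite N" "N \<subseteq> \<Omega>" "\<Omega> \<subseteq> (\<Union>x\<in>N. ball x d)" by simp_all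
  have "\<forall>\<^sub>F k in sequentially. \<forall>x\<in>N. \<bar>D (n k) x - D \<nu> x\<bar> < e / 4"
  proof (intro eventually_ball_finite[OF N(1)] ballI)
    fix x
    have "(\<lambda>y. \<rho> (x - y)) \<in> C0 \<Omega>" using continuous_kernel cpt by (auto simp: C0_def)
    then have "(\<lambda>k. D (n k) x) \<longlonglongrightarrow> D \<nu> x"
      using conv by (simp add: weak_star_tendsto_def conv_op_def)
    then show "\<forall>\<^sub>F k in sequentially. \<bar>D (n k) x - D \<nu> x\<bar> < e / 4"
      using tendstoD[of "\<lambda>k. D (n k) x" _ _ "e / 4"] e by (simp add: dist_real_def)
  qed
  then show ?thesis
  proof eventually_elim
    case (elim k)
    show ?case
    proof
      fix x assume x: "x \<in> \<Omega>"
      then obtain x' where x': "x' \<in> N" "dist x x' < d" using N(3) by (auto simp: dist_commute)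
      have "\<bar>D (n k) x - D (n k) x'\<bar> \<le> e' * C" using eq[OF n(1,2,3) x _ x'(2)] x'(1) N(2) by blast
      moreover have "\<bar>D \<nu> x - D \<nu> x'\<bar> \<le> e' * C" using eq[OF \<nu>(1) \<nu>on \<nu>(2) x _ x'(2)] x'(1) N(2) by blast
      moreover have "e' * C \<le> e / 4" using e C0 by (simp add: e'_def field_simps)
      moreover have "\<bar>D (n k) x' - D \<nu> x'\<bar> < e / 4" using elim x'(1) by blast
      ultimately show "\<bar>D (n k) x - D \<nu> x\<bar> < e" using e by linarith
    qed
  qed
qed

lemma C0_iff: "\<phi> \<in> C0 \<Omega> \<longleftrightarrow> continuous_on \<Omega> \<phi>"
  using cpt by (auto simp: C0_def)

text \<open>On the compact set \<Omega> the constant 1 is an admissible test function, so no mass is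
  lost in the limit.\<close>

lemma weak_star_norm_tendsto:
  assumes n: "\<And>k. nonneg_measure (n k)" "\<And>k. n k \<in> measures_on \<Omega>"
    and \<nu>: "nonneg_measure \<nu>" and conv: "weak_star_tendsto \<Omega> n \<nu>"
  shows "(\<lambda>k. norm (n k)) \<longlonglongrightarrow> norm \<nu>"
proof -
  have \<nu>on: "\<nu> \<in> measures_on \<Omega>" using conv by (simp add: weak_star_tendsto_def)
  have "(\<lambda>k. P (\<lambda>_. 1) (n k)) \<longlonglongrightarrow> P (\<lambda>_. 1) \<nu>"
    using conv by (simp add: weak_star_tendsto_def C0_iff)
  then show ?thesis using n \<nu> \<nu>on by (simp add: pairing_const[OF _ cpt])
qed

lemma conv_norm_eq: "conv_norm \<rho> \<Omega> \<mu> = sqrt (Q \<mu>)"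
  by (simp add: conv_norm_def Q_def)

end

section \<open>Convergence of the forward-backward method\<close>

text \<open>The derivative is taken within M, so only the segment from x to y is available; the
  inequality is the one-sided limit of difference quotients, each bounded by convexity.\<close>

lemma convex_on_derivative_le:
  fixes F :: "'b::real_normed_vector \<Rightarrow> real"
  assumes F: "convex_on M F" and d: "(F has_derivative G) (at x within M)" and x: "x \<in> M" and y: "y \<in> M"
  shows "F x + G (y - x) \<le> F y"
proof -
  define g where "g t = F (x + t *\<^sub>R (y - x))" for t :: real
  have M: "convex M" using F by (rule convex_on_imp_convex)
  have seg: "x + t *\<^sub>R (y - x) \<in> M" if "t \<in> {0..1}" for t
  proof -
    have "(1 - t) *\<^sub>R x + t *\<^sub>R y \<in> M" using that M x y by (intro convexD) auto
    then show ?thesis by (simp add: algebra_simps)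
  qed
  have "((\<lambda>t. x + t *\<^sub>R (y - x)) has_derivative (\<lambda>t. t *\<^sub>R (y - x))) (at 0 within {0..1})"
    by (auto intro!: derivative_eq_intros)
  moreover have "(F has_derivative G) (at (x + 0 *\<^sub>R (y - x)) within (\<lambda>t. x + t *\<^sub>R (y - x)) ` {0..1})"
    using has_derivative_subset[OF d, of "(\<lambda>t. x + t *\<^sub>R (y - x)) ` {0..1}"] seg by (simp add: image_subset_iff)
  ultimately have "(g has_derivative (\<lambda>t. G (t *\<^sub>R (y - x)))) (at 0 within {0..1})"
    unfolding g_def by (rule has_derivative_in_compose)
  moreover have "(\<lambda>t. G (t *\<^sub>R (y - x))) = (*) (G (y - x))"
    using linear_cmul[OF has_derivative_linear[OF d]] by (auto simp: mult.commute)
  ultimately have "(g has_real_derivative G (y - x)) (at 0 within {0..1})"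
    by (simp add: has_field_derivative_def)
  then have lim: "((\<lambda>t. (g t - g 0) / (t - 0)) \<longlongrightarrow> G (y - x)) (at 0 within {0..1})"
    by (simp add: has_field_derivative_iff)
  have "\<forall>\<^sub>F t in at 0 within {0..1}. (g t - g 0) / (t - 0) \<le> F y - F x"
    unfolding eventually_at
  proof (intro exI[of _ 1] conjI ballI impI)
    fix t :: real assume t: "t \<in> {0..1}" and "t \<noteq> 0 \<and> dist t 0 < 1"
    then have t0: "0 < t" by auto
    have "g t = F ((1 - t) *\<^sub>R x + t *\<^sub>R y)" unfolding g_def by (simp add: algebra_simps)
    also have "\<dots> \<le> (1 - t) * F x + t * F y" using convex_onD[OF F, of t x y] t x y by simp
    finally have "g t - g 0 \<le> t * (F y - F x)" by (simp add: g_def algebra_simps)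
    then show "(g t - g 0) / (t - 0) \<le> F y - F x" using t0 by (simp add: pos_divide_le_eq mult.commute)
  qed simp
  moreover have "at (0::real) within {0..1} \<noteq> bot"
    by (simp add: trivial_limit_within islimpt_Icc)
  ultimately have "G (y - x) \<le> F y - F x" by (rule tendsto_upperbound[OF lim])
  then show ?thesis by simp
qed

text \<open>Passing to a k + 1 absorbs the additive error into the factor 1 + c k + d k, which is at
  most exp (c k + d k).\<close>

lemma discrete_Gronwall_bounded:
  fixes a c d :: "nat \<Rightarrow> real"
  assumes rec: "\<And>k. a (Suc k) \<le> (1 + c k) * a k + d k" and nn: "\<And>k. 0 \<le> a k" "\<And>k. 0 \<le> c k" "\<And>k. 0 \<le> d k"
    and sum: "summable c" "summable d"
  obtains C where "\<forall>k. a k \<le> C"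
proof -
  let ?s = "\<lambda>k. c k + d k"
  have s: "summable ?s" using sum by (rule summable_add)
  have b: "a k + 1 \<le> (a 0 + 1) * exp (\<Sum>i<k. ?s i)" for k
  proof (induction k)
    case (Suc k)
    have "a (Suc k) + 1 \<le> (1 + ?s k) * (a k + 1)"
      using rec[of k] mult_nonneg_nonneg[OF nn(3) nn(1), of k k] nn(2)[of k] nn(3)[of k] by (simp add: algebra_simps)
    also have "\<dots> \<le> exp (?s k) * (a k + 1)"
      using exp_ge_add_one_self nn(1)[of k] by (intro mult_right_mono) auto
    also have "\<dots> \<le> exp (?s k) * ((a 0 + 1) * exp (\<Sum>i<k. ?s i))"
      using Suc by (intro mult_left_mono) auto
    finally show ?case by (simp add: exp_add mult_ac)
  qed simp
  have "a k \<le> (a 0 + 1) * exp (\<Sum>i. ?s i)" for k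
  proof -
    have "(\<Sum>i<k. ?s i) \<le> (\<Sum>i. ?s i)" using s nn by (intro sum_le_suminf) auto
    then have "(a 0 + 1) * exp (\<Sum>i<k. ?s i) \<le> (a 0 + 1) * exp (\<Sum>i. ?s i)"
      using nn(1)[of 0] by (intro mult_left_mono) auto
    then show ?thesis using b[of k] by linarith
  qed
  then show thesis using that by blast
qed

text \<open>Subtracting the partial sums of the errors makes the sequence decreasing, and
  summability keeps it bounded below.\<close>

lemma quasi_decreasing_convergent:
  fixes a c :: "nat \<Rightarrow> real"
  assumes rec: "\<And>k. a (Suc k) \<le> a k + c k" and c: "\<And>k. 0 \<le> c k" "summable c" and lb: "\<And>k. b \<le> a k"
  shows "convergent a"
proof -
  let ?b = "\<lambda>k. a k - (\<Sum>i<k. c i)"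
  have dec: "decseq ?b" by (rule decseq_SucI) (use rec in \<open>simp add: algebra_simps\<close>)
  have "b - suminf c \<le> ?b k" for k
    using lb[of k] sum_le_suminf[OF c(2), of "{..<k}"] c(1) by (simp add: diff_mono)
  then have low: "\<forall>k. b - suminf c \<le> ?b k" by blast
  obtain L where "?b \<longlonglongrightarrow> L" by (rule decseq_convergent[OF dec low])
  moreover have "(\<lambda>k. \<Sum>i<k. c i) \<longlonglongrightarrow> suminf c" by (rule summable_LIMSEQ[OF c(2)])
  ultimately have "(\<lambda>k. ?b k + (\<Sum>i<k. c i)) \<longlonglongrightarrow> L + suminf c" by (rule tendsto_add)
  then show ?thesis by (auto intro: convergentI)
qed

lemma zero_in_pre_subdiff_iff:
  assumes "0 \<le> \<alpha>"
  shows "(\<lambda>x. 0) \<in> pre_subdiff \<Omega> (\<lambda>\<nu>. ereal (F \<nu>) + reg_G \<alpha> \<nu>) \<eta> \<longleftrightarrow>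
    nonneg_measure \<eta> \<and> (\<forall>\<nu>\<in>measures_on \<Omega>. nonneg_measure \<nu> \<longrightarrow> F \<eta> + \<alpha> * norm \<eta> \<le> F \<nu> + \<alpha> * norm \<nu>)"
proof -
  have C0: "(\<lambda>x. 0) \<in> C0 \<Omega>" by (auto simp: C0_def intro!: exI[of _ "{}"])
  have P0: "pairing \<Omega> (\<lambda>x. 0) \<nu> = 0" for \<nu> :: "'a radon"
    by (simp add: pairing_def set_lebesgue_integral_def)
  have z: "0 \<in> measures_on \<Omega>" by (rule subspace_0[OF subspace_measures_on])
  show ?thesis
  proof (cases "nonneg_measure \<eta>")
    case True
    have "(ereal (F \<nu>) + reg_G \<alpha> \<nu>) - (ereal (F \<eta>) + reg_G \<alpha> \<eta>) \<ge> 0 \<longleftrightarrow>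
      (nonneg_measure \<nu> \<longrightarrow> F \<eta> + \<alpha> * norm \<eta> \<le> F \<nu> + \<alpha> * norm \<nu>)" for \<nu>
      using True by (cases "nonneg_measure \<nu>") (auto simp: reg_G_def zero_ereal_def)
    then show ?thesis using True by (auto simp: pre_subdiff_def C0 P0 zero_ereal_def[symmetric])
  next
    case False
    \<comment> \<open>Where the functional is infinite, comparison with the zero measure yields a
      finite value minus infinity, which is negative.\<close>
    have "\<not> 0 \<le> (ereal (F 0) + reg_G \<alpha> 0) - (ereal (F \<eta>) + reg_G \<alpha> \<eta>)"
      using False by (simp add: reg_G_def nonneg_zero)
    then show ?thesis using False z by (auto simp: pre_subdiff_def P0 zero_ereal_def[symmetric])
  qed
qed

section \<open>A priori estimates for the iterates\<close>

locale forward_backward = convolution_kernel \<Omega> \<rho> B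
  for \<Omega> :: "'a::euclidean_space set" and \<rho> B +
  fixes F :: "'a radon \<Rightarrow> real" and F' :: "'a radon \<Rightarrow> 'a \<Rightarrow> real" and \<mu> :: "nat \<Rightarrow> 'a radon"
    and \<alpha> L \<tau> \<kappa> :: real and \<epsilon> :: "nat \<Rightarrow> real"
  assumes \<alpha>: "\<alpha> > 0" and convF: "convex_on (measures_on \<Omega>) F" and derF: "has_pre_derivative \<Omega> F F'"
    and smooth: "\<And>\<mu> \<nu>. \<mu> \<in> measures_on \<Omega> \<Longrightarrow> \<nu> \<in> measures_on \<Omega> \<Longrightarrow>
           F \<nu> - F \<mu> - pairing \<Omega> (F' \<mu>) (\<nu> - \<mu>) \<le> L / 2 * (conv_norm \<rho> \<Omega> (\<nu> - \<mu>))\<^sup>2"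
    and \<tau>: "\<tau> > 0" "\<tau> * L < 1" and \<kappa>: "0 < \<kappa>" and alg: "muFB \<Omega> \<rho> \<alpha> F' \<tau> \<kappa> \<epsilon> \<mu>"
    and bdd: "bdd_below (F ` measures_on \<Omega>)"
    and F'_cont: "\<And>\<mu> e. \<mu> \<in> measures_on \<Omega> \<Longrightarrow> e > 0 \<Longrightarrow>
           \<exists>d>0. \<forall>\<nu>\<in>measures_on \<Omega>. conv_norm \<rho> \<Omega> (\<nu> - \<mu>) < d \<longrightarrow>
             (\<forall>x\<in>\<Omega>. \<bar>F' \<nu> x - F' \<mu> x\<bar> < e)"
    and \<epsilon>: "\<And>k. \<epsilon> (Suc k) > 0" "summable (\<lambda>k. \<epsilon> (Suc k))"
begin

definition J :: "'a radon \<Rightarrow> real" where "J \<nu> = F \<nu> + \<alpha> * norm \<nu>"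

definition \<Delta> :: "nat \<Rightarrow> 'a radon" where "\<Delta> k = \<mu> (Suc k) - \<mu> k"

definition res :: "nat \<Rightarrow> 'a \<Rightarrow> real" where "res k x = \<tau> * (F' (\<mu> k) x + \<alpha>) + D (\<Delta> k) x"

lemma \<mu>_discrete: "\<mu> k \<in> discrete_measures \<Omega>"
  using alg by (cases k) (auto simp: muFB_def Let_def)

lemma \<mu>_on: "\<mu> k \<in> measures_on \<Omega>"
  using \<mu>_discrete discrete_subset_measures_on by blast

lemma \<mu>_nonneg: "nonneg_measure (\<mu> (Suc k))"
  using alg by (auto simp: muFB_def Let_def)

lemma res_ge: "x \<in> \<Omega> \<Longrightarrow> - \<epsilon> (Suc k) \<le> res k x"
  using alg by (auto simp: muFB_def Let_def res_def \<Delta>_def)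

lemma res_pairing: "P (res k) (\<mu> (Suc k)) \<le> \<kappa> * \<epsilon> (Suc k)"
  using alg by (auto simp: muFB_def Let_def res_def[abs_def] \<Delta>_def)

lemma \<Delta>_discrete: "\<Delta> k \<in> discrete_measures \<Omega>"
  unfolding \<Delta>_def by (rule discrete_diff[OF \<mu>_discrete \<mu>_discrete])

lemma continuous_F': "\<nu> \<in> measures_on \<Omega> \<Longrightarrow> continuous_on \<Omega> (F' \<nu>)"
  using derF by (auto simp: has_pre_derivative_def C0_iff)

lemma gradient_inequality: "\<eta> \<in> measures_on \<Omega> \<Longrightarrow> \<nu> \<in> measures_on \<Omega> \<Longrightarrow> F \<eta> + P (F' \<eta>) (\<nu> - \<eta>) \<le> F \<nu>"
  using derF by (intro convex_on_derivative_le[OF convF]) (auto simp: has_pre_derivative_def)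

lemma continuous_res: "continuous_on \<Omega> (res k)"
  unfolding res_def[abs_def] by (intro continuous_intros continuous_F' \<mu>_on continuous_D)

lemma pairing_res: "P (res k) \<sigma> = \<tau> * P (F' (\<mu> k)) \<sigma> + \<tau> * (\<alpha> * P (\<lambda>_. 1) \<sigma>) + P (D (\<Delta> k)) \<sigma>"
proof -
  have c: "continuous_on \<Omega> (F' (\<mu> k))" by (rule continuous_F'[OF \<mu>_on])
  have "P (res k) \<sigma> = P (\<lambda>x. \<tau> * F' (\<mu> k) x + \<tau> * \<alpha> * 1 + D (\<Delta> k) x) \<sigma>"
    unfolding res_def[abs_def] by (simp add: distrib_left)
  also have "\<dots> = P (\<lambda>x. \<tau> * F' (\<mu> k) x + \<tau> * \<alpha> * 1) \<sigma> + P (D (\<Delta> k)) \<sigma>"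
    by (rule pairing_add[OF cpt]) (intro continuous_intros c continuous_D)+
  also have "P (\<lambda>x. \<tau> * F' (\<mu> k) x + \<tau> * \<alpha> * 1) \<sigma> = P (\<lambda>x. \<tau> * F' (\<mu> k) x) \<sigma> + P (\<lambda>x. \<tau> * \<alpha> * 1) \<sigma>"
    by (rule pairing_add[OF cpt]) (intro continuous_intros c)+
  finally show ?thesis unfolding pairing_cmult[OF cpt] by simp
qed

lemma pairing_one: "nonneg_measure \<nu> \<Longrightarrow> \<nu> \<in> measures_on \<Omega> \<Longrightarrow> P (\<lambda>_. 1) \<nu> = norm \<nu>"
  using pairing_const[OF _ cpt, of \<nu> 1] by simp

text \<open>The residual is tested with \<mu>^(k+1) - \<nu>. Its lower bound on all of \<Omega>
  controls the part with \<nu> and yields the error \<open>norm \<nu>\<close>; the integrated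
  condition of the step controls the other part and yields \<kappa>. The change of F is split at
  \<mu>^k: smoothness handles the move to \<mu>^(k+1), convexity the move to \<nu>.\<close>

lemma three_point:
  assumes \<nu>: "\<nu> \<in> measures_on \<Omega>" "nonneg_measure \<nu>"
  shows "\<tau> * (J (\<mu> (Suc k)) - J \<nu>) + P (D (\<Delta> k)) (\<mu> (Suc k) - \<nu>)
    \<le> \<epsilon> (Suc k) * (\<kappa> + norm \<nu>) + \<tau> * L / 2 * Q (\<Delta> k)"
proof -
  let ?m = "\<mu> (Suc k)"
  have "- \<epsilon> (Suc k) * norm \<nu> \<le> P (res k) \<nu>"
    using pairing_mono[OF \<nu>(2) cpt _ continuous_res, of "\<lambda>_. - \<epsilon> (Suc k)" k] res_ge \<nu>
    by (simp add: pairing_const[OF _ cpt])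
  then have "P (res k) (?m - \<nu>) \<le> \<epsilon> (Suc k) * (\<kappa> + norm \<nu>)"
    unfolding pairing_diff_measure[OF cpt continuous_res] using res_pairing[of k] by (simp add: algebra_simps)
  moreover have "P (\<lambda>_. 1) (?m - \<nu>) = norm ?m - norm \<nu>"
    by (subst pairing_diff_measure[OF cpt]) (auto simp: pairing_one \<mu>_nonneg \<mu>_on \<nu>)
  ultimately have 1: "\<tau> * P (F' (\<mu> k)) (?m - \<nu>) + \<tau> * (\<alpha> * (norm ?m - norm \<nu>)) + P (D (\<Delta> k)) (?m - \<nu>) \<le> \<epsilon> (Suc k) * (\<kappa> + norm \<nu>)"
    by (simp add: pairing_res)
  \<comment> \<open>The root squares back to \<open>Q\<close> because \<open>\<Delta> k\<close> is
    discrete, so \<open>Q\<close> is nonnegative there.\<close>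
  have "(conv_norm \<rho> \<Omega> (?m - \<mu> k))\<^sup>2 = Q (\<Delta> k)"
    using Q_discrete_nonneg[OF \<Delta>_discrete] by (simp add: conv_norm_eq \<Delta>_def)
  then have "F ?m - F (\<mu> k) - P (F' (\<mu> k)) (?m - \<mu> k) \<le> L / 2 * Q (\<Delta> k)"
    using smooth[OF \<mu>_on[of k] \<mu>_on[of "Suc k"]] by simp
  moreover have "F (\<mu> k) + P (F' (\<mu> k)) (\<nu> - \<mu> k) \<le> F \<nu>" by (rule gradient_inequality[OF \<mu>_on \<nu>(1)])
  ultimately have "F ?m - F \<nu> \<le> P (F' (\<mu> k)) (?m - \<nu>) + L / 2 * Q (\<Delta> k)"
    by (simp add: pairing_diff_measure[OF cpt continuous_F'[OF \<mu>_on]])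
  then have "\<tau> * (F ?m - F \<nu>) \<le> \<tau> * P (F' (\<mu> k)) (?m - \<nu>) + \<tau> * L / 2 * Q (\<Delta> k)"
    using mult_left_mono[of "F ?m - F \<nu>" _ \<tau>] \<tau>(1) by (fastforce simp: distrib_left mult.assoc)
  then show ?thesis using 1 by (simp add: J_def algebra_simps)
qed

text \<open>With \<nu> the previous iterate the mixed term equals \<open>Q\<close> of the step, and
  \<tau> * L < 1 leaves at least half of it on the left. The index starts one later because
  nonnegativity is guaranteed only from \<mu>^1 on.\<close>

lemma descent:
  "\<tau> * (J (\<mu> (Suc (Suc k))) - J (\<mu> (Suc k))) + Q (\<Delta> (Suc k)) / 2 \<le> \<epsilon> (Suc (Suc k)) * (\<kappa> + norm (\<mu> (Suc k)))"
proof -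
  have "\<tau> * L / 2 * Q (\<Delta> (Suc k)) \<le> 1 / 2 * Q (\<Delta> (Suc k))"
    using \<tau> by (intro mult_right_mono Q_discrete_nonneg \<Delta>_discrete) auto
  moreover have "P (D (\<Delta> (Suc k))) (\<mu> (Suc (Suc k)) - \<mu> (Suc k)) = Q (\<Delta> (Suc k))"
    by (simp add: Q_def \<Delta>_def)
  ultimately show ?thesis using three_point[OF \<mu>_on \<mu>_nonneg, of "Suc k" k] by simp
qed

text \<open>Expanding \<open>Q\<close> at p - \<Delta> k, with p the new difference, produces the
  mixed term of the three-point inequality; the term \<open>Q (\<Delta> k)\<close> that appears with
  it absorbs the smoothness error. The expansion is legitimate since \<open>\<Delta> k\<close> is
  discrete, although p need not be.\<close>

lemma quasi_Fejer:
  assumes \<nu>: "\<nu> \<in> measures_on \<Omega>" "nonneg_measure \<nu>" and min: "J \<nu> \<le> J (\<mu> (Suc k))"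
  shows "Q (\<mu> (Suc k) - \<nu>) \<le> Q (\<mu> k - \<nu>) + 2 * (\<epsilon> (Suc k) * (\<kappa> + norm \<nu>))"
proof -
  let ?p = "\<mu> (Suc k) - \<nu>"
  have eq: "\<mu> k - \<nu> = ?p - \<Delta> k" by (simp add: \<Delta>_def)
  have "Q (\<mu> k - \<nu>) = Q ?p - 2 * P (D (\<Delta> k)) ?p + Q (\<Delta> k)"
    unfolding eq Q_def using P_D_commute[OF \<Delta>_discrete, of k ?p] by (simp add: P_D_diff P_diff)
  moreover have "0 \<le> \<tau> * (J (\<mu> (Suc k)) - J \<nu>)" using \<tau>(1) min by simp
  moreover have "\<tau> * L / 2 * Q (\<Delta> k) \<le> 1 / 2 * Q (\<Delta> k)"
    using \<tau> by (intro mult_right_mono Q_discrete_nonneg \<Delta>_discrete) auto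
  ultimately show ?thesis using three_point[OF \<nu>, of k] by simp
qed

text \<open>The descent error contains the norm of the iterate itself, so plain summation gives no
  bound. As F is bounded below, the objective controls \<alpha> times the norm, and a Gronwall
  recursion closes the circle.\<close>

lemma norm_bounded: obtains C where "\<forall>k. norm (\<mu> (Suc k)) \<le> C" "0 \<le> C"
proof -
  obtain b where b: "\<And>\<nu>. \<nu> \<in> measures_on \<Omega> \<Longrightarrow> b \<le> F \<nu>" using bdd unfolding bdd_below_def by auto
  define a where "a k = J (\<mu> (Suc k)) - b" for k
  have na: "\<alpha> * norm (\<mu> (Suc k)) \<le> a k" for k using b[OF \<mu>_on, of "Suc k"] by (simp add: a_def J_def)
  have a0: "0 \<le> a k" for k using na[of k] \<alpha> by (meson mult_nonneg_nonneg norm_ge_zero less_imp_le order_trans)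
  \<comment> \<open>These coefficients arise from inserting
    \<open>norm (\<mu> (Suc k)) \<le> a k / \<alpha>\<close> into the descent error and dividing by
    \<tau>.\<close>
  define c where "c k = \<epsilon> (Suc (Suc k)) / (\<tau> * \<alpha>)" for k
  define d where "d k = \<epsilon> (Suc (Suc k)) * \<kappa> / \<tau>" for k
  have s: "summable (\<lambda>k. \<epsilon> (Suc (Suc k)))" using \<epsilon>(2) summable_Suc_iff[of "\<lambda>k. \<epsilon> (Suc k)"] by simp
  have rec: "a (Suc k) \<le> (1 + c k) * a k + d k" for k
  proof -
    have "\<tau> * (a (Suc k) - a k) \<le> \<epsilon> (Suc (Suc k)) * (\<kappa> + norm (\<mu> (Suc k)))"
      using descent[of k] Q_discrete_nonneg[OF \<Delta>_discrete, of "Suc k"] by (simp add: a_def)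
    also have "\<dots> \<le> \<epsilon> (Suc (Suc k)) * (\<kappa> + a k / \<alpha>)"
      using na[of k] \<alpha> less_imp_le[OF \<epsilon>(1)] by (intro mult_left_mono) (auto simp: field_simps)
    finally have "a (Suc k) - a k \<le> \<epsilon> (Suc (Suc k)) * (\<kappa> + a k / \<alpha>) / \<tau>"
      using \<tau>(1) by (simp add: pos_le_divide_eq mult.commute)
    also have "\<dots> = c k * a k + d k" using \<alpha> \<tau>(1) by (simp add: c_def d_def field_simps)
    finally show ?thesis by (simp add: distrib_right)
  qed
  obtain C where "\<forall>k. a k \<le> C"
  proof (rule discrete_Gronwall_bounded[where a = a and c = c and d = d, OF rec a0])
    show "0 \<le> c k" "0 \<le> d k" for k using \<epsilon>(1) \<alpha> \<tau>(1) \<kappa> by (auto simp: c_def d_def less_imp_le)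
    show "summable c" "summable d" unfolding c_def[abs_def] d_def[abs_def] using s by (auto intro!: summable_divide summable_mult2)
  qed
  then have "\<alpha> * norm (\<mu> (Suc k)) \<le> C" for k
    using na[of k] order_trans by blast
  then have n: "norm (\<mu> (Suc k)) \<le> C / \<alpha>" for k
    using \<alpha> by (simp add: pos_le_divide_eq mult.commute)
  show thesis
  proof (rule that)
    show "\<forall>k. norm (\<mu> (Suc k)) \<le> C / \<alpha>" using n by blast
    show "0 \<le> C / \<alpha>" using n[of 0] norm_ge_zero order_trans by blast
  qed
qed

text \<open>The descent inequality telescopes: the objective is bounded below, and bounded masses
  make its errors summable.\<close>

lemma Q_\<Delta>_tendsto_0: "(\<lambda>k. Q (\<Delta> k)) \<longlonglongrightarrow> 0"
proof -
  obtain b where b: "\<And>\<nu>. \<nu> \<in> measures_on \<Omega> \<Longrightarrow> b \<le> F \<nu>" using bdd unfolding bdd_below_def by auto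
  obtain C where C: "\<And>k. norm (\<mu> (Suc k)) \<le> C" "0 \<le> C" using norm_bounded by metis
  have s: "summable (\<lambda>k. \<epsilon> (Suc (Suc k)))" using \<epsilon>(2) summable_Suc_iff[of "\<lambda>k. \<epsilon> (Suc k)"] by simp
  define e where "e k = \<epsilon> (Suc (Suc k)) * (\<kappa> + C)" for k
  have es: "summable e" unfolding e_def[abs_def] using s by (rule summable_mult2)
  have e0: "0 \<le> e k" for k using \<epsilon>(1) \<kappa> C(2) by (simp add: e_def less_imp_le)
  have part: "(\<Sum>k<n. Q (\<Delta> (Suc k)) / 2) \<le> \<tau> * (J (\<mu> (Suc 0)) - J (\<mu> (Suc n))) + (\<Sum>k<n. e k)" for n
  proof (induction n)
    case (Suc n)
    have "\<epsilon> (Suc (Suc n)) * (\<kappa> + norm (\<mu> (Suc n))) \<le> e n"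
      unfolding e_def using C(1)[of n] less_imp_le[OF \<epsilon>(1)] by (intro mult_left_mono) auto
    then show ?case using Suc descent[of n] by (simp add: algebra_simps)
  qed simp
  have "summable (\<lambda>k. Q (\<Delta> (Suc k)) / 2)"
  proof (rule bounded_imp_summable)
    show "0 \<le> Q (\<Delta> (Suc k)) / 2" for k using Q_discrete_nonneg[OF \<Delta>_discrete] by simp
    show "(\<Sum>k\<le>n. Q (\<Delta> (Suc k)) / 2) \<le> \<tau> * (J (\<mu> (Suc 0)) - b) + suminf e" for n
    proof -
      have "b \<le> J (\<mu> (Suc (Suc n)))"
        using b[OF \<mu>_on, of "Suc (Suc n)"] \<alpha> by (simp add: J_def add_increasing2)
      then have "\<tau> * (J (\<mu> (Suc 0)) - J (\<mu> (Suc (Suc n)))) \<le> \<tau> * (J (\<mu> (Suc 0)) - b)"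
        using \<tau>(1) by (intro mult_left_mono) auto
      moreover have "(\<Sum>k<Suc n. e k) \<le> suminf e" using es e0 by (intro sum_le_suminf) auto
      ultimately show ?thesis using part[of "Suc n"] by (simp only: lessThan_Suc_atMost)
    qed
  qed
  then have "(\<lambda>k. Q (\<Delta> (Suc k)) / 2) \<longlonglongrightarrow> 0" by (rule summable_LIMSEQ_zero)
  then have "(\<lambda>k. 2 * (Q (\<Delta> (Suc k)) / 2)) \<longlonglongrightarrow> 2 * 0" by (intro tendsto_intros)
  then show ?thesis by (simp add: filterlim_sequentially_Suc[of "\<lambda>k. Q (\<Delta> k)"])
qed

lemma D_\<Delta>_uniform:
  assumes "0 < e"
  shows "\<forall>\<^sub>F k in sequentially. \<forall>x. \<bar>D (\<Delta> k) x\<bar> < e"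
proof -
  have "(\<lambda>k. Q (\<Delta> k) * \<rho> 0) \<longlonglongrightarrow> 0 * \<rho> 0" by (intro tendsto_intros Q_\<Delta>_tendsto_0)
  then have "\<forall>\<^sub>F k in sequentially. Q (\<Delta> k) * \<rho> 0 < e\<^sup>2" using assms by (intro order_tendstoD(2)) auto
  then show ?thesis
  proof eventually_elim
    case (elim k)
    have "\<bar>D (\<Delta> k) x\<bar>\<^sup>2 < e\<^sup>2" for x
      using D_le_Q[OF \<Delta>_discrete, of k x] elim by (simp add: power2_abs)
    then show ?case using assms by (meson less_imp_le power_less_imp_less_base)
  qed
qed

text \<open>The residual of a step contains the gradient at the previous iterate \<open>m j\<close>,
  whereas weak-* convergence is known for the new one \<open>n j\<close>. Small steps and uniform
  convergence of \<open>D\<close> make \<open>m j\<close> converge to \<eta> in the seminorm, which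
  is what continuity of F' requires. The conditions of the step then pass to the limit and give
  first-order optimality, hence minimality by convexity.\<close>

lemma limit_point_optimal:
  assumes r: "strict_mono r" and \<eta>: "nonneg_measure \<eta>" and conv: "weak_star_tendsto \<Omega> (\<mu> \<circ> r) \<eta>"
    and \<nu>: "\<nu> \<in> measures_on \<Omega>" "nonneg_measure \<nu>"
  shows "J \<eta> \<le> J \<nu>"
proof -
  obtain C where C: "\<And>k. norm (\<mu> (Suc k)) \<le> C" "0 \<le> C" using norm_bounded by metis
  have \<eta>on: "\<eta> \<in> measures_on \<Omega>" using conv by (simp add: weak_star_tendsto_def)
  \<comment> \<open>The shift by 2 writes the new iterate and its predecessor both with successor
    indices, so that both are nonnegative and bounded by C.\<close>
  define t where "t j = r (Suc (Suc j)) - 2" for j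
  have r2: "r (Suc (Suc j)) = Suc (Suc (t j))" for j
    using seq_suble[OF r, of "Suc (Suc j)"] by (simp add: t_def)
  have tmono: "strict_mono t"
    unfolding strict_mono_Suc_iff using r2 strict_monoD[OF r] by (metis Suc_less_eq lessI)
  define n where "n j = \<mu> (Suc (Suc (t j)))" for j
  have n: "nonneg_measure (n j)" "n j \<in> measures_on \<Omega>" "norm (n j) \<le> C" for j
    unfolding n_def by (rule \<mu>_nonneg, rule \<mu>_on, rule C(1))
  have nconv: "weak_star_tendsto \<Omega> n \<eta>"
    unfolding weak_star_tendsto_def
  proof (intro conjI ballI \<eta>on)
    fix \<phi> assume "\<phi> \<in> C0 \<Omega>"
    then have "(\<lambda>k. P \<phi> (\<mu> (r k))) \<longlonglongrightarrow> P \<phi> \<eta>" using conv by (simp add: weak_star_tendsto_def)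
    from LIMSEQ_ignore_initial_segment[OF this, of 2] show "(\<lambda>k. P \<phi> (n k)) \<longlonglongrightarrow> P \<phi> \<eta>"
      by (simp add: n_def r2)
  qed
  have norm\<eta>: "norm \<eta> \<le> C"
    by (rule LIMSEQ_le_const2[OF weak_star_norm_tendsto[OF n(1,2) \<eta> nconv]]) (use n in auto)
  define m where "m j = \<mu> (Suc (t j))" for j
  have m: "nonneg_measure (m j)" "m j \<in> measures_on \<Omega>" "norm (m j) \<le> C" for j
    unfolding m_def by (rule \<mu>_nonneg, rule \<mu>_on, rule C(1))
  have mn: "\<Delta> (Suc (t j)) = n j - m j" for j by (simp add: \<Delta>_def n_def m_def)
  have tlim: "filterlim (\<lambda>j. Suc (t j)) sequentially sequentially"
    by (rule filterlim_compose[OF filterlim_Suc filterlim_subseq[OF tmono]])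
  have D\<Delta>: "\<forall>\<^sub>F j in sequentially. \<forall>x. \<bar>D (\<Delta> (Suc (t j))) x\<bar> < e" if "0 < e" for e
    by (rule eventually_compose_filterlim[OF D_\<Delta>_uniform[OF that] tlim])
  have Dm: "\<forall>\<^sub>F j in sequentially. \<forall>x\<in>\<Omega>. \<bar>D (m j - \<eta>) x\<bar> < e" if "0 < e" for e
    using D\<Delta>[OF half_gt_zero[OF that]] uniform_convergence_D[OF n \<eta> norm\<eta> nconv half_gt_zero[OF that]]
  proof eventually_elim
    case (elim j)
    show ?case
    proof
      fix x assume "x \<in> \<Omega>"
      then have "\<bar>D (n j) x - D \<eta> x\<bar> < e / 2" "\<bar>D (n j) x - D (m j) x\<bar> < e / 2"
        using elim unfolding mn D_diff by auto
      then show "\<bar>D (m j - \<eta>) x\<bar> < e" unfolding D_diff by linarith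
    qed
  qed
  \<comment> \<open>\<open>m j - \<eta>\<close> need not be discrete, so \<open>Q\<close> is
    estimated by the supremum of \<open>D\<close> over \<Omega> times the masses.\<close>
  have "(\<lambda>j. Q (m j - \<eta>)) \<longlonglongrightarrow> 0"
  proof (rule LIMSEQ_I)
    fix e :: real assume e: "0 < e"
    define e' where "e' = e / (2 * C + 1)"
    have e': "0 < e'" using e C(2) by (simp add: e'_def)
    have "\<forall>\<^sub>F j in sequentially. norm (Q (m j - \<eta>) - 0) < e"
      using Dm[OF e']
    proof eventually_elim
      case (elim j)
      have "\<bar>Q (m j - \<eta>)\<bar> \<le> e' * (norm (m j) + norm \<eta>)"
        unfolding Q_def by (rule pairing_diff_bound[OF m(1,2) \<eta> \<eta>on continuous_D]) (use elim in \<open>simp add: less_imp_le\<close>)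
      also have "\<dots> \<le> e' * (2 * C)" using m(3)[of j] norm\<eta> e' by (intro mult_left_mono) auto
      also have "\<dots> < e" using e C(2) by (simp add: e'_def field_simps)
      finally show ?case by simp
    qed
    then show "\<exists>N. \<forall>j\<ge>N. norm (Q (m j - \<eta>) - 0) < e" by (simp add: eventually_sequentially)
  qed
  \<comment> \<open>\<open>sqrt\<close> is continuous on all of the real line, negative arguments
    included, so the sign of \<open>Q\<close> is immaterial here.\<close>
  then have cn: "(\<lambda>j. conv_norm \<rho> \<Omega> (m j - \<eta>)) \<longlonglongrightarrow> 0"
    unfolding conv_norm_eq using tendsto_real_sqrt by fastforce
  have F'lim: "\<forall>\<^sub>F j in sequentially. \<forall>x\<in>\<Omega>. \<bar>F' (m j) x - F' \<eta> x\<bar> < e" if e: "0 < e" for e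
  proof -
    obtain d where d: "0 < d" "\<And>\<nu>. \<nu> \<in> measures_on \<Omega> \<Longrightarrow> conv_norm \<rho> \<Omega> (\<nu> - \<eta>) < d \<Longrightarrow> \<forall>x\<in>\<Omega>. \<bar>F' \<nu> x - F' \<eta> x\<bar> < e"
      using F'_cont[OF \<eta>on e] by blast
    show ?thesis using order_tendstoD(2)[OF cn d(1)] by eventually_elim (rule d(2)[OF m(2)])
  qed
  \<comment> \<open>The uniform limit of the residuals, whose convolution term tends to
    zero.\<close>
  define g where "g x = \<tau> * (F' \<eta> x + \<alpha>)" for x
  have gc: "continuous_on \<Omega> g" unfolding g_def[abs_def] by (intro continuous_intros continuous_F' \<eta>on)
  have res_lim: "\<forall>\<^sub>F j in sequentially. \<forall>x\<in>\<Omega>. \<bar>res (Suc (t j)) x - g x\<bar> < e" if e: "0 < e" for e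
  proof -
    have e2: "0 < e / (2 * \<tau>)" using e \<tau>(1) by simp
    show ?thesis using F'lim[OF e2] D\<Delta>[OF half_gt_zero[OF e]]
    proof eventually_elim
      case (elim j)
      show ?case
      proof
        fix x assume x: "x \<in> \<Omega>"
        have "\<tau> * \<bar>F' (m j) x - F' \<eta> x\<bar> < \<tau> * (e / (2 * \<tau>))"
          using elim(1) x \<tau>(1) by (intro mult_strict_left_mono) auto
        then have "\<bar>\<tau> * (F' (m j) x - F' \<eta> x)\<bar> < e / 2" using \<tau>(1) by (simp add: abs_mult)
        moreover have "\<bar>D (\<Delta> (Suc (t j))) x\<bar> < e / 2" using elim(2) by blast
        moreover have "res (Suc (t j)) x - g x = \<tau> * (F' (m j) x - F' \<eta> x) + D (\<Delta> (Suc (t j))) x"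
          by (simp add: res_def g_def m_def algebra_simps)
        ultimately show "\<bar>res (Suc (t j)) x - g x\<bar> < e" by linarith
      qed
    qed
  qed
  have \<epsilon>lim: "(\<lambda>j. \<epsilon> (Suc (Suc (t j)))) \<longlonglongrightarrow> 0"
    by (rule filterlim_compose[OF summable_LIMSEQ_zero[OF \<epsilon>(2)] tlim])
  have g_nonneg: "0 \<le> g x" if x: "x \<in> \<Omega>" for x
  proof (rule field_le_epsilon)
    fix e :: real assume e: "0 < e"
    have "\<forall>\<^sub>F j in sequentially. 0 \<le> g x + e"
      using res_lim[OF half_gt_zero[OF e]] order_tendstoD(2)[OF \<epsilon>lim half_gt_zero[OF e]]
    proof eventually_elim
      case (elim j)
      have "\<bar>res (Suc (t j)) x - g x\<bar> < e / 2" using elim(1) x by blast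
      then show ?case using elim(2) res_ge[OF x, of "Suc (t j)"] by linarith
    qed
    then show "0 \<le> g x + e" by simp
  qed
  have "P g \<eta> \<le> 0 + e" if e: "0 < e" for e
  proof -
    define e' where "e' = e / (2 * (C + 1))"
    have e': "0 < e'" using e C(2) by (simp add: e'_def)
    have lim1: "(\<lambda>j. P g (n j)) \<longlonglongrightarrow> P g \<eta>" using nconv gc by (simp add: weak_star_tendsto_def C0_iff)
    have lim2: "(\<lambda>j. \<kappa> * \<epsilon> (Suc (Suc (t j)))) \<longlonglongrightarrow> \<kappa> * 0" by (intro tendsto_intros \<epsilon>lim)
    have "\<forall>\<^sub>F j in sequentially. \<kappa> * \<epsilon> (Suc (Suc (t j))) < e / 2"
      using e by (intro order_tendstoD(2)[OF lim2]) auto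
    then have "\<forall>\<^sub>F j in sequentially. P g (n j) \<le> e"
      using res_lim[OF e']
    proof eventually_elim
      case (elim j)
      have "\<bar>P (\<lambda>x. res (Suc (t j)) x - g x) (n j)\<bar> \<le> e' * norm (n j)"
        by (rule pairing_bound[OF n(1) cpt n(2)]) (use elim in \<open>auto intro!: continuous_on_diff continuous_res gc less_imp_le\<close>)
      also have "\<dots> \<le> e' * C" using n(3) e' by (intro mult_left_mono) auto
      also have "\<dots> \<le> e / 2" using e C(2) by (simp add: e'_def field_simps)
      finally have "P g (n j) \<le> P (res (Suc (t j))) (n j) + e / 2"
        unfolding pairing_diff[OF cpt continuous_res gc] by linarith
      then show ?case using res_pairing[of "Suc (t j)"] elim(1) by (simp add: n_def)
    qed
    then show ?thesis using tendsto_upperbound[OF lim1] by simp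
  qed
  then have g\<eta>: "P g \<eta> \<le> 0" by (rule field_le_epsilon)
  \<comment> \<open>Nonnegativity of g on \<Omega> and \<open>P g \<eta> \<le> 0\<close> act as
    complementary slackness: together they give the variational inequality at \<eta>.\<close>
  have "0 \<le> P g \<nu>" by (rule pairing_nonneg[OF \<nu>(2) cpt gc g_nonneg])
  then have "0 \<le> P g (\<nu> - \<eta>)" using g\<eta> by (simp add: pairing_diff_measure[OF cpt gc])
  also have "P g (\<nu> - \<eta>) = \<tau> * P (\<lambda>x. F' \<eta> x + \<alpha>) (\<nu> - \<eta>)"
    unfolding g_def[abs_def] by (rule pairing_cmult[OF cpt])
  also have "P (\<lambda>x. F' \<eta> x + \<alpha>) (\<nu> - \<eta>) = P (F' \<eta>) (\<nu> - \<eta>) + P (\<lambda>x. \<alpha>) (\<nu> - \<eta>)"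
    by (rule pairing_add[OF cpt continuous_F'[OF \<eta>on] continuous_on_const])
  also have "P (\<lambda>x. \<alpha>) (\<nu> - \<eta>) = \<alpha> * (norm \<nu> - norm \<eta>)"
    by (simp add: pairing_diff_measure[OF cpt continuous_on_const] pairing_const[OF _ cpt] \<nu> \<eta> \<eta>on right_diff_distrib)
  finally have "0 \<le> P (F' \<eta>) (\<nu> - \<eta>) + \<alpha> * (norm \<nu> - norm \<eta>)" using \<tau>(1) by (simp add: zero_le_mult_iff)
  then show ?thesis using gradient_inequality[OF \<eta>on \<nu>(1)] by (simp add: J_def algebra_simps)
qed

section \<open>Existence, subsequences and Opial's argument\<close>

definition sol :: "'a radon set" where
  "sol = {\<mu>'. weak_star_limit_point \<Omega> \<mu> \<mu>' \<and>
                    (\<lambda>x. 0) \<in> pre_subdiff \<Omega> (\<lambda>\<nu>. ereal (F \<nu>) + reg_G \<alpha> \<nu>) \<mu>'}"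

lemma sol_iff:
  "\<eta> \<in> sol \<longleftrightarrow> weak_star_limit_point \<Omega> \<mu> \<eta> \<and> nonneg_measure \<eta> \<and>
    (\<forall>\<nu>\<in>measures_on \<Omega>. nonneg_measure \<nu> \<longrightarrow> J \<eta> \<le> J \<nu>)"
  using \<alpha> by (simp add: sol_def zero_in_pre_subdiff_iff J_def)

text \<open>Stated for an arbitrary subsequence s: the identity gives existence, and a subsequence
  avoiding the candidate limit gives convergence of the whole sequence when the solution is
  unique.\<close>

lemma subsequence_in_sol:
  assumes s: "strict_mono (s :: nat \<Rightarrow> nat)"
  obtains r \<eta> where "strict_mono (r :: nat \<Rightarrow> nat)" "weak_star_tendsto \<Omega> (\<mu> \<circ> (s \<circ> r)) \<eta>" "\<eta> \<in> sol"
proof -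
  obtain C where C: "\<And>k. norm (\<mu> (Suc k)) \<le> C" "0 \<le> C" using norm_bounded by metis
  \<comment> \<open>The first term of the subsequence may be \<mu>^0, which need not be nonnegative;
    from the second term on the index is a successor.\<close>
  have s1: "\<exists>l. s (Suc k) = Suc l" for k
    using seq_suble[OF s, of "Suc k"] by (cases "s (Suc k)") auto
  have n: "nonneg_measure ((\<mu> \<circ> s \<circ> Suc) k)" "(\<mu> \<circ> s \<circ> Suc) k \<in> measures_on \<Omega>" "norm ((\<mu> \<circ> s \<circ> Suc) k) \<le> C" for k
    using s1[of k] by (auto simp: \<mu>_nonneg \<mu>_on C)
  obtain r \<eta> where r: "strict_mono r" "nonneg_measure \<eta>" "weak_star_tendsto \<Omega> ((\<mu> \<circ> s \<circ> Suc) \<circ> r) \<eta>"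
    by (rule weak_star_compact[OF cpt n(2) n(1) n(3)])
  have sr: "strict_mono (Suc \<circ> r)" using r(1) by (simp add: strict_mono_def)
  have eq: "(\<mu> \<circ> s \<circ> Suc) \<circ> r = \<mu> \<circ> (s \<circ> (Suc \<circ> r))" by (simp add: comp_def)
  have ssr: "strict_mono (s \<circ> (Suc \<circ> r))" by (rule strict_mono_o[OF s sr])
  have "\<eta> \<in> sol"
    unfolding sol_iff weak_star_limit_point_def
    using r limit_point_optimal[OF ssr r(2)] ssr unfolding eq by blast
  then show thesis using that[OF sr] r(3) unfolding eq by blast
qed

lemma sol_nonempty: "sol \<noteq> {}"
proof -
  have "strict_mono (id :: nat \<Rightarrow> nat)" by (rule strict_mono_id)
  then obtain r \<eta> where "strict_mono r" "weak_star_tendsto \<Omega> (\<mu> \<circ> (id \<circ> r)) \<eta>" "\<eta> \<in> sol"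
    by (rule subsequence_in_sol)
  then show ?thesis by blast
qed

text \<open>If some test function stayed away from its limit along a subsequence, a further
  subsequence would converge to an element of \<open>sol\<close>, hence to \<eta>, a
  contradiction.\<close>

lemma sol_singleton_convergence:
  assumes "sol = {\<eta>}"
  shows "weak_star_tendsto \<Omega> \<mu> \<eta>"
  unfolding weak_star_tendsto_def
proof (intro conjI ballI)
  show "\<eta> \<in> measures_on \<Omega>"
    using assms by (auto simp: sol_iff weak_star_limit_point_def weak_star_tendsto_def dest: equalityD2)
  fix \<phi> assume \<phi>: "\<phi> \<in> C0 \<Omega>"
  show "(\<lambda>k. P \<phi> (\<mu> k)) \<longlonglongrightarrow> P \<phi> \<eta>"
  proof (rule ccontr)
    assume "\<not> (\<lambda>k. P \<phi> (\<mu> k)) \<longlonglongrightarrow> P \<phi> \<eta>"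
    then obtain e where e: "0 < e" "\<And>N. \<exists>k\<ge>N. e \<le> dist (P \<phi> (\<mu> k)) (P \<phi> \<eta>)"
      unfolding lim_sequentially by (auto simp: not_less)
    let ?S = "{k. e \<le> dist (P \<phi> (\<mu> k)) (P \<phi> \<eta>)}"
    have inf: "infinite ?S" unfolding infinite_nat_iff_unbounded_le using e(2) by auto
    obtain s :: "nat \<Rightarrow> nat" where s: "strict_mono s" "\<forall>n. s n \<in> ?S"
      using infinite_enumerate[OF inf] by blast
    obtain r \<eta>' where r: "strict_mono r" "weak_star_tendsto \<Omega> (\<mu> \<circ> (s \<circ> r)) \<eta>'" "\<eta>' \<in> sol"
      by (rule subsequence_in_sol[OF s(1)])
    have "(\<lambda>k. P \<phi> (\<mu> (s (r k)))) \<longlonglongrightarrow> P \<phi> \<eta>"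
      using r(2,3) assms \<phi> by (simp add: weak_star_tendsto_def)
    then obtain k where "dist (P \<phi> (\<mu> (s (r k)))) (P \<phi> \<eta>) < e"
      using e(1) unfolding lim_sequentially by blast
    then show False using s(2)[rule_format, of "r k"] by simp
  qed
qed

text \<open>For each solution \<nu>, \<open>Q (\<mu> k - \<nu>)\<close> converges. The difference of
  these values for two solutions is affine in \<mu>^k with linear part given by
  \<open>D \<sigma>\<close>, so \<open>P (D \<sigma>) (\<mu> k)\<close> converges along the whole
  sequence. Its limit can be evaluated along the subsequences of both solutions, and the two values
  differ by \<open>Q \<sigma>\<close>.\<close>

lemma Q_zero_sol:
  assumes "\<mu>1 \<in> sol" "\<mu>2 \<in> sol"
  shows "Q (\<mu>1 - \<mu>2) = 0"
proof -
  obtain C where C: "\<And>k. norm (\<mu> (Suc k)) \<le> C" "0 \<le> C" using norm_bounded by metis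
  have on: "\<nu> \<in> measures_on \<Omega>" if "\<nu> \<in> sol" for \<nu>
    using that by (auto simp: sol_iff weak_star_limit_point_def weak_star_tendsto_def)
  have conv: "convergent (\<lambda>k. Q (\<mu> (Suc k) - \<nu>))" if \<nu>: "\<nu> \<in> sol" for \<nu>
  proof (rule quasi_decreasing_convergent[where c = "\<lambda>k. 2 * (\<epsilon> (Suc (Suc k)) * (\<kappa> + norm \<nu>))" and b = "- (B * (C + norm \<nu>)\<^sup>2)"])
    have nn: "nonneg_measure \<nu>" using \<nu> by (simp add: sol_iff)
    show "Q (\<mu> (Suc (Suc k)) - \<nu>) \<le> Q (\<mu> (Suc k) - \<nu>) + 2 * (\<epsilon> (Suc (Suc k)) * (\<kappa> + norm \<nu>))" for k
      by (rule quasi_Fejer[OF on[OF \<nu>] nn]) (use \<nu> \<mu>_on \<mu>_nonneg in \<open>auto simp: sol_iff\<close>)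
    show "0 \<le> 2 * (\<epsilon> (Suc (Suc k)) * (\<kappa> + norm \<nu>))" for k
      using \<epsilon>(1) \<kappa> by (simp add: less_imp_le)
    have "summable (\<lambda>k. \<epsilon> (Suc (Suc k)))" using \<epsilon>(2) summable_Suc_iff[of "\<lambda>k. \<epsilon> (Suc k)"] by simp
    then show "summable (\<lambda>k. 2 * (\<epsilon> (Suc (Suc k)) * (\<kappa> + norm \<nu>)))" by (intro summable_mult summable_mult2)
    show "- (B * (C + norm \<nu>)\<^sup>2) \<le> Q (\<mu> (Suc k) - \<nu>)" for k
    proof -
      have "B * (norm (\<mu> (Suc k)) + norm \<nu>)\<^sup>2 \<le> B * (C + norm \<nu>)\<^sup>2"
        using C B_nonneg by (intro mult_left_mono power_mono add_mono) auto
      then show ?thesis using Q_diff_bound[OF \<mu>_nonneg \<mu>_on nn on[OF \<nu>], of k] by linarith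
    qed
  qed
  define \<sigma> where "\<sigma> = \<mu>1 - \<mu>2"
  have "P (D \<sigma>) (\<mu> k) = (Q (\<mu> k - \<mu>2) - Q (\<mu> k - \<mu>1) + Q \<mu>1 - Q \<mu>2) / 2" for k
    using P_D_commute[OF \<mu>_discrete, of k \<mu>1] P_D_commute[OF \<mu>_discrete, of k \<mu>2]
    unfolding \<sigma>_def Q_def by (simp add: P_D_diff P_diff)
  moreover have "convergent (\<lambda>k. (Q (\<mu> (Suc k) - \<mu>2) - Q (\<mu> (Suc k) - \<mu>1) + Q \<mu>1 - Q \<mu>2) / 2)"
  proof -
    obtain l1 l2 where "(\<lambda>k. Q (\<mu> (Suc k) - \<mu>1)) \<longlonglongrightarrow> l1" "(\<lambda>k. Q (\<mu> (Suc k) - \<mu>2)) \<longlonglongrightarrow> l2"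
      using conv assms unfolding convergent_def by blast
    then have "(\<lambda>k. (Q (\<mu> (Suc k) - \<mu>2) - Q (\<mu> (Suc k) - \<mu>1) + Q \<mu>1 - Q \<mu>2) / 2) \<longlonglongrightarrow> (l2 - l1 + Q \<mu>1 - Q \<mu>2) / 2"
      by (intro tendsto_intros) auto
    then show ?thesis by (rule convergentI)
  qed
  ultimately obtain l where "(\<lambda>k. P (D \<sigma>) (\<mu> (Suc k))) \<longlonglongrightarrow> l" unfolding convergent_def by auto
  then have l: "(\<lambda>k. P (D \<sigma>) (\<mu> k)) \<longlonglongrightarrow> l" by (simp add: filterlim_sequentially_Suc[of "\<lambda>k. P (D \<sigma>) (\<mu> k)"])
  have "P (D \<sigma>) \<nu> = l" if \<nu>: "\<nu> \<in> sol" for \<nu>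
  proof -
    obtain r where r: "strict_mono r" "weak_star_tendsto \<Omega> (\<mu> \<circ> r) \<nu>"
      using \<nu> unfolding sol_iff weak_star_limit_point_def by blast
    then have "(\<lambda>k. P (D \<sigma>) (\<mu> (r k))) \<longlonglongrightarrow> P (D \<sigma>) \<nu>"
      using continuous_D by (simp add: weak_star_tendsto_def C0_iff)
    moreover have "(\<lambda>k. P (D \<sigma>) (\<mu> (r k))) \<longlonglongrightarrow> l"
      using LIMSEQ_subseq_LIMSEQ[OF l r(1)] by (simp add: comp_def)
    ultimately show ?thesis by (rule LIMSEQ_unique)
  qed
  then show ?thesis using assms by (simp add: Q_def P_diff \<sigma>_def[symmetric]) (simp add: \<sigma>_def P_diff)
qed

end

section \<open>The case of a fundamental family of translates\<close>

lemma C0_UNIV_bounded: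
  fixes \<phi> :: "'a::euclidean_space \<Rightarrow> real"
  assumes "\<phi> \<in> C0 UNIV"
  obtains B where "\<forall>x. \<bar>\<phi> x\<bar> \<le> B"
proof -
  obtain K where K: "compact K" "\<And>x. x \<notin> K \<Longrightarrow> \<bar>\<phi> x\<bar> < 1"
    using assms by (auto simp: C0_def dest!: spec[of _ "1::real"])
  have "continuous_on K \<phi>" using assms by (auto simp: C0_def intro: continuous_on_subset[of UNIV])
  then have "bounded (\<phi> ` K)" using K(1) by (intro compact_imp_bounded compact_continuous_image)
  then obtain b where b: "\<And>x. x \<in> K \<Longrightarrow> \<bar>\<phi> x\<bar> \<le> b"
    unfolding bounded_iff by auto
  have "\<bar>\<phi> x\<bar> \<le> max b 1" for x using K(2)[of x] b[of x] by (cases "x \<in> K") auto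
  then show thesis using that by blast
qed

lemma C0_UNIV_continuous: "\<phi> \<in> C0 UNIV \<Longrightarrow> continuous_on UNIV \<phi>"
  by (simp add: C0_def)

section \<open>Correlation of a finite measure with a square-integrable function\<close>

context
  fixes M :: "'a::euclidean_space measure" and \<Omega> :: "'a set" and h :: "'a \<Rightarrow> real"
  assumes fin: "finite_measure M" and sM: "sets M = sets borel" and cpt: "compact \<Omega>"
    and hL: "h \<in> L2"
begin

text \<open>Cauchy-Schwarz against the finite measure M puts the square inside the integral. After
  exchanging the integrals, translation invariance makes the inner one independent of w.\<close>

lemma translate_average_L2: "(\<lambda>t. LINT w:\<Omega>|M. h (t + w)) \<in> L2"
proof -
  interpret M: finite_measure M by (rule fin)
  interpret pair_sigma_finite M lborel by unfold_locales
  note sM [measurable_cong]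
  have [measurable]: "h \<in> borel_measurable borel" by (rule L2_measurable[OF hL])
  have [measurable]: "\<Omega> \<in> sets borel" by (rule borel_compact[OF cpt])
  have m [measurable]: "(\<lambda>t. LINT w:\<Omega>|M. h (t + w)) \<in> borel_measurable borel"
    unfolding set_lebesgue_integral_def by measurable
  define c where "c = (\<integral>\<^sup>+ x. ennreal ((h x)\<^sup>2) \<partial>lborel)"
  have c: "c < \<infinity>" using hL unfolding L2_real_iff c_def by (auto simp: integrable_iff_bounded)
  have shift: "(\<integral>\<^sup>+ t. ennreal ((h (t + w))\<^sup>2) \<partial>lborel) = c" for w
    unfolding c_def by (subst (2) lborel_distr_plus[symmetric, of w]) (simp add: nn_integral_distr add.commute)
  have "(\<integral>\<^sup>+ t. ennreal ((LINT w:\<Omega>|M. h (t + w))\<^sup>2) \<partial>lborel)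
    \<le> (\<integral>\<^sup>+ t. (\<integral>\<^sup>+ w. ennreal ((h (t + w))\<^sup>2) \<partial>M) * emeasure M (space M) \<partial>lborel)"
  proof (rule nn_integral_mono)
    fix t
    have "ennreal \<bar>LINT w:\<Omega>|M. h (t + w)\<bar> \<le> (\<integral>\<^sup>+ w. ennreal \<bar>h (t + w)\<bar> * 1 \<partial>M)"
    \<comment> \<open>If the integrand is not integrable, its Bochner integral is 0 and the bound is
      trivial.\<close>
    proof (cases "integrable M (\<lambda>w. indicator \<Omega> w *\<^sub>R h (t + w))")
      case True
      have "ennreal \<bar>LINT w:\<Omega>|M. h (t + w)\<bar> \<le> (\<integral>\<^sup>+ w. ennreal (norm (indicator \<Omega> w *\<^sub>R h (t + w))) \<partial>M)"
        unfolding set_lebesgue_integral_def using integral_norm_bound_ennreal[OF True] by simp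
      also have "\<dots> \<le> (\<integral>\<^sup>+ w. ennreal \<bar>h (t + w)\<bar> * 1 \<partial>M)"
        by (rule nn_integral_mono) (auto simp: indicator_def)
      finally show ?thesis .
    qed (simp add: set_lebesgue_integral_def not_integrable_integral_eq)
    then have "(ennreal \<bar>LINT w:\<Omega>|M. h (t + w)\<bar>)\<^sup>2 \<le> (\<integral>\<^sup>+ w. ennreal \<bar>h (t + w)\<bar> * 1 \<partial>M)\<^sup>2"
      by (rule power_mono) simp
    also have "\<dots> \<le> (\<integral>\<^sup>+ w. (ennreal \<bar>h (t + w)\<bar>)\<^sup>2 \<partial>M) * (\<integral>\<^sup>+ w. 1\<^sup>2 \<partial>M)"
      by (rule Cauchy_Schwarz_nn_integral) auto
    finally show "ennreal ((LINT w:\<Omega>|M. h (t + w))\<^sup>2) \<le> (\<integral>\<^sup>+ w. ennreal ((h (t + w))\<^sup>2) \<partial>M) * emeasure M (space M)"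
      by (simp add: ennreal_power)
  qed
  also have "\<dots> = (\<integral>\<^sup>+ t. (\<integral>\<^sup>+ w. ennreal ((h (t + w))\<^sup>2) \<partial>M) \<partial>lborel) * emeasure M (space M)"
    by (rule nn_integral_multc) measurable
  also have "(\<integral>\<^sup>+ t. (\<integral>\<^sup>+ w. ennreal ((h (t + w))\<^sup>2) \<partial>M) \<partial>lborel) = (\<integral>\<^sup>+ w. (\<integral>\<^sup>+ t. ennreal ((h (t + w))\<^sup>2) \<partial>lborel) \<partial>M)"
    by (rule Fubini') measurable
  also have "\<dots> * emeasure M (space M) < \<infinity>"
  proof -
    have "emeasure M (space M) < \<top>" unfolding less_top[symmetric] by (rule M.emeasure_finite)
    then show ?thesis unfolding shift using c by (simp add: ennreal_mult_less_top)
  qed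
  finally have "(\<integral>\<^sup>+ t. ennreal ((LINT w:\<Omega>|M. h (t + w))\<^sup>2) \<partial>lborel) < \<infinity>" .
  then show ?thesis using m by (simp add: L2_real_iff integrable_iff_bounded)
qed

text \<open>The inner integral of absolute values is bounded uniformly in w by Cauchy-Schwarz, and M
  is finite, so Fubini applies.\<close>

lemma translate_average_convolution:
  fixes f :: "'a \<Rightarrow> real"
  assumes fL: "f \<in> L2"
  shows "(LINT t|lborel. f (x - t) * (LINT w:\<Omega>|M. h (t + w))) = (LINT w:\<Omega>|M. (LINT t|lborel. f (x - t) * h (t + w)))"
proof -
  interpret M: finite_measure M by (rule fin)
  interpret pair_sigma_finite M lborel by unfold_locales
  note sM [measurable_cong]
  have [measurable]: "h \<in> borel_measurable borel" "f \<in> borel_measurable borel"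
    by (rule L2_measurable[OF hL], rule L2_measurable[OF fL])
  have [measurable]: "\<Omega> \<in> sets borel" by (rule borel_compact[OF cpt])
  have hw: "(\<lambda>t. h (t + w)) \<in> L2" for w using L2_translate[OF hL, of "- w"] by simp
  have fx: "(\<lambda>t. f (x - t)) \<in> L2" by (rule L2_reflect[OF fL])
  have abs: "(\<lambda>t. \<bar>g t\<bar>) \<in> L2" if "g \<in> L2" for g :: "'a \<Rightarrow> real" using that by (auto simp: L2_real_iff)
  let ?K = "\<lambda>(w, t). indicator \<Omega> w * (f (x - t) * h (t + w))"
  let ?C = "sqrt (ip f f) * sqrt (ip h h)"
  have bd: "(LINT t|lborel. \<bar>f (x - t)\<bar> * \<bar>h (t + w)\<bar>) \<le> ?C" for w
    using ip_Cauchy_Schwarz_sqrt[OF abs[OF fx] abs[OF hw, of w]] ip_reflect[OF fL fL, of x] ip_translate[OF hL hL, of "- w"]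
    by (simp add: ip_def)
  have i: "integrable (M \<Otimes>\<^sub>M lborel) ?K"
  proof (rule Fubini_integrable)
    show "?K \<in> borel_measurable (M \<Otimes>\<^sub>M lborel)" by measurable
    have eq: "(LINT t|lborel. norm (?K (w, t))) = indicator \<Omega> w * (LINT t|lborel. \<bar>f (x - t)\<bar> * \<bar>h (t + w)\<bar>)" for w
      by (simp add: abs_mult)
    show "integrable M (\<lambda>w. LINT t|lborel. norm (?K (w, t)))"
      unfolding eq
    proof (rule M.integrable_const_bound[of _ ?C])
      have nn: "0 \<le> (LINT t|lborel. \<bar>f (x - t)\<bar> * \<bar>h (t + w)\<bar>)" for w
        by (rule Bochner_Integration.integral_nonneg) simp
      show "AE w in M. norm (indicator \<Omega> w * (LINT t|lborel. \<bar>f (x - t)\<bar> * \<bar>h (t + w)\<bar>)) \<le> ?C"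
        using bd nn by (intro AE_I2) (auto simp: indicator_def ip_nonneg)
    qed measurable
    show "AE w in M. integrable lborel (\<lambda>t. ?K (w, t))"
      using L2_mult_integrable[OF fx hw] by simp
  qed
  have "(LINT t|lborel. f (x - t) * (LINT w:\<Omega>|M. h (t + w))) = (LINT t|lborel. (LINT w|M. indicator \<Omega> w * (f (x - t) * h (t + w))))"
  proof (rule Bochner_Integration.integral_cong[OF refl])
    fix t
    show "f (x - t) * (LINT w:\<Omega>|M. h (t + w)) = (LINT w|M. indicator \<Omega> w * (f (x - t) * h (t + w)))"
      unfolding set_lebesgue_integral_def
      by (subst integral_mult_right_zero[symmetric]) (simp add: mult.left_commute)
  qed
  also have "\<dots> = (LINT w|M. (LINT t|lborel. indicator \<Omega> w * (f (x - t) * h (t + w))))"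
    by (rule Fubini_integral[OF i])
  finally show ?thesis unfolding set_lebesgue_integral_def by simp
qed

end

section \<open>Injectivity of the operator on nonnegative measures\<close>

context convolution_kernel
begin

text \<open>Let a be the correlation of \<sigma> with \<open>\<rho>h\<close>. Exchanging integrals,
  the convolution of \<open>\<rho>h\<close> with a is the correlation of \<sigma> with \<rho>, a
  reflection of \<open>D \<sigma>\<close>, hence zero on the whole space. Exchanging once more, the
  convolution of a with itself is a correlation of \<sigma> with that zero function. So a vanishes,
  and its values are the pairings of \<sigma> with the translates of \<open>\<rho>h\<close>.\<close>

lemma fundamental_translates_injective:
  assumes hL: "\<rho>h \<in> L2" and hC: "\<rho>h \<in> C0 UNIV" and conv: "\<And>x. \<rho> x = fun_convolution \<rho>h \<rho>h x"
    and fund: "fundamental_C0 \<Omega> (translates \<rho>h \<Omega>)"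
    and \<mu>1: "nonneg_measure \<mu>1" "\<mu>1 \<in> measures_on \<Omega>" and \<mu>2: "nonneg_measure \<mu>2" "\<mu>2 \<in> measures_on \<Omega>"
    and zero: "\<And>z. D (\<mu>1 - \<mu>2) z = 0"
  shows "\<mu>1 = \<mu>2"
proof -
  define \<sigma> where "\<sigma> = \<mu>1 - \<mu>2"
  define a where "a t = P (\<lambda>w. \<rho>h (t + w)) \<sigma>" for t
  obtain Bh where Bh: "\<forall>x. \<bar>\<rho>h x\<bar> \<le> Bh" by (rule C0_UNIV_bounded[OF hC])
  have hc: "continuous_on UNIV \<rho>h" by (rule C0_UNIV_continuous[OF hC])
  have hmeas: "\<rho>h \<in> borel_measurable borel" by (rule L2_measurable[OF hL])
  have ac: "continuous_on UNIV a"
    unfolding a_def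
    by (rule continuous_on_pairing_parameter[OF cpt, of _ Bh])
      (use Bh in \<open>auto intro!: continuous_on_compose2[OF hc] continuous_intros\<close>)
  have parts: "(\<lambda>t. LINT w:\<Omega>|pos_part \<nu>. \<rho>h (t + w)) \<in> L2" for \<nu>
    by (rule translate_average_L2[OF finite_measure_pos_part sets_pos_part cpt hL])
  have aL: "a \<in> L2"
    unfolding a_def[abs_def] pairing_def by (rule L2_diff[OF parts parts])
  have conv_a: "(LINT t|lborel. f (x - t) * a t) = P (\<lambda>w. LINT t|lborel. f (x - t) * \<rho>h (t + w)) \<sigma>"
    if f: "f \<in> L2" for f x
    unfolding a_def pairing_def right_diff_distrib
      translate_average_convolution[OF finite_measure_pos_part sets_pos_part cpt hL f, symmetric]
    by (rule Bochner_Integration.integral_diff[OF L2_mult_integrable[OF L2_reflect[OF f] parts] L2_mult_integrable[OF L2_reflect[OF f] parts]])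
  have shift: "(LINT t|lborel. f (x - t) * \<rho>h (t + w)) = (LINT s|lborel. \<rho>h (x + w - s) * f s)" if f: "f \<in> L2" for f x w
  proof -
    have "\<rho>h \<in> borel_measurable borel" "f \<in> borel_measurable borel" using hmeas L2_measurable[OF f] by auto
    then have "(\<lambda>t. f (x - t) * \<rho>h (t + w)) \<in> borel_measurable borel" by measurable
    from lborel_affine_integral(2)[OF _ this, of "-1" x] show ?thesis by (simp add: algebra_simps)
  qed
  have h_a: "(LINT t|lborel. \<rho>h (x - t) * a t) = 0" for x
  proof -
    have "(LINT t|lborel. \<rho>h (x - t) * a t) = P (\<lambda>w. \<rho> (x + w)) \<sigma>"
      unfolding conv_a[OF hL] shift[OF hL] conv fun_convolution_def ..
    also have "\<dots> = D \<sigma> (- x)"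
      unfolding conv_op_def
    proof (rule pairing_cong[OF cpt])
      show "\<rho> (x + w) = \<rho> (- x - w)" for w using \<rho>_even[of "x + w"] by simp
    qed
    finally show ?thesis using zero by (simp add: \<sigma>_def)
  qed
  have "(LINT t|lborel. a (x - t) * a t) = 0" for x
    unfolding conv_a[OF aL] shift[OF aL] h_a by (simp add: pairing_def set_lebesgue_integral_def)
  then have a0: "a z = 0" for z by (rule selfconv_zero_imp_zero[OF aL ac])
  have on: "\<sigma> \<in> measures_on \<Omega>" unfolding \<sigma>_def by (rule measures_on_diff[OF \<mu>1(2) \<mu>2(2)])
  have "P \<phi> \<sigma> = 0" if \<phi>: "continuous_on \<Omega> \<phi>" for \<phi>
  proof -
    have "\<bar>P \<phi> \<sigma>\<bar> \<le> 0 + e" if e: "0 < e" for e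
    proof -
      define e' where "e' = e / (norm \<mu>1 + norm \<mu>2 + 1)"
      have npos: "0 < norm \<mu>1 + norm \<mu>2 + 1" by (simp add: add_nonneg_pos)
      have e': "0 < e'" using e npos by (simp add: e'_def)
      obtain S c where S: "finite S" "S \<subseteq> translates \<rho>h \<Omega>" "\<And>x. x \<in> \<Omega> \<Longrightarrow> \<bar>\<phi> x - (\<Sum>f\<in>S. c f * f x)\<bar> < e'"
      proof -
        have "\<phi> \<in> C0 \<Omega>" using \<phi> by (simp add: C0_iff)
        then have "\<exists>S c. finite S \<and> S \<subseteq> translates \<rho>h \<Omega> \<and> (\<forall>x\<in>\<Omega>. \<bar>\<phi> x - (\<Sum>f\<in>S. c f * f x)\<bar> < e')"
          using fund e' unfolding fundamental_C0_def by blast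
        then show thesis using that by blast
      qed
      have Sc: "continuous_on \<Omega> f" and S0: "P f \<sigma> = 0" if fS: "f \<in> S" for f
      proof -
        obtain y where f: "f = (\<lambda>x. \<rho>h (x - y))" using S(2) fS by (auto simp: translates_def)
        show "continuous_on \<Omega> f" unfolding f by (rule continuous_on_compose2[OF hc]) (auto intro!: continuous_intros)
        \<comment> \<open>The pairing with the translate by y is the value of a at -y, which
          explains why a has to vanish outside \<Omega> too.\<close>
        show "P f \<sigma> = 0" using a0[of "- y"] unfolding f a_def by simp
      qed
      have cs: "continuous_on \<Omega> (\<lambda>x. \<Sum>f\<in>S. c f * f x)" by (intro continuous_intros Sc)
      have "P (\<lambda>x. \<Sum>f\<in>S. c f * f x) \<sigma> = (\<Sum>f\<in>S. P (\<lambda>x. c f * f x) \<sigma>)"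
        by (rule pairing_sum[OF cpt S(1)]) (intro continuous_intros Sc)
      also have "\<dots> = 0" by (rule sum.neutral) (simp add: pairing_cmult[OF cpt] S0)
      finally have "P \<phi> \<sigma> = P (\<lambda>x. \<phi> x - (\<Sum>f\<in>S. c f * f x)) \<sigma>"
        by (simp add: pairing_diff[OF cpt \<phi> cs])
      also have "\<bar>\<dots>\<bar> \<le> e' * (norm \<mu>1 + norm \<mu>2)"
        unfolding \<sigma>_def
        by (rule pairing_diff_bound[OF \<mu>1 \<mu>2]) (use S(3) in \<open>auto intro!: continuous_on_diff \<phi> cs less_imp_le\<close>)
      also have "\<dots> \<le> e" using e npos by (simp add: e'_def field_simps)
      finally show ?thesis by simp
    qed
    then have "\<bar>P \<phi> \<sigma>\<bar> \<le> 0" by (rule field_le_epsilon)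
    then show ?thesis by simp
  qed
  then have "\<sigma> = 0" by (rule pairing_eq_0_imp_zero[OF cpt on])
  then show ?thesis by (simp add: \<sigma>_def)
qed

end

section \<open>Uniqueness of the optimal limit point\<close>

context forward_backward
begin

text \<open>\<open>D_le_Q\<close> holds for discrete measures, which \<mu>1 and \<mu>2 need not be.
  Both are therefore approximated by iterates x and y: \<open>Q (x k - y k)\<close> tends to
  \<open>Q \<sigma>\<close>, which is 0, while \<open>D (x k - y k) z\<close> tends to
  \<open>D \<sigma> z\<close>.\<close>

lemma D_zero_sol:
  assumes s1: "\<mu>1 \<in> sol" and s2: "\<mu>2 \<in> sol"
  shows "D (\<mu>1 - \<mu>2) z = 0"
proof -
  define \<sigma> where "\<sigma> = \<mu>1 - \<mu>2"
  obtain C where C: "\<And>k. norm (\<mu> (Suc k)) \<le> C" "0 \<le> C" using norm_bounded by metis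
  have sub: "\<exists>n. (\<forall>k. nonneg_measure (n k) \<and> n k \<in> discrete_measures \<Omega> \<and> norm (n k) \<le> C) \<and> weak_star_tendsto \<Omega> n \<nu> \<and> norm \<nu> \<le> C"
    if \<nu>: "\<nu> \<in> sol" for \<nu>
  proof -
    obtain r where r: "strict_mono r" "weak_star_tendsto \<Omega> (\<mu> \<circ> r) \<nu>"
      using \<nu> unfolding sol_iff weak_star_limit_point_def by blast
    have nn: "nonneg_measure \<nu>" using \<nu> by (simp add: sol_iff)
    \<comment> \<open>Dropping the first term ensures a successor index, hence nonnegativity and the
      mass bound.\<close>
    define n where "n k = \<mu> (r (Suc k))" for k
    have n: "nonneg_measure (n k)" "n k \<in> discrete_measures \<Omega>" "norm (n k) \<le> C" for k
    proof -
      obtain l where "r (Suc k) = Suc l" using seq_suble[OF r(1), of "Suc k"] by (cases "r (Suc k)") auto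
      then show "nonneg_measure (n k)" "n k \<in> discrete_measures \<Omega>" "norm (n k) \<le> C"
        using \<mu>_nonneg \<mu>_discrete C(1) by (auto simp: n_def)
    qed
    have nw: "weak_star_tendsto \<Omega> n \<nu>"
      using r(2) LIMSEQ_Suc unfolding weak_star_tendsto_def n_def comp_def by blast
    have "norm \<nu> \<le> C"
      by (rule LIMSEQ_le_const2[OF weak_star_norm_tendsto[OF n(1) _ nn nw]])
        (use n discrete_subset_measures_on in blast)+
    then show ?thesis using n nw by blast
  qed
  obtain x where x: "\<And>k. nonneg_measure (x k)" "\<And>k. x k \<in> discrete_measures \<Omega>" "\<And>k. norm (x k) \<le> C"
    and xw: "weak_star_tendsto \<Omega> x \<mu>1" and n1: "norm \<mu>1 \<le> C" using sub[OF s1] by blast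
  obtain y where y: "\<And>k. nonneg_measure (y k)" "\<And>k. y k \<in> discrete_measures \<Omega>" "\<And>k. norm (y k) \<le> C"
    and yw: "weak_star_tendsto \<Omega> y \<mu>2" and n2: "norm \<mu>2 \<le> C" using sub[OF s2] by blast
  have xon: "x k \<in> measures_on \<Omega>" and yon: "y k \<in> measures_on \<Omega>" for k
    using x(2) y(2) discrete_subset_measures_on by blast+
  have nn1: "nonneg_measure \<mu>1" and nn2: "nonneg_measure \<mu>2" using s1 s2 by (simp_all add: sol_iff)
  have conv: "(\<lambda>k. P \<phi> (x k - y k)) \<longlonglongrightarrow> P \<phi> \<sigma>" if "continuous_on \<Omega> \<phi>" for \<phi>
  proof -
    have "(\<lambda>k. P \<phi> (x k)) \<longlonglongrightarrow> P \<phi> \<mu>1" "(\<lambda>k. P \<phi> (y k)) \<longlonglongrightarrow> P \<phi> \<mu>2"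
      using xw yw that by (auto simp: weak_star_tendsto_def C0_iff)
    then show ?thesis unfolding \<sigma>_def pairing_diff_measure[OF cpt that] by (rule tendsto_diff)
  qed
  \<comment> \<open>\<open>Q (x k - y k)\<close> involves two varying arguments. Replacing the first
    by \<sigma> costs little, because \<open>D\<close> converges uniformly and the masses are
    bounded; what remains is a weak-* limit against the fixed function
    \<open>D \<sigma>\<close>.\<close>
  have diff0: "(\<lambda>k. P (D (x k - y k)) (x k - y k) - P (D \<sigma>) (x k - y k)) \<longlonglongrightarrow> 0"
  proof (rule LIMSEQ_I)
    fix e :: real assume e: "0 < e"
    define e' where "e' = e / (4 * C + 1)"
    have e': "0 < e'" using e C(2) by (simp add: e'_def)
    have "\<forall>\<^sub>F k in sequentially. norm (P (D (x k - y k)) (x k - y k) - P (D \<sigma>) (x k - y k) - 0) < e"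
      using uniform_convergence_D[OF x(1) xon x(3) nn1 n1 xw e'] uniform_convergence_D[OF y(1) yon y(3) nn2 n2 yw e']
    proof eventually_elim
      case (elim k)
      have "\<bar>D (x k - y k) v - D \<sigma> v\<bar> \<le> 2 * e'" if "v \<in> \<Omega>" for v
        using elim(1)[rule_format, OF that] elim(2)[rule_format, OF that] unfolding \<sigma>_def D_diff by linarith
      then have "\<bar>P (\<lambda>v. D (x k - y k) v - D \<sigma> v) (x k - y k)\<bar> \<le> 2 * e' * (norm (x k) + norm (y k))"
        by (intro pairing_diff_bound[OF x(1) xon y(1) yon] continuous_on_diff continuous_D)
      also have "\<dots> \<le> 2 * e' * (C + C)" using x(3) y(3) e' by (intro mult_left_mono add_mono) auto
      also have "\<dots> < e" using e C(2) by (simp add: e'_def field_simps)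
      finally show ?case by (simp add: pairing_diff[OF cpt continuous_D continuous_D])
    qed
    then show "\<exists>N. \<forall>k\<ge>N. norm (P (D (x k - y k)) (x k - y k) - P (D \<sigma>) (x k - y k) - 0) < e"
      by (simp add: eventually_sequentially)
  qed
  have "P (D \<sigma>) \<sigma> = 0" using Q_zero_sol[OF s1 s2] by (simp add: Q_def \<sigma>_def)
  then have "(\<lambda>k. (P (D (x k - y k)) (x k - y k) - P (D \<sigma>) (x k - y k)) + P (D \<sigma>) (x k - y k)) \<longlonglongrightarrow> 0 + 0"
    using tendsto_add[OF diff0 conv[OF continuous_D, of \<sigma>]] by simp
  then have "(\<lambda>k. Q (x k - y k) * \<rho> 0) \<longlonglongrightarrow> 0 * \<rho> 0" unfolding Q_def by (intro tendsto_intros) simp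
  moreover have "(\<lambda>k. (D (x k - y k) z)\<^sup>2) \<longlonglongrightarrow> (D \<sigma> z)\<^sup>2"
    using conv[OF continuous_kernel, of z] unfolding conv_op_def by (intro tendsto_power)
  ultimately have "(D \<sigma> z)\<^sup>2 \<le> 0 * \<rho> 0"
    by (intro LIMSEQ_le) (use D_le_Q[OF discrete_diff[OF x(2) y(2)]] in blast)+
  then show ?thesis by (simp add: \<sigma>_def)
qed

lemma sol_unique_if_fundamental:
  assumes "\<rho>h \<in> L2" "\<rho>h \<in> C0 UNIV" "\<And>x. \<rho> x = fun_convolution \<rho>h \<rho>h x"
    and "fundamental_C0 \<Omega> (translates \<rho>h \<Omega>)"
  obtains \<mu>1 where "sol = {\<mu>1}"
proof -
  have on: "\<nu> \<in> measures_on \<Omega>" "nonneg_measure \<nu>" if "\<nu> \<in> sol" for \<nu>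
    using that by (auto simp: sol_iff weak_star_limit_point_def weak_star_tendsto_def)
  have "\<mu>1 = \<mu>2" if "\<mu>1 \<in> sol" "\<mu>2 \<in> sol" for \<mu>1 \<mu>2
    using fundamental_translates_injective[OF assms on(2,1)[OF that(1)] on(2,1)[OF that(2)] D_zero_sol[OF that]] .
  then show thesis using that sol_nonempty by (metis is_singletonI' is_singletonE)
qed

end

theorem theorem4p18:
  fixes \<Omega> :: "(real ^ 'n) set"
    and \<rho> :: "real ^ 'n \<Rightarrow> real" and \<rho>_hat :: "real ^ 'n \<Rightarrow> complex"
    and F :: "(real ^ 'n) radon \<Rightarrow> real" and F' :: "(real ^ 'n) radon \<Rightarrow> real ^ 'n \<Rightarrow> real"
    and \<mu> :: "nat \<Rightarrow> (real ^ 'n) radon"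
    and \<alpha> L \<tau> \<kappa> :: real and \<epsilon> :: "nat \<Rightarrow> real"
  assumes "compact \<Omega>"
    and "\<alpha> > 0"
    and "\<exists>x. \<rho> x \<noteq> 0" and "\<rho> \<in> C0 UNIV \<inter> L2"
    and "\<And>y. \<rho> (- y) = \<rho> y"
    and "has_fourier_L2 \<rho> \<rho>_hat" and "AE \<xi> in lborel. \<rho>_hat \<xi> \<in> \<real>\<^sub>\<ge>\<^sub>0"
    and "convex_on (measures_on \<Omega>) F"
    and "has_pre_derivative \<Omega> F F'"
    and "L \<ge> 0"
    and "\<And>\<mu> \<nu>. \<mu> \<in> measures_on \<Omega> \<Longrightarrow> \<nu> \<in> measures_on \<Omega> \<Longrightarrow>
           F \<nu> - F \<mu> - pairing \<Omega> (F' \<mu>) (\<nu> - \<mu>) \<le> L / 2 * (conv_norm \<rho> \<Omega> (\<nu> - \<mu>))\<^sup>2"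
    and "\<tau> > 0" and "\<tau> * L < 1"
    and "0 < \<kappa>" and "\<kappa> < 1"
    and "muFB \<Omega> \<rho> \<alpha> F' \<tau> \<kappa> \<epsilon> \<mu>"
    and "bdd_below (F ` measures_on \<Omega>)"
    and "\<And>\<mu> e. \<mu> \<in> measures_on \<Omega> \<Longrightarrow> e > 0 \<Longrightarrow>
           \<exists>d>0. \<forall>\<nu>\<in>measures_on \<Omega>. conv_norm \<rho> \<Omega> (\<nu> - \<mu>) < d \<longrightarrow>
             (\<forall>x\<in>\<Omega>. \<bar>F' \<nu> x - F' \<mu> x\<bar> < e)"
    and "\<And>k. \<epsilon> (Suc k) > 0" and "summable (\<lambda>k. \<epsilon> (Suc k))"
  defines "S \<equiv> {\<mu>'. weak_star_limit_point \<Omega> \<mu> \<mu>' \<and>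
                    (\<lambda>x. 0) \<in> pre_subdiff \<Omega> (\<lambda>\<nu>. ereal (F \<nu>) + reg_G \<alpha> \<nu>) \<mu>'}"
  shows "S \<noteq> {}
    \<and> (\<forall>\<mu>1\<in>S. \<forall>\<mu>2\<in>S. conv_norm \<rho> \<Omega> (\<mu>1 - \<mu>2) = 0)
    \<and> (\<forall>\<mu>1. S = {\<mu>1} \<longrightarrow> weak_star_tendsto \<Omega> \<mu> \<mu>1)
    \<and> ((\<exists>\<rho>h\<in>L2 \<inter> C0 UNIV. (\<forall>x. \<rho> x = fun_convolution \<rho>h \<rho>h x) \<and> fundamental_C0 \<Omega> (translates \<rho>h \<Omega>))
        \<longrightarrow> (\<exists>\<mu>1. S = {\<mu>1} \<and> weak_star_tendsto \<Omega> \<mu> \<mu>1))"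
proof -
  obtain B where B: "\<forall>x. \<bar>\<rho> x\<bar> \<le> B" using C0_UNIV_bounded assms(4) by blast
  have \<rho>_cont: "continuous_on UNIV \<rho>" using assms(4) C0_UNIV_continuous by blast
  \<comment> \<open>The bound B comes from decay at infinity, and the transform of \<rho> is used
    only to discharge positive definiteness.\<close>
  interpret forward_backward \<Omega> \<rho> B F F' \<mu> \<alpha> L \<tau> \<kappa> \<epsilon>
  proof
    show "0 \<le> (\<Sum>i\<in>I. \<Sum>j\<in>I. c i * c j * \<rho> (x i - x j))"
      if "finite I" for I :: "(real ^ 'n) option set" and c x
      by (rule positive_definite_of_fourier[OF \<rho>_cont _ assms(6,7) that]) (use B in blast)
  qed (use assms \<rho>_cont B in \<open>simp_all\<close>)
  have S: "S = sol" unfolding S_def sol_def ..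
  show ?thesis
    unfolding S
  proof (intro conjI ballI allI impI)
    show "sol \<noteq> {}" by (rule sol_nonempty)
    show "conv_norm \<rho> \<Omega> (\<mu>1 - \<mu>2) = 0" if "\<mu>1 \<in> sol" "\<mu>2 \<in> sol" for \<mu>1 \<mu>2
      using Q_zero_sol[OF that] by (simp add: conv_norm_eq)
    show "weak_star_tendsto \<Omega> \<mu> \<mu>1" if "sol = {\<mu>1}" for \<mu>1
      using that by (rule sol_singleton_convergence)
    assume "\<exists>\<rho>h\<in>L2 \<inter> C0 UNIV. (\<forall>x. \<rho> x = fun_convolution \<rho>h \<rho>h x) \<and> fundamental_C0 \<Omega> (translates \<rho>h \<Omega>)"
    then obtain \<mu>1 where "sol = {\<mu>1}" using sol_unique_if_fundamental by (metis IntD1 IntD2)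
    then show "\<exists>\<mu>1. sol = {\<mu>1} \<and> weak_star_tendsto \<Omega> \<mu> \<mu>1" using sol_singleton_convergence by blast
  qed
qed

end
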